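(* Let $p$ be an odd prime, let $m=3$ or $m=4$, and let $G$ be a group of order $2p^m$. Suppose that $(G,\{\sigma_1,\sigma_2\})$ is the automorphism group (with its distinguished generators) of a chiral polyhedron $\mathcal{P}$ of type $\{k_1,k_2\}$. Then $\mathcal{P}$ is tight, that is, $k_1k_2=2p^m$.
   Context: Abstract polyhedra. An abstract polyhedron (abstract polytope of rank $3$) is a partially ordered set $\mathcal{P}$ with a strictly monotone rank function with range $\{-1,0,1,2,3\}$ such that: (P1) there is a least face $F_{-1}$ and a greatest face $F_3$; (P2) every flag (maximal chain) contains exactly $5$ elements; (P3) any two flags $\Phi,\Psi$ can be joined by a sequence of flags $\Phi=\Phi_0,\dots,\Phi_k=\Psi$, each containing $\Phi\cap\Psi$, with consecutive flags differing in exactly one element; (P4) if $F<G$ have ranks $i-1$ and $i+1$ with $0\le i\le 2$, there are exactly two elements $H$ of rank $i$ with $F<H<G$. For a flag $\Phi$ and $i\in\{0,1,2\}$, $\Phi^i$ denotes the unique flag differing from $\Phi$ exactly in its element of rank $i$ (the $i$-adjacent flag). $\mathrm{Aut}(\mathcal{P})$ is the group of order-preserving permutations of $\mathcal{P}$ (acting on the right). $\mathcal{P}$ is chiral if $\mathrm{Aut}(\mathcal{P})$ has exactly two orbits on flags and adjacent flags always lie in different orbits. Then $\mathcal{P}$ is equivelar: it has type $\{k_1,k_2\}$ (an ordered pair), where $k_1$ is the number of edges of each $2$-face and $k_2$ is the valency of each vertex. Fix a base flag $\Phi$. The distinguished generators of $G=\mathrm{Aut}(\mathcal{P})$ are the automorphisms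 $\sigma_1,\sigma_2$ with $\sigma_j$ taking $\Phi$ to $(\Phi^{j})^{j-1}$; $\sigma_1,\sigma_2$ have orders $k_1,k_2$. "$(G,\{\sigma_1,\sigma_2\})$ is the automorphism group of $\mathcal{P}$" means $G=\mathrm{Aut}(\mathcal{P})$ with these generators. Standard group-theoretic characterization (Schulte–Weiss): a finite group $G$ with elements $\sigma_1,\sigma_2$ is of the form $(\mathrm{Aut}(\mathcal{P}),\{\sigma_1,\sigma_2\})$ for a chiral polyhedron $\mathcal{P}$ of type $\{k_1,k_2\}$ if and only if $G=\langle\sigma_1,\sigma_2\rangle$, $\sigma_1,\sigma_2,\sigma_1\sigma_2$ have orders $k_1,k_2,2$, $\langle\sigma_1\rangle\cap\langle\sigma_2\rangle=\{1\}$, and there is no automorphism $\alpha$ of $G$ with $\sigma_1^\alpha=\sigma_1^{-1}$ and $\sigma_2^\alpha=\sigma_2^{-1}$. The polyhedron $\mathcal{P}$ of type $\{k_1,k_2\}$ is tight if $|\mathrm{Aut}(\mathcal{P})|=k_1k_2$. *)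

theory Defs
  imports "HOL-Algebra.Group_Action" "HOL-Computational_Algebra.Primes"
begin

record 'a ranked_poset =
  faces :: "'a set"
  leq :: "'a rel"
  rk :: "'a \<Rightarrow> int"

definition lt :: "('a, 'b) ranked_poset_scheme \<Rightarrow> 'a \<Rightarrow> 'a \<Rightarrow> bool" where
  "lt P x y \<longleftrightarrow> (x, y) \<in> leq P \<and> x \<noteq> y"

definition flag :: "('a, 'b) ranked_poset_scheme \<Rightarrow> 'a set \<Rightarrow> bool" where
  "flag P \<Phi> \<longleftrightarrow> pred_on.maxchain (faces P) (lt P) \<Phi>"

definition adjacent :: "'a set \<Rightarrow> 'a set \<Rightarrow> bool" where
  "adjacent \<Phi> \<Psi> \<longleftrightarrow> card (\<Phi> - \<Psi>) = 1 \<and> card (\<Psi> - \<Phi>) = 1"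

locale polyhedron =
  fixes P :: "('a, 'b) ranked_poset_scheme"
  assumes partial_order: "partial_order_on (faces P) (leq P)"
    and rk_strict_mono: "monotone_on (faces P) (lt P) (<) (rk P)"
    and rk_range: "rk P ` faces P = {-1..3}"
    and P1_least: "\<exists>F\<in>faces P. \<forall>H\<in>faces P. (F, H) \<in> leq P"
    and P1_greatest: "\<exists>F\<in>faces P. \<forall>H\<in>faces P. (H, F) \<in> leq P"
    and P2: "flag P \<Phi> \<Longrightarrow> card \<Phi> = 5"
    and P3: "flag P \<Phi> \<Longrightarrow> flag P \<Psi> \<Longrightarrow>
      \<exists>(X :: nat \<Rightarrow> 'a set) k. X 0 = \<Phi> \<and> X k = \<Psi> \<and>
        (\<forall>i\<le>k. flag P (X i) \<and> \<Phi> \<inter> \<Psi> \<subseteq> X i) \<and>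
        (\<forall>i<k. adjacent (X i) (X (Suc i)))"
    and P4: "i \<in> {0, 1, 2} \<Longrightarrow> F \<in> faces P \<Longrightarrow> G \<in> faces P \<Longrightarrow> lt P F G \<Longrightarrow>
      rk P F = i - 1 \<Longrightarrow> rk P G = i + 1 \<Longrightarrow>
      card {H \<in> faces P. rk P H = i \<and> lt P F H \<and> lt P H G} = 2"

text \<open>
  The \<open>i\<close>-adjacent flag; in a polyhedron it exists and is unique
  for every flag and every \<open>i \<in> {0, 1, 2}\<close>.
\<close>
definition adj_flag :: "('a, 'b) ranked_poset_scheme \<Rightarrow> int \<Rightarrow> 'a set \<Rightarrow> 'a set" where
  "adj_flag P i \<Phi> = (THE \<Psi>. flag P \<Psi> \<and> \<Psi> \<noteq> \<Phi> \<and>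
     {x \<in> \<Psi>. rk P x \<noteq> i} = {x \<in> \<Phi>. rk P x \<noteq> i})"

text \<open>
  Automorphisms act on the right: the product \<open>f g\<close> applies \<open>f\<close> first.
  (The multiplication of \<^const>\<open>BijGroup\<close> is the opposite one.)
\<close>
definition Aut :: "('a, 'b) ranked_poset_scheme \<Rightarrow> ('a \<Rightarrow> 'a) monoid" where
  "Aut P =
    \<lparr>carrier = {f \<in> Bij (faces P).
        \<forall>x\<in>faces P. \<forall>y\<in>faces P. (f x, f y) \<in> leq P \<longleftrightarrow> (x, y) \<in> leq P},
     monoid.mult = \<lambda>f g. compose (faces P) g f,
     one = \<lambda>x\<in>faces P. x\<rparr>"

lemma group_Aut: "group (Aut P)"
proof (rule groupI)
  fix f assume f: "f \<in> carrier (Aut P)"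
  let ?g = "\<lambda>x\<in>faces P. inv_into (faces P) f x"
  have B: "f \<in> Bij (faces P)" using f by (simp add: Aut_def)
  then have im: "f ` faces P = faces P" by (simp add: Bij_def bij_betw_def)
  have "?g \<in> carrier (Aut P)"
    using f im restrict_inv_into_Bij[OF B]
    by (auto simp: Aut_def) (metis f_inv_into_f inv_into_into)+
  moreover have "compose (faces P) f ?g = (\<lambda>x\<in>faces P. x)"
    using im by (auto simp: compose_def f_inv_into_f)
  ultimately show "\<exists>g\<in>carrier (Aut P). g \<otimes>\<^bsub>Aut P\<^esub> f = \<one>\<^bsub>Aut P\<^esub>"
    by (intro bexI[of _ ?g]) (simp_all add: Aut_def)
next
  fix f g assume "f \<in> carrier (Aut P)" "g \<in> carrier (Aut P)"
  then show "f \<otimes>\<^bsub>Aut P\<^esub> g \<in> carrier (Aut P)"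
    using Bij_imp_funcset[of f "faces P"]
    by (auto simp: Aut_def compose_Bij compose_eq Pi_iff)
next
  fix f g h assume "f \<in> carrier (Aut P)" "g \<in> carrier (Aut P)" "h \<in> carrier (Aut P)"
  then show "f \<otimes>\<^bsub>Aut P\<^esub> g \<otimes>\<^bsub>Aut P\<^esub> h = f \<otimes>\<^bsub>Aut P\<^esub> (g \<otimes>\<^bsub>Aut P\<^esub> h)"
    by (simp add: Aut_def compose_assoc[OF Bij_imp_funcset])
qed (auto simp: Aut_def id_Bij intro: compose_Id Bij_imp_funcset Bij_imp_extensional)

definition chiral :: "('a, 'b) ranked_poset_scheme \<Rightarrow> bool" where
  "chiral P \<longleftrightarrow>
    card (orbits (Aut P) {\<Phi>. flag P \<Phi>} (\<lambda>f. (`) f)) = 2 \<and>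
    (\<forall>\<Phi> \<Psi>. flag P \<Phi> \<longrightarrow> flag P \<Psi> \<longrightarrow> adjacent \<Phi> \<Psi> \<longrightarrow>
       orbit (Aut P) (\<lambda>f. (`) f) \<Phi> \<noteq> orbit (Aut P) (\<lambda>f. (`) f) \<Psi>)"

definition edges_of_face :: "('a, 'b) ranked_poset_scheme \<Rightarrow> 'a \<Rightarrow> 'a set" where
  "edges_of_face P F = {E \<in> faces P. rk P E = 1 \<and> lt P E F}"

definition edges_at_vertex :: "('a, 'b) ranked_poset_scheme \<Rightarrow> 'a \<Rightarrow> 'a set" where
  "edges_at_vertex P v = {E \<in> faces P. rk P E = 1 \<and> lt P v E}"

definition has_type :: "('a, 'b) ranked_poset_scheme \<Rightarrow> nat \<Rightarrow> nat \<Rightarrow> bool" where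
  "has_type P k1 k2 \<longleftrightarrow>
    (\<forall>F\<in>faces P. rk P F = 2 \<longrightarrow>
       finite (edges_of_face P F) \<and> card (edges_of_face P F) = k1) \<and>
    (\<forall>v\<in>faces P. rk P v = 0 \<longrightarrow>
       finite (edges_at_vertex P v) \<and> card (edges_at_vertex P v) = k2)"

definition distinguished_generators ::
    "('a, 'b) ranked_poset_scheme \<Rightarrow> 'a set \<Rightarrow> ('a \<Rightarrow> 'a) \<Rightarrow> ('a \<Rightarrow> 'a) \<Rightarrow> bool" where
  "distinguished_generators P \<Phi> \<sigma>1 \<sigma>2 \<longleftrightarrow>
    \<sigma>1 \<in> carrier (Aut P) \<and> \<sigma>1 ` \<Phi> = adj_flag P 0 (adj_flag P 1 \<Phi>) \<and>
    \<sigma>2 \<in> carrier (Aut P) \<and> \<sigma>2 ` \<Phi> = adj_flag P 1 (adj_flag P 2 \<Phi>)"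

text \<open>
  Finiteness is required since \<^const>\<open>order\<close> is \<open>0\<close> on infinite carriers.
\<close>
definition tight :: "('a, 'b) ranked_poset_scheme \<Rightarrow> bool" where
  "tight P \<longleftrightarrow> finite (carrier (Aut P)) \<and>
    (\<exists>k1 k2. has_type P k1 k2 \<and> order (Aut P) = k1 * k2)"

end

theory Submission
  imports Defs "HOL-Algebra.Sylow" "HOL-Algebra.Multiplicative_Group"
begin

text \<open>
  Put \<open>x = \<sigma>1\<close> and \<open>y = inv \<sigma>2\<close>, so that \<open>t = x inv y\<close> is an involution, and let \<open>P\<close> be the Sylow
  \<open>p\<close>-subgroup, which has index 2. Exactly one of \<open>x\<close>, \<open>y\<close> lies in \<open>P\<close>, say \<open>x\<close>; then \<open>P\<close> is
  generated by \<open>x\<close> and its conjugate \<open>b = t x t\<close>, and \<open>y\<^sup>2 = b x\<close>. As \<open>\<langle>x\<rangle>\<close> and \<open>\<langle>y\<rangle>\<close> meet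
  trivially, it is enough to show that \<open>|x| |b x| \<ge> p\<^sup>m\<close>. If \<open>P\<close> is abelian this is a count. Otherwise, whenever
  the inequality fails, \<open>x\<close> and \<open>b\<close> satisfy relations that present a group of order at most \<open>p\<^sup>m\<close>
  and that are preserved by inverting \<open>x\<close> and \<open>b\<close>. So there is an automorphism inverting \<open>x\<close> and fixing \<open>t\<close>;
  up to conjugation it inverts \<open>\<sigma>1\<close> and \<open>\<sigma>2\<close>, which chirality forbids. In class 3 (only possible
  for \<open>m = 4\<close>) such relations always hold.
\<close>

section \<open>Presentations and inverting automorphisms\<close>

text \<open>The automorphism is obtained without ever constructing the presented group. Instead
  there is a bound valid in every group: elements satisfying the relations generate at most
  \<open>2 * q * r * (w * s)\<close> elements. Applied to \<open>(a, inv a)\<close> and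
  \<open>(t, t)\<close> in the direct square of \<open>G\<close>, it leaves room for nothing but the
  graph of an automorphism, so consistency of the relations is never at stake. Taking
  \<open>inv \<sigma>2\<close> instead of \<open>\<sigma>2\<close> makes the hypotheses symmetric in
  \<open>x\<close> and \<open>y\<close>, so the case that \<open>y\<close> lies in the Sylow
  subgroup is the other case with the names exchanged. In class 3 the expansion of a
  \<open>p\<close>-th power of a product would contain a term with exponent
  \<open>p choose 3\<close>, which does not vanish for \<open>p = 3\<close>. It is avoided: products
  are raised to the power \<open>p\<close> only in class 2, while in class 3 only the commutator of
  \<open>x [^] p\<close> with \<open>b\<close> is expanded, where \<open>p choose 2\<close> is the
  worst exponent.\<close>

text \<open>Inverses come for free from finiteness: left multiplication by a generator is injective
  on \<open>S\<close>, hence permutes it, and so does its inverse.\<close>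

lemma (in group) generate_subset_if_left_closed:
  assumes S: "S \<subseteq> carrier G" "finite S" "\<one> \<in> S" and X: "X \<subseteq> carrier G"
    and closed: "\<And>x s. x \<in> X \<Longrightarrow> s \<in> S \<Longrightarrow> x \<otimes> s \<in> S"
  shows "generate G X \<subseteq> S"
proof -
  have "\<forall>s\<in>S. x \<otimes> s \<in> S" if "x \<in> generate G X" for x
    using that
  proof (induction rule: generate.induct)
    case one
    then show ?case using S by auto
  next
    case (incl h)
    then show ?case using closed by blast
  next
    case (inv h)
    then have h: "h \<in> carrier G" using X by blast
    have "inj_on ((\<otimes>) h) S" using h S(1) by (auto simp: inj_on_def subset_iff)
    moreover have "(\<otimes>) h ` S \<subseteq> S" using closed inv by blast
    ultimately have im: "(\<otimes>) h ` S = S" using S(2) by (simp add: endo_inj_surj)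
    show ?case
    proof
      fix s assume "s \<in> S"
      then obtain s' where s': "s' \<in> S" "s = h \<otimes> s'" using im by blast
      then have "inv h \<otimes> s = s'" using h S(1) by (metis subsetD inv_solve_left m_closed)
      then show "inv h \<otimes> s \<in> S" using s' by simp
    qed
  next
    case (eng h1 h2)
    have "h1 \<in> carrier G" "h2 \<in> carrier G" using eng.hyps X generate_in_carrier by auto
    then show ?case using eng.IH S(1) by (simp add: m_assoc subset_iff)
  qed
  then show ?thesis using S X generate_in_carrier by (metis r_one subsetI)
qed

section \<open>Normal forms modulo a set of commutators\<close>

lemma (in group) pow_push:
  assumes "x \<in> carrier G" "M \<subseteq> carrier G"
    and "\<And>w. w \<in> M \<Longrightarrow> \<exists>w'\<in>M. w \<otimes> x = x \<otimes> w'" and "w \<in> M"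
  shows "\<exists>w'\<in>M. w \<otimes> x [^] (n::nat) = x [^] n \<otimes> w'"
  using assms(4)
proof (induction n arbitrary: w)
  case 0
  then show ?case using assms by (auto simp: subset_iff)
next
  case (Suc n)
  obtain w1 where w1: "w1 \<in> M" "w \<otimes> x [^] n = x [^] n \<otimes> w1" using Suc by blast
  obtain w2 where w2: "w2 \<in> M" "w1 \<otimes> x = x \<otimes> w2" using w1 assms(3) by blast
  have "w \<otimes> x [^] Suc n = x [^] n \<otimes> w1 \<otimes> x"
    using w1 Suc.prems assms(1,2) by (simp add: m_assoc[symmetric] subset_iff)
  also have "\<dots> = x [^] Suc n \<otimes> w2" using w1 w2 assms(1,2) by (simp add: m_assoc subset_iff)
  finally show ?case using w2 by blast
qed

text \<open>Pushing collects all factors from \<open>M\<close> on the right, so modulo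
  \<open>M\<close> the element behaves like a pure power of \<open>x\<close>.\<close>

lemma (in group) pow_mult_in:
  assumes "x \<in> carrier G" "M \<subseteq> carrier G" "\<one> \<in> M" "\<And>v w. v \<in> M \<Longrightarrow> w \<in> M \<Longrightarrow> v \<otimes> w \<in> M"
    and push: "\<And>w. w \<in> M \<Longrightarrow> \<exists>w'\<in>M. w \<otimes> x = x \<otimes> w'" and "w \<in> M"
  shows "\<exists>w'\<in>M. (x [^] (i::nat) \<otimes> w) [^] (n::nat) = x [^] (i * n) \<otimes> w'"
proof (induction n)
  case 0
  then show ?case using assms by (auto simp: subset_iff)
next
  case (Suc n)
  then obtain w1 where w1: "w1 \<in> M" "(x [^] i \<otimes> w) [^] n = x [^] (i * n) \<otimes> w1" by blast
  obtain w2 where w2: "w2 \<in> M" "w1 \<otimes> x [^] i = x [^] i \<otimes> w2"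
    using pow_push[OF assms(1,2) push w1(1)] by blast
  have "(x [^] i \<otimes> w) [^] Suc n = x [^] (i * n) \<otimes> (w1 \<otimes> x [^] i) \<otimes> w"
    using w1 assms(1,2,6) by (simp add: m_assoc subset_iff)
  also have "\<dots> = x [^] (i * n) \<otimes> x [^] i \<otimes> (w2 \<otimes> w)"
    using w2 assms(1,2,6) by (simp add: m_assoc subset_iff)
  also have "\<dots> = x [^] (i * Suc n) \<otimes> (w2 \<otimes> w)"
    using assms(1) by (simp add: nat_pow_mult algebra_simps)
  finally show ?case using assms w2 by blast
qed

text \<open>
  The set of all \<open>a\<^sup>i b\<^sup>j w\<close> and \<open>a\<^sup>i b\<^sup>j w t\<close> with \<open>w \<in> M\<close> is closed under left multiplication
  by \<open>a\<close> and \<open>t\<close>; no uniqueness of these normal forms is needed.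
\<close>
lemma (in group) card_generate_le:
  fixes q r :: nat
  assumes M: "finite M" "M \<subseteq> carrier G" "\<one> \<in> M" "\<And>v w. v \<in> M \<Longrightarrow> w \<in> M \<Longrightarrow> v \<otimes> w \<in> M"
    and abt: "a \<in> carrier G" "b \<in> carrier G" "t \<in> carrier G"
    and t: "t \<otimes> a = b \<otimes> t" "t \<otimes> b = a \<otimes> t" "t \<otimes> t = \<one>"
    and Ma: "\<And>w. w \<in> M \<Longrightarrow> \<exists>w'\<in>M. w \<otimes> a = a \<otimes> w'"
    and Mb: "\<And>w. w \<in> M \<Longrightarrow> \<exists>w'\<in>M. w \<otimes> b = b \<otimes> w'"
    and Mt: "\<And>w. w \<in> M \<Longrightarrow> \<exists>w'\<in>M. t \<otimes> w = w' \<otimes> t"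
    and ba: "\<exists>w\<in>M. b \<otimes> a = a \<otimes> b \<otimes> w"
    and q: "0 < q" "a [^] q \<in> M"
    and r: "0 < r" "\<exists>i::nat. \<exists>w\<in>M. b [^] r = a [^] i \<otimes> w"
  shows "card (generate G {a, t}) \<le> 2 * q * r * card M"
proof -
  define S0 where "S0 = {a [^] i \<otimes> b [^] j \<otimes> w |(i::nat) (j::nat) w. w \<in> M}"
  define S where "S = S0 \<union> (\<lambda>s. s \<otimes> t) ` S0"
  note cl = abt subsetD[OF M(2)]
  have S0c: "S0 \<subseteq> carrier G" unfolding S0_def using cl by auto
  have S0I: "a [^] i \<otimes> b [^] j \<otimes> w \<in> S0" if "w \<in> M" for i j :: nat and w
    unfolding S0_def using that by blast
  have S0E: thesis if "s \<in> S0" "\<And>(i::nat) (j::nat) w. s = a [^] i \<otimes> b [^] j \<otimes> w \<Longrightarrow> w \<in> M \<Longrightarrow> thesis" for s thesis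
    using that unfolding S0_def by auto
  have aS: "a \<otimes> s \<in> S0" if sS: "s \<in> S0" for s
  proof -
    obtain i j :: nat and w where s: "s = a [^] i \<otimes> b [^] j \<otimes> w" "w \<in> M"
      using sS by (rule S0E)
    have "a \<otimes> s = a [^] Suc i \<otimes> b [^] j \<otimes> w"
      using s cl by (simp only: nat_pow_Suc2) (simp add: m_assoc)
    then show ?thesis using S0I s by metis
  qed
  obtain w0 where w0: "w0 \<in> M" "b \<otimes> a = a \<otimes> b \<otimes> w0" using ba by blast
  have bai: "\<exists>w\<in>M. b \<otimes> a [^] i = a [^] i \<otimes> b \<otimes> w" for i :: nat
  proof (induction i)
    case 0
    then show ?case using cl M by auto
  next
    case (Suc i)
    then obtain w1 where w1: "w1 \<in> M" "b \<otimes> a [^] i = a [^] i \<otimes> b \<otimes> w1" by blast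
    obtain w2 where w2: "w2 \<in> M" "w1 \<otimes> a = a \<otimes> w2" using Ma w1 by blast
    have "b \<otimes> a [^] Suc i = (b \<otimes> a [^] i) \<otimes> a" using cl by (simp add: m_assoc)
    also have "\<dots> = a [^] i \<otimes> b \<otimes> (w1 \<otimes> a)" using w1 cl by (simp add: m_assoc)
    also have "\<dots> = a [^] i \<otimes> (b \<otimes> a) \<otimes> w2" using w2 cl by (simp add: m_assoc)
    also have "\<dots> = a [^] Suc i \<otimes> b \<otimes> (w0 \<otimes> w2)" unfolding w0(2) using w0(1) w2 cl by (simp add: m_assoc)
    finally show ?case using w0 w2 M by blast
  qed
  have bS: "b \<otimes> s \<in> S0" if sS: "s \<in> S0" for s
  proof -
    obtain i j :: nat and w where s: "s = a [^] i \<otimes> b [^] j \<otimes> w" "w \<in> M"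
      using sS by (rule S0E)
    obtain w1 where w1: "w1 \<in> M" "b \<otimes> a [^] i = a [^] i \<otimes> b \<otimes> w1" using bai by blast
    obtain w2 where w2: "w2 \<in> M" "w1 \<otimes> b [^] j = b [^] j \<otimes> w2"
      using pow_push[OF abt(2) M(2) Mb w1(1)] by blast
    have "b \<otimes> s = (b \<otimes> a [^] i) \<otimes> b [^] j \<otimes> w" using s cl by (simp add: m_assoc)
    also have "\<dots> = a [^] i \<otimes> b \<otimes> (w1 \<otimes> b [^] j) \<otimes> w" using w1 s cl by (simp add: m_assoc)
    also have "\<dots> = a [^] i \<otimes> (b \<otimes> b [^] j) \<otimes> (w2 \<otimes> w)" using w2 s cl by (simp add: m_assoc)
    also have "\<dots> = a [^] i \<otimes> b [^] Suc j \<otimes> (w2 \<otimes> w)" using cl by (simp only: nat_pow_Suc2)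
    finally show ?thesis using S0I[OF M(4)[OF w2(1) s(2)], of i "Suc j"] by (simp only:)
  qed
  have bnS: "b [^] n \<otimes> s \<in> S0" if "s \<in> S0" for n :: nat and s
    using that
  proof (induction n arbitrary: s)
    case 0
    then show ?case using S0c by auto
  next
    case (Suc n)
    have "b [^] Suc n \<otimes> s = b [^] n \<otimes> (b \<otimes> s)"
      using cl subsetD[OF S0c Suc.prems] by (simp add: m_assoc)
    then show ?case using Suc.IH[OF bS[OF Suc.prems]] by simp
  qed
  have tpow: "t \<otimes> x [^] n = y [^] n \<otimes> t"
    if "t \<otimes> x = y \<otimes> t" "x \<in> carrier G" "y \<in> carrier G" for x y and n :: nat
  proof (induction n)
    case 0
    then show ?case using cl by simp
  next
    case (Suc n)
    have "t \<otimes> x [^] Suc n = (t \<otimes> x [^] n) \<otimes> x" using cl that by (simp add: m_assoc)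
    also have "\<dots> = y [^] n \<otimes> (t \<otimes> x)" using Suc cl that by (simp add: m_assoc)
    finally show ?case using cl that by (simp add: m_assoc)
  qed
  \<comment> \<open>Moving \<open>t\<close> to the right exchanges \<open>a\<close> and
    \<open>b\<close>, so the powers come out in the wrong order; \<open>bnS\<close> sorts them
    again.\<close>
  have tS: "\<exists>s'\<in>S0. t \<otimes> s = s' \<otimes> t" if sS: "s \<in> S0" for s
  proof -
    obtain i j :: nat and w where s: "s = a [^] i \<otimes> b [^] j \<otimes> w" "w \<in> M"
      using sS by (rule S0E)
    obtain w1 where w1: "w1 \<in> M" "t \<otimes> w = w1 \<otimes> t" using Mt s by blast
    have "t \<otimes> s = (t \<otimes> a [^] i) \<otimes> b [^] j \<otimes> w" using s cl by (simp add: m_assoc)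
    also have "\<dots> = b [^] i \<otimes> (t \<otimes> b [^] j) \<otimes> w" using s cl tpow[OF t(1)] by (simp add: m_assoc)
    also have "\<dots> = b [^] i \<otimes> a [^] j \<otimes> (t \<otimes> w)" using s cl tpow[OF t(2)] by (simp add: m_assoc)
    also have "\<dots> = (b [^] i \<otimes> (a [^] j \<otimes> b [^] (0::nat) \<otimes> w1)) \<otimes> t" using s cl w1 by (simp add: m_assoc)
    finally show ?thesis using bnS S0I w1 by blast
  qed
  let ?f = "\<lambda>(i, j, w). a [^] (i::nat) \<otimes> b [^] (j::nat) \<otimes> w"
  \<comment> \<open>The surplus of the exponent of \<open>b\<close> is removed first, because
    \<open>b [^] r\<close> contributes a power of \<open>a\<close>; only then is the total exponent
    of \<open>a\<close> reduced modulo \<open>q\<close>, the surplus going into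
    \<open>M\<close>.\<close>
  have bound: "S0 \<subseteq> ?f ` ({..<q} \<times> {..<r} \<times> M)"
  proof
    fix s assume "s \<in> S0"
    then obtain i j :: nat and w where s: "s = a [^] i \<otimes> b [^] j \<otimes> w" "w \<in> M"
      by (rule S0E)
    obtain k :: nat and w1 where w1: "w1 \<in> M" "b [^] r = a [^] k \<otimes> w1" using r by blast
    let ?d = "j div r" and ?e = "j mod r"
    obtain w2 where w2: "w2 \<in> M" "(a [^] k \<otimes> w1) [^] ?d = a [^] (k * ?d) \<otimes> w2"
      using pow_mult_in[OF abt(1) M(2,3,4) Ma w1(1)] by blast
    have "b [^] j = b [^] (r * ?d) \<otimes> b [^] ?e" using cl by (simp add: nat_pow_mult)
    also have "b [^] (r * ?d) = a [^] (k * ?d) \<otimes> w2" using w1 w2 cl by (simp add: nat_pow_pow[symmetric])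
    finally have bj: "b [^] j = a [^] (k * ?d) \<otimes> w2 \<otimes> b [^] ?e" .
    obtain w3 where w3: "w3 \<in> M" "w2 \<otimes> b [^] ?e = b [^] ?e \<otimes> w3"
      using pow_push[OF abt(2) M(2) Mb w2(1)] by blast
    define i' where "i' = i + k * ?d"
    have s2: "s = a [^] i' \<otimes> b [^] ?e \<otimes> (w3 \<otimes> w)"
    proof -
      have "s = a [^] i \<otimes> a [^] (k * ?d) \<otimes> (w2 \<otimes> b [^] ?e) \<otimes> w"
        unfolding s(1) bj using cl s w2 by (simp add: m_assoc)
      then show ?thesis unfolding w3(2) i'_def using cl s w3 by (simp add: m_assoc nat_pow_mult[symmetric])
    qed
    have "(a [^] q) [^] n \<in> M" for n :: nat
      by (induction n) (use M q in auto)
    then have w4: "a [^] (q * (i' div q)) \<in> M" using cl by (simp add: nat_pow_pow)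
    obtain w5 where w5: "w5 \<in> M" "a [^] (q * (i' div q)) \<otimes> b [^] ?e = b [^] ?e \<otimes> w5"
      using pow_push[OF abt(2) M(2) Mb w4] by blast
    have "a [^] i' = a [^] (i' mod q) \<otimes> a [^] (q * (i' div q))" using cl by (simp add: nat_pow_mult)
    then have "s = a [^] (i' mod q) \<otimes> (a [^] (q * (i' div q)) \<otimes> b [^] ?e) \<otimes> (w3 \<otimes> w)"
      using s2 cl s w3 by (simp add: m_assoc)
    then have "s = a [^] (i' mod q) \<otimes> b [^] ?e \<otimes> (w5 \<otimes> (w3 \<otimes> w))"
      unfolding w5(2) using cl s w3 w5 by (simp add: m_assoc)
    then have "s = ?f (i' mod q, ?e, w5 \<otimes> (w3 \<otimes> w))" by simp
    moreover have "(i' mod q, ?e, w5 \<otimes> (w3 \<otimes> w)) \<in> {..<q} \<times> {..<r} \<times> M"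
      using q r M w3 w5 s by simp
    ultimately show "s \<in> ?f ` ({..<q} \<times> {..<r} \<times> M)" by blast
  qed
  have finS0: "finite S0" using bound M(1) by (meson finite_SigmaI finite_imageI finite_lessThan finite_subset)
  have cS0: "card S0 \<le> q * r * card M"
  proof -
    have "card S0 \<le> card ({..<q} \<times> {..<r} \<times> M)" using surj_card_le[OF _ bound] M(1) by blast
    then show ?thesis by (simp add: card_cartesian_product mult.assoc)
  qed
  have sub: "generate G {a, t} \<subseteq> S"
  proof (rule generate_subset_if_left_closed)
    show "S \<subseteq> carrier G" unfolding S_def using S0c cl by auto
    show "finite S" unfolding S_def using finS0 by blast
    have "a [^] (0::nat) \<otimes> b [^] (0::nat) \<otimes> \<one> \<in> S0" using S0I M by blast
    then show "\<one> \<in> S" unfolding S_def by simp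
    show "{a, t} \<subseteq> carrier G" using abt by blast
    fix x s assume x: "x \<in> {a, t}" and s: "s \<in> S"
    obtain s0 where s0: "s0 \<in> S0" "s = s0 \<or> s = s0 \<otimes> t" using s unfolding S_def by blast
    have s0c: "s0 \<in> carrier G" using S0c s0 by blast
    obtain s1 where s1: "s1 \<in> S0" "t \<otimes> s0 = s1 \<otimes> t" using tS s0 by blast
    have s1c: "s1 \<in> carrier G" using S0c s1 by blast
    have "a \<otimes> (s0 \<otimes> t) = (a \<otimes> s0) \<otimes> t" using cl s0c by (simp add: m_assoc)
    moreover have "t \<otimes> (s0 \<otimes> t) = s1"
    proof -
      have "t \<otimes> (s0 \<otimes> t) = (t \<otimes> s0) \<otimes> t" using cl s0c by (simp add: m_assoc)
      also have "\<dots> = s1 \<otimes> (t \<otimes> t)" unfolding s1(2) using cl s1c by (simp add: m_assoc)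
      finally show ?thesis using t s1c by simp
    qed
    ultimately show "x \<otimes> s \<in> S" using x s0 s1 aS[OF s0(1)] unfolding S_def by auto
  qed
  have "card S \<le> card S0 + card S0"
    unfolding S_def using card_Un_le[of S0 "(\<lambda>s. s \<otimes> t) ` S0"] card_image_le[OF finS0, of "\<lambda>s. s \<otimes> t"] by linarith
  moreover have "card (generate G {a, t}) \<le> card S"
    using sub finS0 unfolding S_def by (simp add: card_mono)
  moreover have "2 * q * r * card M = q * r * card M + q * r * card M" by (simp add: algebra_simps)
  ultimately show "card (generate G {a, t}) \<le> 2 * q * r * card M" using cS0 by linarith
qed

lemma (in group) pow_intertwine:
  assumes "x \<in> carrier G" "y \<in> carrier G" "g \<in> carrier G" "g \<otimes> x = y \<otimes> g"
  shows "g \<otimes> x [^] (n::nat) = y [^] n \<otimes> g"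
proof (induction n)
  case 0
  then show ?case using assms by simp
next
  case (Suc n)
  have "g \<otimes> x [^] Suc n = (g \<otimes> x [^] n) \<otimes> x" using assms by (simp add: m_assoc)
  also have "\<dots> = y [^] n \<otimes> (g \<otimes> x)" using Suc assms by (simp add: m_assoc)
  finally show ?case using assms by (simp add: m_assoc)
qed

lemma (in group) inv_mult_cancel:
  assumes "x \<in> carrier G" "y \<in> carrier G"
  shows "inv x \<otimes> (x \<otimes> y) = y" "x \<otimes> (inv x \<otimes> y) = y"
  using assms by (simp_all add: m_assoc[symmetric])

lemma (in group) commute_inv:
  assumes "x \<in> carrier G" "y \<in> carrier G" "x \<otimes> y = y \<otimes> x"
  shows "inv x \<otimes> y = y \<otimes> inv x"
  using assms by (metis inv_closed inv_solve_left inv_solve_right m_assoc m_closed)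

lemma (in group) inv_eq_pow:
  assumes "x \<in> carrier G" "x [^] (n::nat) = \<one>" "0 < n"
  shows "inv x = x [^] (n - 1)"
  using assms by (metis Suc_diff_1 inv_equality nat_pow_Suc nat_pow_closed)

text \<open>Conjugation by \<open>t\<close> exchanges \<open>a\<close> and \<open>b\<close>, and
  exchanging the entries of a commutator inverts it.\<close>

lemma (in group) swap_commutator:
  assumes cl: "a \<in> carrier G" "b \<in> carrier G" "t \<in> carrier G" "z \<in> carrier G"
    and t: "t \<otimes> a = b \<otimes> t" and tb: "t \<otimes> b = a \<otimes> t" and ab: "a \<otimes> b = b \<otimes> a \<otimes> z"
  shows "t \<otimes> z = inv z \<otimes> t"
proof -
  have ta': "t \<otimes> (a \<otimes> y) = b \<otimes> (t \<otimes> y)" and tb': "t \<otimes> (b \<otimes> y) = a \<otimes> (t \<otimes> y)"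
    if "y \<in> carrier G" for y
    using t tb cl that by (simp_all add: m_assoc[symmetric])
  have "a \<otimes> b \<otimes> (t \<otimes> z) = t \<otimes> (b \<otimes> a \<otimes> z)" using ta' tb' cl by (simp add: m_assoc)
  also have "\<dots> = t \<otimes> a \<otimes> b" using ab cl by (simp add: m_assoc)
  also have "\<dots> = b \<otimes> a \<otimes> t" using ta' tb cl by (simp add: m_assoc)
  also have "\<dots> = b \<otimes> a \<otimes> z \<otimes> inv z \<otimes> t" using cl by (simp add: m_assoc inv_mult_cancel)
  also have "\<dots> = a \<otimes> b \<otimes> (inv z \<otimes> t)" using ab cl by (simp add: m_assoc inv_mult_cancel)
  finally show ?thesis using cl by simp
qed

text \<open>Conjugation by \<open>t\<close> turns the commutator of \<open>z\<close> with
  \<open>a\<close> into that of \<open>inv z\<close> with \<open>b\<close>, and the latter is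
  \<open>inv d\<close> because \<open>d\<close> commutes with \<open>z\<close>.\<close>

lemma (in group) swap_double_commutator:
  assumes cl: "a \<in> carrier G" "b \<in> carrier G" "t \<in> carrier G" "z \<in> carrier G" "c \<in> carrier G"
    and dc: "d \<in> carrier G"
    and t: "t \<otimes> a = b \<otimes> t" and tb: "t \<otimes> b = a \<otimes> t" and ab: "a \<otimes> b = b \<otimes> a \<otimes> z"
    and za: "z \<otimes> a = a \<otimes> z \<otimes> c" and zb: "z \<otimes> b = b \<otimes> z \<otimes> d" and dz: "d \<otimes> z = z \<otimes> d"
  shows "t \<otimes> c = inv d \<otimes> t"
proof -
  note tz = swap_commutator[OF cl(1-4) t tb ab]
  have zib: "inv z \<otimes> b = b \<otimes> inv z \<otimes> inv d"
  proof -
    have "z \<otimes> (b \<otimes> inv z \<otimes> inv d) = z \<otimes> b \<otimes> (inv z \<otimes> inv d)" using cl dc by (simp add: m_assoc)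
    also have "\<dots> = b \<otimes> (z \<otimes> d) \<otimes> (inv z \<otimes> inv d)" using zb cl dc by (simp add: m_assoc)
    also have "inv z \<otimes> inv d = inv (z \<otimes> d)" using dz dc cl by (metis inv_mult_group)
    finally have "z \<otimes> (b \<otimes> inv z \<otimes> inv d) = b" using cl dc by (simp add: m_assoc)
    then show ?thesis using cl dc by (metis inv_closed inv_solve_left m_closed)
  qed
  have "b \<otimes> inv z \<otimes> (t \<otimes> c) = t \<otimes> (a \<otimes> z \<otimes> c)"
    using t tz cl by (metis inv_closed m_assoc m_closed)
  also have "\<dots> = t \<otimes> z \<otimes> a" using za cl by (simp add: m_assoc)
  also have "\<dots> = inv z \<otimes> b \<otimes> t" using tz t cl by (simp add: m_assoc)
  also have "\<dots> = b \<otimes> inv z \<otimes> (inv d \<otimes> t)" using zib cl dc by (simp add: m_assoc)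
  finally show ?thesis using cl dc by simp
qed

text \<open>A presentation of class at most 3: \<open>z\<close> is the commutator of
  \<open>a\<close> and \<open>b\<close>, and its own commutators with them are \<open>c\<close> and
  \<open>c [^] n\<close>, so they lie in one cyclic group. Class 2 is the case
  \<open>c = \<one>\<close>. Two relations for \<open>t\<close> suffice, since its action on
  \<open>z\<close> and \<open>c\<close> is forced by the swap lemmas.\<close>

lemma (in group) card_generate_le_of_relations:
  fixes w s q r n k i j :: nat
  assumes cl: "a \<in> carrier G" "b \<in> carrier G" "t \<in> carrier G" "z \<in> carrier G" "c \<in> carrier G"
    and t: "t \<otimes> a = b \<otimes> t" "t \<otimes> t = \<one>"
    and ab: "a \<otimes> b = b \<otimes> a \<otimes> z"
    and za: "z \<otimes> a = a \<otimes> z \<otimes> c" and zb: "z \<otimes> b = b \<otimes> z \<otimes> c [^] n"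
    and ca: "c \<otimes> a = a \<otimes> c" and cb: "c \<otimes> b = b \<otimes> c"
    and z: "0 < w" "z [^] w = \<one>" and c: "0 < s" "c [^] s = \<one>"
    and aq: "0 < q" "a [^] q = c [^] k" and br: "0 < r" "b [^] r = a [^] i \<otimes> c [^] j"
  shows "card (generate G {a, t}) \<le> 2 * q * r * (w * s)"
proof -
  have tb: "t \<otimes> b = a \<otimes> t"
  proof -
    have "t \<otimes> b \<otimes> t = t \<otimes> (t \<otimes> a)" unfolding t(1) using cl by (simp add: m_assoc)
    also have "\<dots> = (t \<otimes> t) \<otimes> a" using cl by (simp add: m_assoc)
    also have "\<dots> = a \<otimes> (t \<otimes> t)" using t cl by simp
    also have "\<dots> = a \<otimes> t \<otimes> t" using cl by (simp add: m_assoc)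
    finally show ?thesis using cl by simp
  qed
  have cz: "c \<otimes> z = z \<otimes> c"
  proof -
    have "b \<otimes> a \<otimes> (c \<otimes> z) = b \<otimes> (c \<otimes> a) \<otimes> z" using ca cl by (simp add: m_assoc)
    also have "\<dots> = c \<otimes> (b \<otimes> a \<otimes> z)" using cb cl by (simp add: m_assoc[symmetric])
    also have "\<dots> = c \<otimes> a \<otimes> b" using ab cl by (simp add: m_assoc)
    also have "\<dots> = a \<otimes> (c \<otimes> b)" using ca cl by (simp add: m_assoc)
    also have "\<dots> = a \<otimes> b \<otimes> c" using cb cl by (simp add: m_assoc)
    also have "\<dots> = b \<otimes> a \<otimes> (z \<otimes> c)" using ab cl by (simp add: m_assoc)
    finally show ?thesis using cl by simp
  qed
  \<comment> \<open>Natural exponents are enough, because \<open>z\<close> and \<open>c\<close> have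
    finite order; this also gives the size of \<open>M\<close>.\<close>
  define M where "M = (\<lambda>(x, y). z [^] (x::nat) \<otimes> c [^] (y::nat)) ` UNIV"
  have MI: "z [^] (x::nat) \<otimes> c [^] (y::nat) \<in> M" for x y unfolding M_def by force
  have ME: thesis if "v \<in> M" "\<And>(x::nat) (y::nat). v = z [^] x \<otimes> c [^] y \<Longrightarrow> thesis" for v thesis
    using that unfolding M_def by auto
  have comm: "c [^] (x::nat) \<otimes> y = y \<otimes> c [^] x" if "c \<otimes> y = y \<otimes> c" "y \<in> carrier G" for x y
    using pow_intertwine[of c c y x] that cl by simp
  have czp: "c [^] (x::nat) \<otimes> z [^] (y::nat) = z [^] y \<otimes> c [^] x" for x y
    using pow_intertwine[of z z "c [^] x" y] comm[OF cz cl(4), of x] cl by simp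
  have mod: "x [^] (u::nat) = x [^] (u mod v)" if "x [^] v = \<one>" "x \<in> carrier G" for x u and v :: nat
  proof -
    have "x [^] u = (x [^] v) [^] (u div v) \<otimes> x [^] (u mod v)"
      using that(2) by (simp add: nat_pow_pow nat_pow_mult)
    then show ?thesis using that by simp
  qed
  have zpow: "\<exists>y. z [^] x \<otimes> g = g \<otimes> (z [^] x \<otimes> c [^] (y::nat))"
    if "z \<otimes> g = g \<otimes> z \<otimes> c [^] m" "g \<in> carrier G" for g and x m :: nat
  proof -
    have "g \<otimes> (z \<otimes> c [^] m) = z \<otimes> g" using that cl by (simp add: m_assoc)
    then have "z [^] x \<otimes> g = g \<otimes> (z \<otimes> c [^] m) [^] x"
      using pow_intertwine[of "z \<otimes> c [^] m" z g x] that cl by simp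
    also have "(z \<otimes> c [^] m) [^] x = z [^] x \<otimes> (c [^] m) [^] x"
      by (rule pow_mult_distrib) (use comm[OF cz, of m] cl in auto)
    finally show ?thesis using cl by (auto simp: nat_pow_pow)
  qed
  have push: "\<exists>w'\<in>M. v \<otimes> g = g \<otimes> w'" if v: "v \<in> M" and g: "z \<otimes> g = g \<otimes> z \<otimes> c [^] m"
    "c \<otimes> g = g \<otimes> c" "g \<in> carrier G" for v g and m :: nat
  proof -
    obtain x y :: nat where xy: "v = z [^] x \<otimes> c [^] y" using v by (rule ME)
    obtain y' where y': "z [^] x \<otimes> g = g \<otimes> (z [^] x \<otimes> c [^] (y'::nat))" using zpow g by blast
    have "v \<otimes> g = (z [^] x \<otimes> g) \<otimes> c [^] y" using xy comm[OF g(2,3)] g cl by (simp add: m_assoc)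
    also have "\<dots> = g \<otimes> (z [^] x \<otimes> c [^] (y' + y))"
      unfolding y' using g cl by (simp add: m_assoc nat_pow_mult[symmetric])
    finally show ?thesis using MI by blast
  qed
  have Mc: "M \<subseteq> carrier G" unfolding M_def using cl by auto
  have sub: "M \<subseteq> (\<lambda>(x, y). z [^] x \<otimes> c [^] y) ` ({..<w} \<times> {..<s})"
  proof
    fix v assume "v \<in> M"
    then obtain x y :: nat where "v = z [^] x \<otimes> c [^] y" by (rule ME)
    then have "v = z [^] (x mod w) \<otimes> c [^] (y mod s)" using mod z c cl by metis
    then show "v \<in> (\<lambda>(x, y). z [^] x \<otimes> c [^] y) ` ({..<w} \<times> {..<s})" using z c by force
  qed
  have fM: "finite M" by (rule finite_subset[OF sub]) simp
  have cM: "card M \<le> w * s" using surj_card_le[OF _ sub] by simp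
  have mult: "u \<otimes> v \<in> M" if u: "u \<in> M" and v: "v \<in> M" for u v
  proof -
    obtain x y :: nat where xy: "u = z [^] x \<otimes> c [^] y" using u by (rule ME)
    obtain x' y' :: nat where xy': "v = z [^] x' \<otimes> c [^] y'" using v by (rule ME)
    have "u \<otimes> v = z [^] x \<otimes> (c [^] y \<otimes> z [^] x') \<otimes> c [^] y'"
      using xy xy' cl by (simp add: m_assoc)
    also have "\<dots> = z [^] (x + x') \<otimes> c [^] (y + y')"
      unfolding czp using cl by (simp add: m_assoc nat_pow_mult[symmetric])
    finally show ?thesis using MI by simp
  qed
  have one: "\<one> \<in> M" using MI[of 0 0] by simp
  have powM: "u [^] (x::nat) \<in> M" if "u \<in> M" for u x
    by (induction x) (auto intro: one mult that)
  have zM: "z \<in> M" using MI[of 1 0] cl by simp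
  have cM': "c \<in> M" using MI[of 0 1] cl by simp
  have izM: "inv z \<in> M" using inv_eq_pow[OF cl(4) z(2,1)] powM[OF zM] by simp
  define d where "d = c [^] n"
  have dc: "d \<in> carrier G" unfolding d_def using cl by simp
  have "d [^] s = \<one>" unfolding d_def using c cl by (metis nat_pow_pow mult.commute nat_pow_one)
  then have idM: "inv d \<in> M" using inv_eq_pow[OF dc _ c(1)] powM[OF powM[OF cM']] unfolding d_def by simp
  have dz: "d \<otimes> z = z \<otimes> d" unfolding d_def using comm cz cl by simp
  have tz: "t \<otimes> z = inv z \<otimes> t"
    by (rule swap_commutator[OF cl(1-4) t(1) tb ab])
  have tc: "t \<otimes> c = inv d \<otimes> t"
    by (rule swap_double_commutator[OF cl(1-5) dc t(1) tb ab za zb[folded d_def] dz])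
  have Mt: "\<exists>w'\<in>M. t \<otimes> v = w' \<otimes> t" if v: "v \<in> M" for v
  proof -
    obtain x y :: nat where xy: "v = z [^] x \<otimes> c [^] y" using v by (rule ME)
    have "t \<otimes> v = (t \<otimes> z [^] x) \<otimes> c [^] y" using xy cl by (simp add: m_assoc)
    also have "\<dots> = inv z [^] x \<otimes> (t \<otimes> c [^] y)"
      using pow_intertwine[OF cl(4) _ cl(3) tz] cl by (simp add: m_assoc)
    also have "\<dots> = (inv z [^] x \<otimes> inv d [^] y) \<otimes> t"
      using pow_intertwine[OF cl(5) _ cl(3) tc] cl dc by (simp add: m_assoc)
    finally show ?thesis using mult powM izM idM by blast
  qed
  have ba: "b \<otimes> a = a \<otimes> b \<otimes> inv z" using ab cl by (simp add: m_assoc)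
  have "card (generate G {a, t}) \<le> 2 * q * r * card M"
  proof (rule card_generate_le[OF fM Mc one mult cl(1-3) t(1) tb t(2)])
    show "\<exists>w'\<in>M. v \<otimes> a = a \<otimes> w'" if "v \<in> M" for v
      using push[OF that, of a 1] za ca cl by simp
    show "\<exists>w'\<in>M. v \<otimes> b = b \<otimes> w'" if "v \<in> M" for v
      using push[OF that zb cb] cl by simp
    show "\<exists>w\<in>M. b \<otimes> a = a \<otimes> b \<otimes> w" using ba izM by blast
    show "a [^] q \<in> M" using aq powM cM' by simp
    show "\<exists>i. \<exists>w\<in>M. b [^] r = a [^] (i::nat) \<otimes> w" using br powM cM' by blast
  qed (use Mt aq br in auto)
  also have "\<dots> \<le> 2 * q * r * (w * s)" using cM by simp
  finally show ?thesis .
qed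

section \<open>Inverting both generators\<close>

text \<open>When \<open>a\<close> and \<open>b\<close> are inverted, a commutator of weight
  \<open>k\<close> changes by the sign \<open>(-1)^k\<close>, up to higher weight. So
  \<open>c\<close>, of weight 3, becomes \<open>inv c\<close>, while \<open>z\<close>, of weight 2,
  is kept up to a correction by elements commuting with \<open>a\<close> and
  \<open>b\<close>.\<close>

lemma (in group) relations_inv:
  fixes w q r n k i j :: nat
  assumes cl: "a \<in> carrier G" "b \<in> carrier G" "z \<in> carrier G" "c \<in> carrier G"
    and ab: "a \<otimes> b = b \<otimes> a \<otimes> z"
    and za: "z \<otimes> a = a \<otimes> z \<otimes> c" and zb: "z \<otimes> b = b \<otimes> z \<otimes> c [^] n"
    and ca: "c \<otimes> a = a \<otimes> c" and cb: "c \<otimes> b = b \<otimes> c"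
    and z: "z [^] w = \<one>"
    and aq: "a [^] q = c [^] k" and br: "b [^] r = a [^] i \<otimes> c [^] j"
  obtains z' where "z' \<in> carrier G" "inv a \<otimes> inv b = inv b \<otimes> inv a \<otimes> z'"
    "z' \<otimes> inv a = inv a \<otimes> z' \<otimes> inv c" "z' \<otimes> inv b = inv b \<otimes> z' \<otimes> inv c [^] n"
    "inv c \<otimes> inv a = inv a \<otimes> inv c" "inv c \<otimes> inv b = inv b \<otimes> inv c"
    "z' [^] w = \<one>" "inv a [^] q = inv c [^] k" "inv b [^] r = inv a [^] i \<otimes> inv c [^] j"
proof
  define d where "d = c [^] n"
  let ?z = "a \<otimes> b \<otimes> inv a \<otimes> inv b"
  have dc: "d \<in> carrier G" unfolding d_def using cl by simp
  have comm: "c [^] (x::nat) \<otimes> y = y \<otimes> c [^] x" if "c \<otimes> y = y \<otimes> c" "y \<in> carrier G" for x y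
    using pow_intertwine[of c c y x] that cl by simp
  have da: "d \<otimes> a = a \<otimes> d" and db: "d \<otimes> b = b \<otimes> d"
    unfolding d_def using comm ca cb cl by auto
  have ica: "inv c \<otimes> a = a \<otimes> inv c" and icb: "inv c \<otimes> b = b \<otimes> inv c"
    and ida: "inv d \<otimes> a = a \<otimes> inv d" and idb: "inv d \<otimes> b = b \<otimes> inv d"
    using commute_inv ca cb da db cl dc by auto
  have conj: "x \<otimes> z = z \<otimes> x \<otimes> inv y"
    if "z \<otimes> x = x \<otimes> z \<otimes> y" "x \<in> carrier G" "y \<in> carrier G" for x y
  proof -
    have "z \<otimes> x \<otimes> inv y = x \<otimes> z \<otimes> y \<otimes> inv y" using that by simp
    then show ?thesis using that cl by (simp add: m_assoc)
  qed
  have az: "a \<otimes> z = z \<otimes> a \<otimes> inv c" using conj za cl by blast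
  have bz: "b \<otimes> z = z \<otimes> b \<otimes> inv d" using conj zb cl dc unfolding d_def by blast
  \<comment> \<open>The correction in \<open>?z = z \<otimes> e\<close>: the factor
    \<open>inv c\<close> arises when \<open>z\<close> moves past \<open>a\<close>, the factor
    \<open>inv d\<close> when it moves past \<open>b\<close>.\<close>
  define e where "e = inv d \<otimes> inv c"
  have ec: "e \<in> carrier G" unfolding e_def using cl dc by simp
  have ea: "e \<otimes> a = a \<otimes> e"
    unfolding e_def using ica ida cl dc by (metis inv_closed m_assoc)
  have eb: "e \<otimes> b = b \<otimes> e"
    unfolding e_def using icb idb cl dc by (metis inv_closed m_assoc)
  have zeq: "?z = z \<otimes> e"
  proof -
    have "a \<otimes> b = z \<otimes> e \<otimes> (b \<otimes> a)"
    proof -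
      have "a \<otimes> b = b \<otimes> (a \<otimes> z)" using ab cl by (simp add: m_assoc)
      also have "\<dots> = b \<otimes> z \<otimes> a \<otimes> inv c" using az cl by (simp add: m_assoc)
      also have "\<dots> = z \<otimes> (b \<otimes> inv d) \<otimes> (a \<otimes> inv c)" unfolding bz using cl dc by (simp add: m_assoc)
      also have "\<dots> = z \<otimes> inv d \<otimes> (b \<otimes> inv c) \<otimes> a"
        unfolding ica[symmetric] idb[symmetric] using cl dc by (simp add: m_assoc)
      also have "\<dots> = z \<otimes> e \<otimes> (b \<otimes> a)" unfolding icb[symmetric] e_def using cl dc by (simp add: m_assoc)
      finally show ?thesis .
    qed
    then show ?thesis using cl ec by (simp add: m_assoc)
  qed
  show "?z \<in> carrier G" using cl by simp
  show "inv a \<otimes> inv b = inv b \<otimes> inv a \<otimes> ?z"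
    using cl by (simp add: m_assoc inv_mult_cancel)
  have push: "z \<otimes> e \<otimes> inv x = inv x \<otimes> (z \<otimes> e) \<otimes> inv y"
    if "x \<otimes> z = z \<otimes> x \<otimes> inv y" "e \<otimes> x = x \<otimes> e" "inv y \<otimes> x = x \<otimes> inv y" "x \<in> carrier G" "y \<in> carrier G"
      "inv y \<otimes> e = e \<otimes> inv y" for x y
  proof -
    have "x \<otimes> (z \<otimes> e \<otimes> inv x) = (z \<otimes> x \<otimes> inv y) \<otimes> e \<otimes> inv x"
      using that ec cl by (simp add: m_assoc[symmetric])
    also have "\<dots> = z \<otimes> (x \<otimes> e) \<otimes> (inv y \<otimes> inv x)"
      using that ec cl by (simp add: m_assoc)
    also have "inv y \<otimes> inv x = inv x \<otimes> inv y"
      using commute_inv[of x "inv y"] that by simp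
    also have "z \<otimes> (x \<otimes> e) \<otimes> (inv x \<otimes> inv y) = z \<otimes> (e \<otimes> (x \<otimes> inv x)) \<otimes> inv y"
      unfolding that(2)[symmetric] using that(4,5) ec cl by (simp only: m_assoc m_closed inv_closed)
    also have "\<dots> = z \<otimes> e \<otimes> inv y" using that(4,5) ec cl by simp
    finally show ?thesis using that ec cl by (metis inv_closed inv_solve_left m_assoc m_closed)
  qed
  have cd: "inv c \<otimes> inv d = inv d \<otimes> inv c"
    unfolding d_def using cl by (metis inv_mult_group nat_pow_Suc nat_pow_Suc2 nat_pow_closed)
  show "?z \<otimes> inv a = inv a \<otimes> ?z \<otimes> inv c"
    unfolding zeq by (rule push[OF az ea ica]) (use cl dc cd in \<open>simp_all add: e_def m_assoc[symmetric]\<close>)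
  have icn: "inv c [^] n = inv d" unfolding d_def using cl by (simp add: nat_pow_inv)
  show "?z \<otimes> inv b = inv b \<otimes> ?z \<otimes> inv c [^] n"
    unfolding zeq icn by (rule push[OF bz eb idb]) (use cl dc cd in \<open>simp_all add: e_def m_assoc\<close>)
  show "inv c \<otimes> inv a = inv a \<otimes> inv c" "inv c \<otimes> inv b = inv b \<otimes> inv c"
    using commute_inv[of a "inv c"] commute_inv[of b "inv c"] ica icb cl by auto
  \<comment> \<open>\<open>?z\<close> is the conjugate of \<open>z\<close> by
    \<open>b \<otimes> a\<close>, so its \<open>w\<close>-th power is trivial too.\<close>
  have "b \<otimes> a \<otimes> z = ?z \<otimes> (b \<otimes> a)" unfolding ab[symmetric] using cl by (simp add: m_assoc inv_mult_cancel)
  then have "b \<otimes> a \<otimes> z [^] w = ?z [^] w \<otimes> (b \<otimes> a)"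
    by (intro pow_intertwine) (use cl in auto)
  then have "\<one> \<otimes> (b \<otimes> a) = ?z [^] w \<otimes> (b \<otimes> a)" using z cl by simp
  then show "?z [^] w = \<one>" using cl right_cancel[of "b \<otimes> a" \<one> "?z [^] w"] by simp
  show "inv a [^] q = inv c [^] k" using aq cl by (metis nat_pow_inv)
  have "c [^] j \<otimes> a [^] i = a [^] i \<otimes> c [^] j"
    using pow_intertwine[of a a "c [^] j" i] comm[OF ca] cl by simp
  then have "b [^] r = c [^] j \<otimes> a [^] i" using br by simp
  then have "inv (b [^] r) = inv (a [^] i) \<otimes> inv (c [^] j)" using cl by (simp add: inv_mult_group)
  then show "inv b [^] r = inv a [^] i \<otimes> inv c [^] j" using cl by (simp add: nat_pow_inv)
qed

section \<open>Automorphisms as graphs in the direct square\<close>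

lemma DirProd_nat_pow:
  assumes "group G" "group H" "x \<in> carrier G" "y \<in> carrier H"
  shows "(x, y) [^]\<^bsub>G \<times>\<times> H\<^esub> (n::nat) = (x [^]\<^bsub>G\<^esub> n, y [^]\<^bsub>H\<^esub> n)"
  by (induction n) (simp_all add: group.is_monoid[OF assms(1)] monoid.nat_pow_Suc monoid.nat_pow_0 nat_pow_def)

text \<open>
  The subgroup generated by the pairs \<open>(x, f x)\<close> projects onto both factors, so if it is no larger
  than \<open>G\<close> it is the graph of an automorphism.
\<close>
lemma (in group) iso_of_small_graph:
  assumes fin: "finite (carrier G)" and X: "X \<subseteq> carrier G" "generate G X = carrier G"
    and f: "f ` X \<subseteq> carrier G" "generate G (f ` X) = carrier G"
    and card: "card (generate (G \<times>\<times> G) ((\<lambda>x. (x, f x)) ` X)) \<le> order G"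
  shows "\<exists>\<alpha>\<in>iso G G. \<forall>x\<in>X. \<alpha> x = f x"
proof -
  interpret D: group "G \<times>\<times> G" by (rule DirProd_group) (rule is_group)+
  let ?Y = "(\<lambda>x. (x, f x)) ` X"
  define K where "K = generate (G \<times>\<times> G) ?Y"
  have Y: "?Y \<subseteq> carrier (G \<times>\<times> G)" using X f by auto
  have sK: "subgroup K (G \<times>\<times> G)" unfolding K_def by (rule D.generate_is_subgroup[OF Y])
  have Kc: "K \<subseteq> carrier G \<times> carrier G" using subgroup.subset[OF sK] by simp
  have finK: "finite K" using Kc fin by (meson finite_SigmaI finite_subset)
  interpret F: group_hom "G \<times>\<times> G" G fst
    by (unfold_locales) (auto simp: hom_def mult_DirProd')
  interpret S: group_hom "G \<times>\<times> G" G snd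
    by (unfold_locales) (auto simp: hom_def mult_DirProd')
  have fK: "fst ` K = carrier G" using F.generate_img[OF Y] X by (simp add: K_def image_image)
  have sndK: "snd ` K = carrier G" using S.generate_img[OF Y] f by (simp add: K_def image_image)
  \<comment> \<open>\<open>fst\<close> maps \<open>K\<close> onto \<open>G\<close>, so the assumed
    bound is an equality, and surjections between finite sets of equal size are injective.\<close>
  have cardK: "card K = order G"
    using card fK card_image_le[OF finK, of fst] by (simp add: K_def order_def)
  have injf: "inj_on fst K" and injs: "inj_on snd K"
    using eq_card_imp_inj_on[OF finK, of fst] eq_card_imp_inj_on[OF finK, of snd] cardK fK sndK
    by (simp_all add: order_def)
  define \<alpha> where "\<alpha> x = snd (inv_into K fst x)" for x
  have \<alpha>I: "\<alpha> x = y" if "(x, y) \<in> K" for x y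
    using inv_into_f_f[OF injf that] by (simp add: \<alpha>_def)
  have \<alpha>K: "(x, \<alpha> x) \<in> K" if "x \<in> carrier G" for x
    using \<alpha>I that fK by (metis (no_types, lifting) imageE prod.collapse)
  have "\<alpha> \<in> hom G G"
  proof (rule homI)
    show "\<alpha> x \<in> carrier G" if "x \<in> carrier G" for x using \<alpha>K[OF that] Kc by blast
    fix x y assume "x \<in> carrier G" "y \<in> carrier G"
    then have "(x, \<alpha> x) \<otimes>\<^bsub>G \<times>\<times> G\<^esub> (y, \<alpha> y) \<in> K" using \<alpha>K subgroup.m_closed[OF sK] by blast
    then show "\<alpha> (x \<otimes> y) = \<alpha> x \<otimes> \<alpha> y" using \<alpha>I by simp
  qed
  moreover have "inj_on \<alpha> (carrier G)"
  proof (rule inj_onI)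
    fix x y assume "x \<in> carrier G" "y \<in> carrier G" "\<alpha> x = \<alpha> y"
    then show "x = y" using \<alpha>K injs by (metis inj_onD prod.inject snd_conv)
  qed
  moreover have "\<alpha> ` carrier G = carrier G"
    using \<open>inj_on \<alpha> (carrier G)\<close> \<open>\<alpha> \<in> hom G G\<close> fin by (simp add: endo_inj_surj hom_def image_subset_iff Pi_iff)
  ultimately have "\<alpha> \<in> iso G G" by (simp add: iso_def bij_betw_def)
  moreover have "\<alpha> x = f x" if "x \<in> X" for x
    using that by (intro \<alpha>I) (auto simp: K_def intro: generate.incl)
  ultimately show ?thesis by blast
qed

text \<open>
  By \<open>relations_inv\<close> the defining relations hold for the pairs \<open>(a, inv a)\<close> and \<open>(t, t)\<close> in \<open>G \<times> G\<close> as well.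
\<close>
lemma (in group) inverting_automorphism_exists:
  fixes w s q r n k i j :: nat
  assumes cl: "a \<in> carrier G" "b \<in> carrier G" "t \<in> carrier G" "z \<in> carrier G" "c \<in> carrier G"
    and t: "t \<otimes> a = b \<otimes> t" "t \<otimes> t = \<one>"
    and ab: "a \<otimes> b = b \<otimes> a \<otimes> z"
    and za: "z \<otimes> a = a \<otimes> z \<otimes> c" and zb: "z \<otimes> b = b \<otimes> z \<otimes> c [^] n"
    and ca: "c \<otimes> a = a \<otimes> c" and cb: "c \<otimes> b = b \<otimes> c"
    and z: "0 < w" "z [^] w = \<one>" and c: "0 < s" "c [^] s = \<one>"
    and aq: "0 < q" "a [^] q = c [^] k" and br: "0 < r" "b [^] r = a [^] i \<otimes> c [^] j"
    and fin: "finite (carrier G)" and gen: "generate G {a, t} = carrier G"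
    and card: "2 * q * r * (w * s) \<le> order G"
  shows "\<exists>\<alpha>\<in>iso G G. \<alpha> a = inv a \<and> \<alpha> t = t"
\<comment> \<open>If \<open>a = t\<close>, then \<open>a\<close> is an involution and the identity
  already inverts it. Otherwise the two values prescribed for \<open>f\<close> below cannot
  collide.\<close>
proof (cases "a = t")
  case True
  then show ?thesis using t cl by (intro bexI[OF _ iso_set_refl]) (auto simp: inv_equality)
next
  case False
  interpret D: group "G \<times>\<times> G" by (rule DirProd_group) (rule is_group)+
  obtain z' where z': "z' \<in> carrier G" "inv a \<otimes> inv b = inv b \<otimes> inv a \<otimes> z'"
    "z' \<otimes> inv a = inv a \<otimes> z' \<otimes> inv c" "z' \<otimes> inv b = inv b \<otimes> z' \<otimes> inv c [^] n"
    "inv c \<otimes> inv a = inv a \<otimes> inv c" "inv c \<otimes> inv b = inv b \<otimes> inv c"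
    "z' [^] w = \<one>" "inv a [^] q = inv c [^] k" "inv b [^] r = inv a [^] i \<otimes> inv c [^] j"
    by (rule relations_inv[OF cl(1,2,4,5) ab za zb ca cb z(2) aq(2) br(2)])
  have ti: "t \<otimes> inv a = inv b \<otimes> t"
  proof -
    have "b \<otimes> (t \<otimes> inv a) = t \<otimes> a \<otimes> inv a" using t cl by (simp add: m_assoc)
    then have "b \<otimes> (t \<otimes> inv a) = t" using cl by (simp add: m_assoc)
    then show ?thesis using cl by (metis inv_closed inv_solve_left m_closed)
  qed
  have ic: "inv c [^] s = \<one>" using c cl by (simp add: nat_pow_inv)
  have "card (generate (G \<times>\<times> G) {(a, inv a), (t, t)}) \<le> 2 * q * r * (w * s)"
    by (rule D.card_generate_le_of_relations[of _ "(b, inv b)" _ "(z, z')" "(c, inv c)"])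
      (use assms z' ti ic in \<open>auto simp: DirProd_nat_pow is_group\<close>)
  then have card': "card (generate (G \<times>\<times> G) {(a, inv a), (t, t)}) \<le> order G" using card by simp
  define f where "f x = (if x = a then inv a else t)" for x
  have ft: "f a = inv a" "f t = t" using False by (auto simp: f_def)
  have "generate G {a, t} \<subseteq> generate G {inv a, t}"
  proof (rule generate_subgroup_incl)
    show "subgroup (generate G {inv a, t}) G" using cl by (intro generate_is_subgroup) auto
    have "inv (inv a) \<in> generate G {inv a, t}" by (rule generate.inv) simp
    then show "{a, t} \<subseteq> generate G {inv a, t}" using cl by (auto intro: generate.incl)
  qed
  then have gen': "generate G {inv a, t} = carrier G"
    using gen generate_incl[of "{inv a, t}"] cl by auto
  have "\<exists>\<alpha>\<in>iso G G. \<forall>x\<in>{a, t}. \<alpha> x = f x"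
    by (rule iso_of_small_graph[OF fin]) (use gen gen' card' cl ft in auto)
  then show ?thesis using ft by auto
qed

section \<open>Commutators in groups of order $p^3$ and $p^4$\<close>

text \<open>One notion for the centre, \<open>centralizer G (carrier G)\<close>, and for the
  centralizer \<open>centralizer G {x}\<close> of an element; the arguments on
  \<open>p\<close>-groups compare the two.\<close>

definition centralizer :: "('a, 'b) monoid_scheme \<Rightarrow> 'a set \<Rightarrow> 'a set" where
  "centralizer G S = {x \<in> carrier G. \<forall>y\<in>S. x \<otimes>\<^bsub>G\<^esub> y = y \<otimes>\<^bsub>G\<^esub> x}"

lemma (in group) centralizer_subgroup:
  assumes "S \<subseteq> carrier G"
  shows "subgroup (centralizer G S) G"
proof (rule subgroupI)
  show "centralizer G S \<noteq> {}" using assms by (auto simp: centralizer_def intro!: exI[of _ \<one>])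
  show "inv x \<in> centralizer G S" if "x \<in> centralizer G S" for x
    using that assms commute_inv unfolding centralizer_def by blast
  show "x \<otimes> y \<in> centralizer G S" if "x \<in> centralizer G S" "y \<in> centralizer G S" for x y
      proof -
    have "x \<otimes> y \<otimes> s = s \<otimes> (x \<otimes> y)" if s: "s \<in> S" for s
    proof -
      have c: "x \<in> carrier G" "y \<in> carrier G" "s \<in> carrier G" "x \<otimes> s = s \<otimes> x" "y \<otimes> s = s \<otimes> y"
        using \<open>x \<in> centralizer G S\<close> \<open>y \<in> centralizer G S\<close> s assms by (auto simp: centralizer_def)
      have "x \<otimes> y \<otimes> s = (x \<otimes> s) \<otimes> y" using c(1-3,5) by (simp add: m_assoc)
      also have "\<dots> = s \<otimes> (x \<otimes> y)" unfolding c(4) using c(1-3) by (simp add: m_assoc)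
      finally show ?thesis .
    qed
    then show ?thesis using that by (simp add: centralizer_def)
  qed
qed (auto simp: centralizer_def)

lemma (in group) subgroup_card_pow:
  assumes "prime (p::nat)" "order G = p ^ n" "subgroup H G"
  obtains k where "k \<le> n" "card H = p ^ k"
proof -
  have "card H dvd p ^ n" using lagrange[OF assms(3)] assms(2) by (metis dvd_triv_right)
  then show ?thesis using that divides_primepow_nat[OF assms(1)] by blast
qed

lemma (in group) ord_dvd_card_subgroup:
  assumes "subgroup H G" "x \<in> H"
  shows "ord x dvd card H"
proof -
  interpret H: group "G\<lparr>carrier := H\<rparr>" by (rule subgroup_imp_group[OF assms(1)])
  have "x [^]\<^bsub>G\<lparr>carrier := H\<rparr>\<^esub> card H = \<one>"
    using H.pow_order_eq_1[of x] assms by (simp add: order_def)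
  then have "x [^] card H = \<one>" by (simp add: nat_pow_consistent[symmetric])
  then show ?thesis using pow_eq_id assms subgroup.mem_carrier by metis
qed

section \<open>Centres of groups of prime power order\<close>

text \<open>Class equation: were \<open>\<one>\<close> the only central element, every conjugacy
  class but \<open>{\<one>}\<close> would have size divisible by \<open>p\<close>, although the
  sizes add up to \<open>p ^ n\<close>.\<close>

lemma (in group) p_group_center_nontrivial:
  assumes p: "prime (p::nat)" and ord: "order G = p ^ n" and n: "0 < n"
  shows "centralizer G (carrier G) \<noteq> {\<one>}"
proof
  let ?\<phi> = "\<lambda>g. \<lambda>h\<in>carrier G. g \<otimes> h \<otimes> inv g"
  let ?O = "orbits G (carrier G) ?\<phi>"
  assume Z: "centralizer G (carrier G) = {\<one>}"
  interpret C: group_action G "carrier G" ?\<phi> by (rule action_by_conjugation)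
  have fin: "finite (carrier G)" using ord p order_gt_0_iff_finite by (simp add: prime_gt_0_nat)
  have finO: "finite ?O" unfolding orbits_def using fin by auto
  have "orbit G ?\<phi> \<one> = {\<one>}" unfolding orbit_def by (auto intro!: exI[of _ \<one>])
  moreover have "orbit G ?\<phi> \<one> \<in> ?O"
    unfolding orbits_def by (rule CollectI, rule exI[of _ \<one>]) simp
  ultimately have oneO: "{\<one>} \<in> ?O" by simp
  have dvd: "p dvd card X" if X: "X \<in> ?O - {{\<one>}}" for X
  proof -
    obtain x where x: "x \<in> carrier G" "X = orbit G ?\<phi> x" using X unfolding orbits_def by blast
    have "card X dvd p ^ n"
      by (rule dvdI, rule C.orbit_stabilizer_theorem[OF x(1), folded x(2), unfolded ord, symmetric])
    then obtain k where k: "card X = p ^ k" using divides_primepow_nat[OF p] by blast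
    have "card X \<noteq> 1"
    proof
      assume "card X = 1"
      moreover have xX: "x \<in> X" using C.orbit_refl x by simp
      ultimately have "X = {x}" by (metis card_1_singletonE singletonD)
      then have fixed: "g \<otimes> x \<otimes> inv g = x" if "g \<in> carrier G" for g
        using that x unfolding orbit_def by auto
      have "x \<in> centralizer G (carrier G)"
        unfolding centralizer_def using fixed x by (simp add: inv_solve_right')
      then have "x = \<one>" using Z by blast
      then show False using X \<open>X = {x}\<close> by blast
    qed
    then show ?thesis using k by (cases k) auto
  qed
  have "order G = (\<Sum>X\<in>?O. card X)"
    using C.disjoint_sum[OF fin, of "\<lambda>_. 1::nat"] by (simp add: order_def)
  also have "\<dots> = 1 + (\<Sum>X\<in>?O - {{\<one>}}. card X)" by (subst sum.remove[OF finO oneO]) simp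
  finally have eq: "p ^ n = 1 + (\<Sum>X\<in>?O - {{\<one>}}. card X)" using ord by simp
  have "p dvd 1 + (\<Sum>X\<in>?O - {{\<one>}}. card X)" unfolding eq[symmetric] using n by simp
  moreover have "p dvd (\<Sum>X\<in>?O - {{\<one>}}. card X)" using dvd by (rule dvd_sum)
  ultimately have "p dvd 1" by (simp only: dvd_add_left_iff)
  then show False using p not_prime_unit by blast
qed

lemma (in group) p_group_center_card:
  assumes p: "prime (p::nat)" and ord: "order G = p ^ n" and n: "0 < n"
  obtains k where "0 < k" "k \<le> n" "card (centralizer G (carrier G)) = p ^ k"
proof -
  let ?Z = "centralizer G (carrier G)"
  have sZ: "subgroup ?Z G" by (rule centralizer_subgroup) simp
  obtain k where k: "k \<le> n" "card ?Z = p ^ k" using subgroup_card_pow[OF p ord sZ] .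
  have "k \<noteq> 0"
  proof
    assume "k = 0"
    then have "card ?Z = 1" using k by simp
    then show False using p_group_center_nontrivial[OF p ord n] subgroup.one_closed[OF sZ]
      by (metis card_1_singletonE singletonD)
  qed
  then show thesis using that k by blast
qed

text \<open>The element \<open>x\<close> separates its centralizer from the centre and
  \<open>y\<close> separates it from the whole group, so three exponents increase strictly. For
  small \<open>n\<close> this determines them.\<close>

lemma (in group) p_group_noncommuting:
  assumes p: "prime (p::nat)" and ord: "order G = p ^ n"
    and xy: "x \<in> carrier G" "y \<in> carrier G" "x \<otimes> y \<noteq> y \<otimes> x"
  obtains k l where "0 < k" "k < l" "l < n" "card (centralizer G (carrier G)) = p ^ k"
    "card (centralizer G {x}) = p ^ l"
proof -
  let ?Z = "centralizer G (carrier G)" and ?C = "centralizer G {x}"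
  have fin: "finite (carrier G)" using ord p order_gt_0_iff_finite by (simp add: prime_gt_0_nat)
  have "0 < n"
  proof (rule ccontr)
    assume "\<not> 0 < n"
    then have "carrier G = {\<one>}" using ord order_one_triv_iff by simp
    then show False using xy by auto
  qed
  then obtain k where k: "0 < k" "k \<le> n" "card ?Z = p ^ k" by (rule p_group_center_card[OF p ord])
  have sC: "subgroup ?C G" using xy by (intro centralizer_subgroup) simp
  obtain l where l: "l \<le> n" "card ?C = p ^ l" using subgroup_card_pow[OF p ord sC] .
  have "?Z \<subseteq> ?C" using xy unfolding centralizer_def by auto
  moreover have "x \<in> ?C" "x \<notin> ?Z" using xy unfolding centralizer_def by auto
  ultimately have "?Z \<subset> ?C" by blast
  then have "p ^ k < p ^ l"
    using k l psubset_card_mono[of ?C ?Z] finite_subset[OF _ fin] by (auto simp: centralizer_def)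
  moreover have "y \<notin> ?C" using xy unfolding centralizer_def by auto
  then have "?C \<subset> carrier G" using xy unfolding centralizer_def by blast
  then have "p ^ l < p ^ n" using l ord psubset_card_mono[OF fin, of ?C] by (simp add: order_def)
  ultimately have "k < l" "l < n" using prime_gt_1_nat[OF p] by (simp_all add: power_strict_increasing_iff)
  then show thesis using that k l by blast
qed

lemma (in group) order_p_squared_commute:
  assumes "prime (p::nat)" "order G = p ^ 2" "x \<in> carrier G" "y \<in> carrier G"
  shows "x \<otimes> y = y \<otimes> x"
proof (rule ccontr)
  assume "x \<otimes> y \<noteq> y \<otimes> x"
  then obtain k l where "0 < k" "k < l" "l < (2::nat)" using p_group_noncommuting[OF assms] by blast
  then show False by simp
qed

lemma (in group) central_normal:
  assumes "subgroup N G" "N \<subseteq> centralizer G (carrier G)"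
  shows "N \<lhd> G"
  unfolding normal_inv_iff
proof (intro conjI ballI assms(1))
  fix x h assume "x \<in> carrier G" "h \<in> N"
  then have "h \<in> carrier G" "x \<otimes> h = h \<otimes> x" using assms(2) unfolding centralizer_def by auto
  then show "x \<otimes> h \<otimes> inv x \<in> N" using \<open>x \<in> carrier G\<close> \<open>h \<in> N\<close> by (simp add: m_assoc)
qed

lemma (in normal) rcos_eq_iff_mem:
  assumes "x \<in> carrier G"
  shows "H #> x = H \<longleftrightarrow> x \<in> H"
  using coset_join1[OF _ assms is_subgroup] coset_join2[OF assms is_subgroup] by blast

lemma (in normal) order_Mod:
  "order (G Mod H) * card H = order G"
  using lagrange[OF is_subgroup] by (simp add: order_def FactGroup_def)

lemma (in normal) pow_index_mem:
  assumes "x \<in> carrier G"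
  shows "x [^] order (G Mod H) \<in> H"
proof -
  interpret Q: group "G Mod H" by (rule factorgroup_is_group)
  have "H #> x [^] order (G Mod H) = H"
    using Q.pow_order_eq_1[of "H #> x"] assms by (simp add: FactGroup_pow carrier_FactGroup)
  then show ?thesis using assms rcos_eq_iff_mem by simp
qed

lemma (in group) prime_order_subgroup_powers:
  assumes p: "prime (p::nat)" and N: "subgroup N G" "card N = p" and z: "z \<in> N" "z \<noteq> \<one>" and "x \<in> N"
  obtains i :: nat where "x = z [^] i"
proof -
  have zc: "z \<in> carrier G" using N z subgroup.mem_carrier by metis
  have "ord z dvd p" using ord_dvd_card_subgroup[OF N(1) z(1)] N by simp
  then have "ord z = p" using p z zc ord_eq_1 by (metis prime_nat_iff)
  then have "card (generate G {z}) = p" using generate_pow_card[OF zc] by simp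
  moreover have "generate G {z} \<subseteq> N" using z N by (intro generate_subgroup_incl) auto
  moreover have "finite N" using N p by (metis card.infinite not_prime_0)
  ultimately have "generate G {z} = N" using N by (simp add: card_subset_eq)
  then have "x \<in> {z [^] (k::nat) |k. k \<in> UNIV}"
    using generate_pow_nat[OF zc] \<open>ord z = p\<close> p assms(6) by (auto simp: prime_gt_0_nat)
  then show ?thesis using that by blast
qed

text \<open>If \<open>z\<close> is not trivial, the centre has order \<open>p\<close> and the
  centralizer of \<open>x\<close> order \<open>p ^ 2\<close>. The quotient by the centre is then
  abelian, which puts \<open>z\<close> into the centre, and \<open>z\<close> generates it.\<close>

lemma (in group) order_p_cubed_commutator:
  assumes p: "prime (p::nat)" and ord: "order G = p ^ 3"
    and cl: "x \<in> carrier G" "y \<in> carrier G" "z \<in> carrier G" and z: "x \<otimes> y = y \<otimes> x \<otimes> z"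
  shows "z \<in> centralizer G (carrier G)" and "z [^] p = \<one>"
    and "z \<noteq> \<one> \<Longrightarrow> \<exists>i::nat. x [^] p = z [^] i"
proof -
  let ?Z = "centralizer G (carrier G)" and ?C = "centralizer G {x}"
  have fin: "finite (carrier G)" using ord p order_gt_0_iff_finite by (simp add: prime_gt_0_nat)
  have sZ: "subgroup ?Z G" by (rule centralizer_subgroup) simp
  have sC: "subgroup ?C G" using cl by (intro centralizer_subgroup) simp
  have *: "z \<in> ?Z \<and> z [^] p = \<one> \<and> (\<exists>i::nat. x [^] p = z [^] i)" if z1: "z \<noteq> \<one>"
  proof -
    have "x \<otimes> y \<noteq> y \<otimes> x" using z z1 cl by simp
    then obtain k l where kl: "0 < k" "k < l" "l < 3" "card ?Z = p ^ k" "card ?C = p ^ l"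
      using p_group_noncommuting[OF p ord cl(1,2)] by blast
    have kl': "k = 1" "l = 2" using kl(1-3) by auto
    have cZ: "card ?Z = p" and cC: "card ?C = p ^ 2" using kl(4,5) unfolding kl' by simp_all
    interpret N: normal ?Z G by (rule central_normal[OF sZ]) simp
    interpret Q: group "G Mod ?Z" by (rule N.factorgroup_is_group)
    have "order (G Mod ?Z) * p = p ^ 2 * p" using N.order_Mod cZ ord by (simp add: power_numeral_reduce mult_ac)
    then have "order (G Mod ?Z) = p ^ 2" using prime_gt_0_nat[OF p] by simp
    then have "(?Z #> x) \<otimes>\<^bsub>G Mod ?Z\<^esub> (?Z #> y) = (?Z #> y) \<otimes>\<^bsub>G Mod ?Z\<^esub> (?Z #> x)"
      using cl by (intro Q.order_p_squared_commute[OF p]) (auto simp: carrier_FactGroup)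
    then have "?Z #> (y \<otimes> x \<otimes> z) = ?Z #> (y \<otimes> x)" using cl z by (simp add: N.rcos_sum)
    then have "(?Z #> (y \<otimes> x)) \<otimes>\<^bsub>G Mod ?Z\<^esub> (?Z #> z) = ?Z #> (y \<otimes> x)"
      using cl by (simp add: N.rcos_sum)
    then have "?Z #> z = \<one>\<^bsub>G Mod ?Z\<^esub>"
      using cl Q.l_cancel_one[of "?Z #> (y \<otimes> x)" "?Z #> z"] unfolding carrier_FactGroup by blast
    then have "?Z #> z = ?Z" by simp
    then have zZ: "z \<in> ?Z" using N.rcos_eq_iff_mem cl by simp
    have zp: "z [^] p = \<one>" using ord_dvd_card_subgroup[OF sZ zZ] cZ pow_eq_id cl by simp
    \<comment> \<open>The quotient of the whole group by the centre has order \<open>p ^ 2\<close>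
      and would only give \<open>x [^] (p ^ 2)\<close> in the centre; the quotient of the
      centralizer of \<open>x\<close> has order \<open>p\<close> and gives
      \<open>x [^] p\<close>.\<close>
    interpret C: group "G\<lparr>carrier := ?C\<rparr>" by (rule subgroup_imp_group[OF sC])
    have xC: "x \<in> ?C" using cl(1) unfolding centralizer_def by blast
    have ZC: "?Z \<subseteq> ?C" using cl(1) unfolding centralizer_def by blast
    have "?Z \<subseteq> centralizer (G\<lparr>carrier := ?C\<rparr>) ?C"
    proof
      fix v assume v: "v \<in> ?Z"
      then have "v \<otimes> u = u \<otimes> v" if "u \<in> ?C" for u using that unfolding centralizer_def by blast
      then show "v \<in> centralizer (G\<lparr>carrier := ?C\<rparr>) ?C"
        using v ZC unfolding centralizer_def[of "G\<lparr>carrier := ?C\<rparr>"] by auto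
    qed
    then interpret NC: normal ?Z "G\<lparr>carrier := ?C\<rparr>"
      using C.central_normal[OF subgroup_incl[OF sZ sC ZC]] by simp
    have "order (G\<lparr>carrier := ?C\<rparr> Mod ?Z) * p = p * p"
      using NC.order_Mod cZ cC
      by (simp add: order_def power2_eq_square)
    then have "order (G\<lparr>carrier := ?C\<rparr> Mod ?Z) = p" using prime_gt_0_nat[OF p] by simp
    then have "x [^]\<^bsub>G\<lparr>carrier := ?C\<rparr>\<^esub> p \<in> ?Z" using NC.pow_index_mem[of x] xC by simp
    then have "x [^] p \<in> ?Z" by (simp only: nat_pow_consistent[symmetric])
    then obtain i :: nat where "x [^] p = z [^] i"
      by (rule prime_order_subgroup_powers[OF p sZ cZ zZ z1])
    then show ?thesis using zZ zp by blast
  qed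
  show "z \<in> ?Z" using * subgroup.one_closed[OF sZ] by (cases "z = \<one>") auto
  show "z [^] p = \<one>" using * by (cases "z = \<one>") auto
  show "\<exists>i::nat. x [^] p = z [^] i" if "z \<noteq> \<one>" using * that by blast
qed

text \<open>Sylow's theorem inside the centre. Order exactly \<open>p\<close> is wanted so that
  passing to the quotient lowers the exponent of the group order by one.\<close>

lemma (in group) p_group_central_subgroup:
  assumes p: "prime (p::nat)" and ord: "order G = p ^ n" and n: "0 < n"
  obtains N where "subgroup N G" "card N = p" "N \<subseteq> centralizer G (carrier G)"
proof -
  let ?Z = "centralizer G (carrier G)"
  have sZ: "subgroup ?Z G" by (rule centralizer_subgroup) simp
  obtain k where k: "0 < k" "card ?Z = p ^ k" using p_group_center_card[OF p ord n] by metis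
  interpret Z: group "G\<lparr>carrier := ?Z\<rparr>" by (rule subgroup_imp_group[OF sZ])
  have "finite ?Z" using k p by (metis card.infinite not_prime_0 power_not_zero)
  moreover have "order (G\<lparr>carrier := ?Z\<rparr>) = p ^ 1 * p ^ (k - 1)"
    using k by (simp add: order_def power_eq_if)
  ultimately obtain N where N: "subgroup N (G\<lparr>carrier := ?Z\<rparr>)" "card N = p ^ 1"
    using sylow_thm[OF p Z.is_group, of 1 "p ^ (k - 1)"] by auto
  show thesis
  proof
    show "subgroup N G" by (rule incl_subgroup[OF sZ N(1)])
    show "card N = p" using N by simp
    show "N \<subseteq> ?Z" using subgroup.subset[OF N(1)] by simp
  qed
qed

text \<open>The order \<open>p ^ 3\<close> result holds in the quotient by a central subgroup
  \<open>N\<close> of order \<open>p\<close>; pulled back, each of its conclusions holds up to a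
  factor from \<open>N\<close>.\<close>

lemma (in group) order_p_fourth_commutator:
  assumes p: "prime (p::nat)" and ord: "order G = p ^ 4"
    and cl: "x \<in> carrier G" "y \<in> carrier G" "z \<in> carrier G" "c \<in> carrier G" "d \<in> carrier G"
    and z: "x \<otimes> y = y \<otimes> x \<otimes> z" and c: "z \<otimes> x = x \<otimes> z \<otimes> c" and d: "z \<otimes> y = y \<otimes> z \<otimes> d"
  obtains N where "subgroup N G" "card N = p" "N \<subseteq> centralizer G (carrier G)"
    "c \<in> N" "d \<in> N" "z [^] p \<in> N" "z \<in> N \<or> (\<exists>i::nat. \<exists>v\<in>N. x [^] p = z [^] i \<otimes> v)"
proof -
  obtain N where N: "subgroup N G" "card N = p" "N \<subseteq> centralizer G (carrier G)"
    using p_group_central_subgroup[OF p ord] by auto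
  have fin: "finite (carrier G)" using ord p order_gt_0_iff_finite by (simp add: prime_gt_0_nat)
  interpret N: normal N G by (rule central_normal[OF N(1,3)])
  interpret Q: group "G Mod N" by (rule N.factorgroup_is_group)
  let ?f = "\<lambda>x. N #> x"
  have fc: "?f x \<in> carrier (G Mod N)" if "x \<in> carrier G" for x using that by (auto simp: carrier_FactGroup)
  have fm: "?f x \<otimes>\<^bsub>G Mod N\<^esub> ?f y = ?f (x \<otimes> y)" if "x \<in> carrier G" "y \<in> carrier G" for x y
    using that by (simp add: N.rcos_sum)
  have "order (G Mod N) * p = p ^ 3 * p" using N.order_Mod N(2) ord by (simp add: power_numeral_reduce mult_ac)
  then have ordQ: "order (G Mod N) = p ^ 3" using prime_gt_0_nat[OF p] by simp
  have fz: "?f x \<otimes>\<^bsub>G Mod N\<^esub> ?f y = ?f y \<otimes>\<^bsub>G Mod N\<^esub> ?f x \<otimes>\<^bsub>G Mod N\<^esub> ?f z"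
    using z cl fm by simp
  note Q3 = Q.order_p_cubed_commutator[OF p ordQ fc[OF cl(1)] fc[OF cl(2)] fc[OF cl(3)] fz]
  \<comment> \<open>The image of \<open>z\<close> is central in the quotient, so every commutator
    with \<open>z\<close> dies there.\<close>
  have in_N: "e \<in> N" if "z \<otimes> u = u \<otimes> z \<otimes> e" "u \<in> carrier G" "e \<in> carrier G" for u e
  proof -
    have "?f z \<otimes>\<^bsub>G Mod N\<^esub> ?f u = ?f u \<otimes>\<^bsub>G Mod N\<^esub> ?f z"
      using Q3(1) fc that unfolding centralizer_def by blast
    then have "?f (u \<otimes> z) \<otimes>\<^bsub>G Mod N\<^esub> ?f e = ?f (u \<otimes> z)"
      using that cl fm by simp
    then have "?f e = \<one>\<^bsub>G Mod N\<^esub>" using Q.l_cancel_one[OF fc fc] that cl by simp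
    then have "?f e = N" by simp
    then show ?thesis using N.rcos_eq_iff_mem that by simp
  qed
  have zp: "z [^] p \<in> N"
    using Q3(2) cl N.rcos_eq_iff_mem[of "z [^] p"] by (simp add: N.FactGroup_pow)
  have "\<exists>i::nat. \<exists>v\<in>N. x [^] p = z [^] i \<otimes> v" if "z \<notin> N"
  proof -
    have "?f z \<noteq> \<one>\<^bsub>G Mod N\<^esub>" using that N.rcos_eq_iff_mem cl by simp
    then obtain i :: nat where "?f (x [^] p) = ?f (z [^] i)"
      using Q3(3) cl by (auto simp: N.FactGroup_pow)
    then have "x [^] p \<in> N #> z [^] i" using rcos_self[OF _ N(1)] cl by blast
    then obtain v where v: "v \<in> N" "x [^] p = v \<otimes> z [^] i" unfolding r_coset_def by blast
    moreover have "v \<otimes> z [^] i = z [^] i \<otimes> v" using v N(3) cl unfolding centralizer_def by auto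
    ultimately show ?thesis by metis
  qed
  then show thesis using that[OF N in_N[OF c] in_N[OF d] zp] cl by blast
qed

section \<open>Power formulas in class at most 3\<close>

lemma (in group) pow_twisted:
  assumes "a \<in> carrier G" "z \<in> carrier G" "c \<in> carrier G"
    and za: "z \<otimes> a = a \<otimes> z \<otimes> c" and ca: "c \<otimes> a = a \<otimes> c"
  shows "z \<otimes> a [^] (n::nat) = a [^] n \<otimes> z \<otimes> c [^] n"
proof (induction n)
  case 0
  then show ?case using assms by simp
next
  case (Suc n)
  have "z \<otimes> a [^] Suc n = (z \<otimes> a [^] n) \<otimes> a" using assms(1-3) by (simp add: m_assoc)
  also have "\<dots> = a [^] n \<otimes> z \<otimes> (c [^] n \<otimes> a)" unfolding Suc using assms(1-3) by (simp add: m_assoc)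
  also have "c [^] n \<otimes> a = a \<otimes> c [^] n" using pow_intertwine[of c c a n] ca assms(1-3) by simp
  also have "a [^] n \<otimes> z \<otimes> (a \<otimes> c [^] n) = a [^] n \<otimes> (z \<otimes> a) \<otimes> c [^] n"
    using assms(1-3) by (simp add: m_assoc)
  also have "\<dots> = a [^] Suc n \<otimes> z \<otimes> (c \<otimes> c [^] n)" unfolding za using assms(1-3) by (simp add: m_assoc)
  also have "c \<otimes> c [^] n = c [^] Suc n" using assms(3) by (rule nat_pow_Suc2[symmetric])
  finally show ?case .
qed

text \<open>Each \<open>a\<close> that passes \<open>b\<close> leaves a \<open>z\<close>, which must
  then pass the powers of \<open>a\<close> already moved, at the cost of one \<open>c\<close> for
  each; the exponent is \<open>0 + 1 + ... + (n - 1)\<close>.\<close>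

lemma (in group) pow_commutator:
  assumes cl: "a \<in> carrier G" "b \<in> carrier G" "z \<in> carrier G" "c \<in> carrier G"
    and ab: "a \<otimes> b = b \<otimes> a \<otimes> z" and za: "z \<otimes> a = a \<otimes> z \<otimes> c"
    and ca: "c \<otimes> a = a \<otimes> c" and cz: "c \<otimes> z = z \<otimes> c"
  shows "a [^] n \<otimes> b = b \<otimes> a [^] n \<otimes> z [^] n \<otimes> c [^] (n choose 2)"
proof (induction n)
  case 0
  then show ?case using assms by (simp add: numeral_2_eq_2)
next
  case (Suc n)
  let ?k = "n choose 2"
  have "a [^] Suc n \<otimes> b = a \<otimes> (a [^] n \<otimes> b)"
    using cl by (simp only: nat_pow_Suc2) (simp add: m_assoc)
  also have "\<dots> = (a \<otimes> b) \<otimes> a [^] n \<otimes> z [^] n \<otimes> c [^] ?k" unfolding Suc using cl by (simp add: m_assoc)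
  also have "\<dots> = b \<otimes> a \<otimes> (z \<otimes> a [^] n) \<otimes> z [^] n \<otimes> c [^] ?k" unfolding ab using cl by (simp add: m_assoc)
  also have "\<dots> = b \<otimes> (a \<otimes> a [^] n) \<otimes> z \<otimes> (c [^] n \<otimes> z [^] n) \<otimes> c [^] ?k"
    unfolding pow_twisted[OF cl(1,3,4) za ca] using cl by (simp add: m_assoc)
  also have "c [^] n \<otimes> z [^] n = z [^] n \<otimes> c [^] n"
    using pow_intertwine[of z z "c [^] n" n] pow_intertwine[of c c z n] cz cl by simp
  also have "b \<otimes> (a \<otimes> a [^] n) \<otimes> z \<otimes> (z [^] n \<otimes> c [^] n) \<otimes> c [^] ?k
      = b \<otimes> (a \<otimes> a [^] n) \<otimes> (z \<otimes> z [^] n) \<otimes> (c [^] n \<otimes> c [^] ?k)" using cl by (simp add: m_assoc)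
  also have "\<dots> = b \<otimes> a [^] Suc n \<otimes> z [^] Suc n \<otimes> c [^] (Suc n choose 2)"
    using nat_pow_Suc2[OF cl(1), of n] nat_pow_Suc2[OF cl(3), of n] cl
    by (simp add: nat_pow_mult numeral_2_eq_2)
  finally show ?case .
qed

text \<open>The exponent \<open>n choose 2\<close> counts the pairs of an \<open>a\<close> and a
  later \<open>b\<close> that must be exchanged; \<open>z\<close> commutes with both and can be
  collected.\<close>

lemma (in group) pow_product:
  assumes cl: "a \<in> carrier G" "b \<in> carrier G" "z \<in> carrier G"
    and ab: "a \<otimes> b = b \<otimes> a \<otimes> z" and za: "z \<otimes> a = a \<otimes> z" and zb: "z \<otimes> b = b \<otimes> z"
  shows "(b \<otimes> a) [^] n = b [^] n \<otimes> a [^] n \<otimes> z [^] (n choose 2)"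
proof (induction n)
  case 0
  then show ?case using assms by (simp add: numeral_2_eq_2)
next
  case (Suc n)
  let ?k = "n choose 2"
  have zk: "z [^] i \<otimes> u = u \<otimes> z [^] i" if "z \<otimes> u = u \<otimes> z" "u \<in> carrier G" for u and i :: nat
    using pow_intertwine[of z z u i] that cl by simp
  have "(b \<otimes> a) [^] Suc n = b [^] n \<otimes> a [^] n \<otimes> (z [^] ?k \<otimes> b) \<otimes> a" using Suc cl by (simp add: m_assoc)
  also have "\<dots> = b [^] n \<otimes> (a [^] n \<otimes> b) \<otimes> (z [^] ?k \<otimes> a)"
    unfolding zk[OF zb cl(2)] using cl by (simp add: m_assoc)
  also have "a [^] n \<otimes> b = b \<otimes> a [^] n \<otimes> z [^] n"
    using pow_commutator[OF cl one_closed ab] za cl by simp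
  also have "b [^] n \<otimes> (b \<otimes> a [^] n \<otimes> z [^] n) \<otimes> (z [^] ?k \<otimes> a)
      = b [^] Suc n \<otimes> a [^] n \<otimes> z [^] (n + ?k) \<otimes> a"
    using cl by (simp add: m_assoc nat_pow_mult[symmetric])
  also have "\<dots> = b [^] Suc n \<otimes> a [^] n \<otimes> (z [^] (n + ?k) \<otimes> a)" using cl by (simp add: m_assoc)
  also have "\<dots> = b [^] Suc n \<otimes> a [^] Suc n \<otimes> z [^] (Suc n choose 2)"
    unfolding zk[OF za cl(1)] using cl by (simp add: m_assoc numeral_2_eq_2)
  finally show ?case .
qed

text \<open>For odd \<open>p\<close> the correction terms of \<open>pow_commutator\<close> and
  \<open>pow_product\<close> with exponent \<open>n choose 2\<close> disappear at
  \<open>n = p\<close>, provided that their base has trivial \<open>p\<close>-th power.\<close>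

lemma prime_dvd_choose_2:
  assumes "prime (p::nat)" "odd p"
  shows "p dvd (p choose 2)"
proof -
  have "even (p * (p - 1))" using assms by simp
  then have "2 * (p choose 2) = p * (p - 1)" unfolding choose_two by (rule dvd_mult_div_cancel)
  then have "p dvd 2 * (p choose 2)" by simp
  moreover have "\<not> p dvd 2" using primes_dvd_imp_eq[OF assms(1) two_is_prime_nat] assms(2) by auto
  ultimately show ?thesis using prime_dvd_multD[OF assms(1)] by blast
qed

section \<open>Index two subgroups and orders of elements\<close>

text \<open>There is just one coset besides \<open>P\<close>, so \<open>u\<close> and
  \<open>inv v\<close>, both outside \<open>P\<close>, share it.\<close>

lemma (in group) mult_mem_index_two:
  assumes P: "subgroup P G" and ord: "order G = 2 * card P" and fin: "finite (carrier G)"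
    and u: "u \<in> carrier G" "u \<notin> P" and v: "v \<in> carrier G" "v \<notin> P"
  shows "u \<otimes> v \<in> P"
proof -
  have Pc: "P \<subseteq> carrier G" using subgroup.subset[OF P] .
  have "card P \<noteq> 0" using P fin Pc by (metis card_0_eq finite_subset subgroup.one_closed empty_iff)
  then have "card (rcosets P) = 2" using lagrange[OF P] ord by simp
  moreover have mem: "P #> x \<in> rcosets P" if "x \<in> carrier G" for x using that Pc by (intro rcosetsI)
  moreover have neq: "P #> x \<noteq> P" if "x \<in> carrier G" "x \<notin> P" for x
    using coset_join1[OF _ that(1) P] that(2) by blast
  moreover have "P \<in> rcosets P" using mem[OF one_closed] Pc by simp
  moreover have "inv v \<notin> P" using v P subgroup.m_inv_closed inv_inv by metis
  ultimately have "P #> inv v = P #> u"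
    using u v by (metis (no_types, opaque_lifting) card_2_iff' inv_closed)
  then have "u \<in> P #> inv v" using rcos_self[OF u(1) P] by simp
  then obtain h where h: "h \<in> P" "u = h \<otimes> inv v" unfolding r_coset_def by blast
  then show ?thesis using v Pc by (simp add: m_assoc subset_iff)
qed

text \<open>Trivial intersection makes the products of a power of \<open>x\<close> and a power of
  \<open>y\<close> pairwise distinct. This is the easy half of tightness.\<close>

lemma (in group) ord_mult_ord_le:
  assumes fin: "finite (carrier G)" and cl: "x \<in> carrier G" "y \<in> carrier G"
    and int: "\<And>(i::nat) (j::nat). x [^] i = y [^] j \<Longrightarrow> x [^] i = \<one>"
  shows "ord x * ord y \<le> order G"
proof -
  have less: "x [^] i \<otimes> y [^] j \<noteq> x [^] i' \<otimes> y [^] j'"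
    if "i \<le> i'" "i' < ord x" "j < ord y" "j' < ord y" "(i, j) \<noteq> (i', j')" for i j i' j' :: nat
  proof
    assume eq: "x [^] i \<otimes> y [^] j = x [^] i' \<otimes> y [^] j'"
    have "x [^] i' = x [^] i \<otimes> x [^] (i' - i)" using that cl by (simp add: nat_pow_mult)
    then have e1: "y [^] j = x [^] (i' - i) \<otimes> y [^] j'" using eq cl by (simp add: m_assoc)
    \<comment> \<open>The exponent \<open>ord y - j'\<close> stands in for \<open>-j'\<close>, since
      \<open>int\<close> speaks of natural exponents only.\<close>
    have y1: "y [^] j' \<otimes> y [^] (ord y - j') = \<one>" using that cl by (simp add: nat_pow_mult)
    have "y [^] (j + (ord y - j')) = x [^] (i' - i) \<otimes> (y [^] j' \<otimes> y [^] (ord y - j'))"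
      using e1 cl by (simp add: nat_pow_mult[symmetric] m_assoc)
    then have "x [^] (i' - i) = y [^] (j + (ord y - j'))" using y1 cl by simp
    then have x1: "x [^] (i' - i) = \<one>" by (rule int)
    then have "ord x dvd i' - i" using pow_eq_id cl by blast
    then have "i' = i" using that by (auto dest: dvd_imp_le)
    moreover have "y [^] j = y [^] j'" using e1 x1 cl by simp
    then have "j = j'" using ord_inj[OF cl(2)] that by (auto simp: inj_on_def)
    ultimately show False using that by simp
  qed
  have "inj_on (\<lambda>(i, j). x [^] (i::nat) \<otimes> y [^] (j::nat)) ({..<ord x} \<times> {..<ord y})"
  proof (rule inj_onI, clarify)
    fix i j i' j' :: nat
    assume *: "i < ord x" "j < ord y" "i' < ord x" "j' < ord y"
      "x [^] i \<otimes> y [^] j = x [^] i' \<otimes> y [^] j'"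
    show "i = i' \<and> j = j'"
    proof (cases "i \<le> i'")
      case True
      then show ?thesis using less[OF True] * by blast
    next
      case False
      then show ?thesis using less[of i' i j' j] * by auto
    qed
  qed
  then have "card ({..<ord x} \<times> {..<ord y}) \<le> card (carrier G)"
    by (rule card_inj_on_le) (use cl fin in auto)
  then show ?thesis by (simp add: order_def)
qed

text \<open>Orders are powers of \<open>p\<close> here, so an order not dividing
  \<open>p ^ i\<close> is at least the next power.\<close>

lemma (in group) ord_ge_prime_power:
  assumes p: "prime (p::nat)" and P: "subgroup P G" "card P = p ^ n" and u: "u \<in> P"
    and neq: "u [^] (p ^ i) \<noteq> \<one>"
  shows "p ^ Suc i \<le> ord u"
proof -
  have uc: "u \<in> carrier G" using P u subgroup.mem_carrier by metis
  have "ord u dvd p ^ n" using ord_dvd_card_subgroup[OF P(1) u] P(2) by simp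
  then obtain k where k: "ord u = p ^ k" using divides_primepow_nat[OF p] by blast
  have "\<not> p ^ k dvd p ^ i" using neq pow_eq_id[OF uc] k by simp
  then have "Suc i \<le> k" using le_imp_power_dvd not_less_eq_eq by blast
  then show ?thesis unfolding k using prime_ge_1_nat[OF p] by (rule power_increasing)
qed

lemma (in group) conjugation_iso:
  assumes g: "g \<in> carrier G"
  shows "(\<lambda>v. inv g \<otimes> v \<otimes> g) \<in> iso G G"
proof -
  have c: "inv g \<otimes> (g \<otimes> v) = v" "g \<otimes> (inv g \<otimes> v) = v" if "v \<in> carrier G" for v
    using inv_mult_cancel g that by auto
  have "bij_betw (\<lambda>v. inv g \<otimes> v \<otimes> g) (carrier G) (carrier G)"
    by (rule bij_betw_byWitness[of _ "\<lambda>v. g \<otimes> v \<otimes> inv g"]) (use g c in \<open>auto simp: m_assoc\<close>)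
  then show ?thesis unfolding iso_def hom_def using g c by (auto simp: m_assoc)
qed

section \<open>Groups of order $2p^3$ and $2p^4$\<close>

lemma (in group) order_2pm_tight_aux:
  fixes p m :: nat
  assumes p: "prime p" "odd p" and m: "m = 3 \<or> m = 4" and ord: "order G = 2 * p ^ m"
    and P: "subgroup P G" "card P = p ^ m"
    and xy: "x \<in> P" "y \<in> carrier G" "x \<noteq> y"
    and gen: "generate G {x, y} = carrier G"
    and inv2: "(x \<otimes> inv y) \<otimes> (x \<otimes> inv y) = \<one>"
    and int: "\<And>(i::nat) (j::nat). x [^] i = y [^] j \<Longrightarrow> x [^] i = \<one>"
    and noaut: "\<And>\<alpha>. \<alpha> \<in> iso G G \<Longrightarrow> \<alpha> x = inv x \<Longrightarrow> \<alpha> y \<noteq> inv y"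
  shows "ord x * ord y = 2 * p ^ m"
proof -
  have p1: "1 < p" using prime_gt_1_nat[OF p(1)] .
  have fin: "finite (carrier G)" using ord p1 order_gt_0_iff_finite by simp
  have Pc: "u \<in> carrier G" if "u \<in> P" for u using subgroup.mem_carrier[OF P(1) that] .
  note idx = mult_mem_index_two[OF P(1) _ fin]
  have ord': "order G = 2 * card P" using ord P by simp
  define t where "t = x \<otimes> inv y"
  define b where "b = t \<otimes> x \<otimes> t"
  have xc: "x \<in> carrier G" and yc: "y \<in> carrier G" using xy Pc by auto
  have tc: "t \<in> carrier G" unfolding t_def using xc yc by simp
  have bc: "b \<in> carrier G" unfolding b_def using xc tc by simp
  have tt: "t \<otimes> t = \<one>" using inv2 unfolding t_def .
  have tt': "t \<otimes> (t \<otimes> u) = u" if "u \<in> carrier G" for u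
    using tt tc that by (simp add: m_assoc[symmetric])
  have t1: "t \<noteq> \<one>" unfolding t_def using xc yc xy by (metis inv_equality inv_inv inv_closed)
  have tinv: "inv t = t" using tt tc by (simp add: inv_equality)
  have tP: "t \<notin> P"
  proof
    assume "t \<in> P"
    then have "ord t dvd p ^ m" using ord_dvd_card_subgroup[OF P(1)] P(2) by metis
    moreover have "t [^] (2::nat) = \<one>" using tt tc by (simp add: numeral_2_eq_2)
    then have "ord t dvd 2" using pow_eq_id[OF tc] by blast
    moreover have "ord t \<noteq> 1" using ord_eq_1[OF tc] t1 by simp
    ultimately have "even (p ^ m)" using two_is_prime_nat prime_nat_iff by metis
    then show False using p(2) by simp
  qed
  have yt: "y = t \<otimes> x"
  proof -
    have "t \<otimes> y = x" unfolding t_def using xc yc by (simp add: m_assoc)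
    then show ?thesis using tt'[OF yc] by simp
  qed
  have yP: "y \<notin> P"
  proof
    assume "y \<in> P"
    then have "y \<otimes> inv x \<in> P" using xy(1) P(1) subgroup.m_closed subgroup.m_inv_closed by metis
    moreover have "y \<otimes> inv x = t" unfolding yt using xc tc by (simp add: m_assoc)
    ultimately show False using tP by simp
  qed
  have bP: "b \<in> P" unfolding b_def using idx[OF ord' yc yP tc tP] yt by simp
  have tx: "t \<otimes> x = b \<otimes> t" unfolding b_def using tc xc tt by (simp add: m_assoc)
  have tb: "t \<otimes> b = x \<otimes> t" unfolding b_def using tc xc tt' by (simp add: m_assoc)
  have yy: "y \<otimes> y = b \<otimes> x" unfolding yt b_def using tc xc by (simp add: m_assoc)
  have bxP: "b \<otimes> x \<in> P" using bP xy(1) P(1) subgroup.m_closed by metis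
  have genxt: "generate G {x, t} = carrier G"
  proof -
    have "x \<in> generate G {x, t}" "t \<in> generate G {x, t}" by (auto intro: generate.incl)
    moreover have "y \<in> generate G {x, t}" unfolding yt using calculation generate.eng by metis
    ultimately have "generate G {x, y} \<subseteq> generate G {x, t}"
      using xc tc by (intro generate_subgroup_incl generate_is_subgroup) auto
    then show ?thesis using gen generate_incl[of "{x, t}"] xc tc by auto
  qed
  have ordy: "ord y = 2 * ord (b \<otimes> x)"
  proof -
    \<comment> \<open>With an odd order \<open>y\<close> would be a power of its square
      \<open>b \<otimes> x\<close>, which lies in \<open>P\<close>.\<close>
    have "even (ord y)"
    proof (rule ccontr)
      assume "odd (ord y)"
      then obtain k where k: "ord y = 2 * k + 1" by (rule oddE)
      have "y [^] (2 * Suc k) = y [^] ord y \<otimes> y" unfolding k using yc by (simp add: m_assoc nat_pow_mult)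
      then have "y = y [^] (2 * Suc k)" using yc by simp
      also have "\<dots> = (y [^] (2::nat)) [^] Suc k" using yc by (simp only: nat_pow_pow)
      also have "\<dots> = (b \<otimes> x) [^] Suc k" using yy yc by (simp add: numeral_2_eq_2)
      finally have "y = (b \<otimes> x) [^] Suc k" .
      moreover have "(b \<otimes> x) [^] Suc k \<in> P"
        using bxP subgroup.one_closed[OF P(1)] subgroup.m_closed[OF P(1)] by (induction k) auto
      ultimately show False using yP by simp
    qed
    moreover have "y [^] (2::nat) = b \<otimes> x" using yy yc by (simp add: numeral_2_eq_2)
    ultimately show ?thesis using ord_pow[OF yc, of 2] by auto
  qed
  have le: "ord x * ord y \<le> 2 * p ^ m" using ord_mult_ord_le[OF fin xc yc int] ord by simp
  \<comment> \<open>The trivial intersection already gives \<open>le\<close>, so only a lower bound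
    for the product of the two orders is missing.\<close>
  have tightI: ?thesis if "p ^ m \<le> ord x * ord (b \<otimes> x)"
    using that le ordy by auto
  define z where "z = inv (b \<otimes> x) \<otimes> (x \<otimes> b)"
  have zc: "z \<in> carrier G" unfolding z_def using xc bc by simp
  have xb: "x \<otimes> b = b \<otimes> x \<otimes> z" unfolding z_def using xc bc inv_mult_cancel(2)[of "b \<otimes> x" "x \<otimes> b"] by simp
  have xbP: "x \<otimes> b \<in> P" using bP xy(1) P(1) subgroup.m_closed by metis
  have zP: "z \<in> P" unfolding z_def using bxP xbP P(1) subgroup.m_closed subgroup.m_inv_closed by metis
  \<comment> \<open>The conflict with chirality, specialised to what all cases share:
    \<open>p\<close> is the exponent for \<open>z\<close> as well as for \<open>b\<close> modulo
    powers of \<open>x\<close> and \<open>c\<close>.\<close>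
  have NA: False
    if "c \<in> carrier G" "z \<otimes> x = x \<otimes> z \<otimes> c" "z \<otimes> b = b \<otimes> z \<otimes> c [^] n"
      "c \<otimes> x = x \<otimes> c" "c \<otimes> b = b \<otimes> c" "z [^] p = \<one>" "0 < s" "c [^] s = \<one>"
      "0 < q" "x [^] q = c [^] k" "b [^] p = x [^] i \<otimes> c [^] j" "2 * q * p * (p * s) \<le> 2 * p ^ m"
    for c and n s q k i j :: nat
  proof -
    have "\<exists>\<alpha>\<in>iso G G. \<alpha> x = inv x \<and> \<alpha> t = t"
      by (rule inverting_automorphism_exists[OF xc bc tc zc that(1) tx tt xb that(2-5) _ that(6-10) _ that(11) fin genxt])
        (use that p1 ord in auto)
    then obtain \<alpha> where \<alpha>: "\<alpha> \<in> iso G G" "\<alpha> x = inv x" "\<alpha> t = t" by blast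
    interpret \<alpha>: group_hom G G \<alpha> using \<alpha>(1) by unfold_locales (simp add: iso_def)
    \<comment> \<open>The map \<open>\<alpha>\<close> sends \<open>y = t \<otimes> x\<close> to
      \<open>t \<otimes> inv x\<close>; conjugation by \<open>x\<close> turns this into
      \<open>inv x \<otimes> t = inv y\<close> and does not affect \<open>inv x\<close>.\<close>
    let ?\<beta> = "(\<lambda>v. inv x \<otimes> v \<otimes> x) \<circ> \<alpha>"
    have "?\<beta> \<in> iso G G" by (rule iso_set_trans[OF \<alpha>(1) conjugation_iso[OF xc]])
    moreover have "?\<beta> x = inv x" using \<alpha> xc by (simp add: m_assoc)
    moreover have "?\<beta> y = inv y" unfolding yt using \<alpha> xc tc tinv by (simp add: m_assoc inv_mult_group)
    ultimately show False using noaut by blast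
  qed
  have bxpow: "b [^] (i::nat) = t \<otimes> x [^] i \<otimes> t" for i
    using pow_intertwine[OF xc bc tc tx] bc tc tt by (simp add: m_assoc)
  have bx1: "b \<otimes> x \<noteq> \<one>" if "z \<noteq> \<one>"
  proof
    assume "b \<otimes> x = \<one>"
    then have "b = inv x" using inv_equality xc bc by metis
    then have "z = \<one>" unfolding z_def using xc by simp
    then show False using that by simp
  qed
  have ordbx: "p \<le> ord (b \<otimes> x)" if "z \<noteq> \<one>"
    using ord_ge_prime_power[OF p(1) P bxP, of 0] bx1[OF that] Pc[OF bxP] by simp
  interpret H: group "G\<lparr>carrier := P\<rparr>" by (rule subgroup_imp_group[OF P(1)])
  have ordH: "order (G\<lparr>carrier := P\<rparr>) = p ^ m" using P by (simp add: order_def)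
  have pow_le: "p ^ m \<le> ord x * ord (b \<otimes> x)" if "p ^ i \<le> ord x" "p ^ j \<le> ord (b \<otimes> x)" "i + j = m" for i j
    using mult_le_mono[OF that(1,2)] that(3) by (simp add: power_add[symmetric])
  have abelian: ?thesis if z1: "z = \<one>"
  proof -
    let ?r = "ord (b \<otimes> x)"
    have xbc: "b \<otimes> x = x \<otimes> b" using xb z1 xc bc by simp
    \<comment> \<open>Since \<open>b\<close> and \<open>x\<close> commute, \<open>b\<close> and
      \<open>b \<otimes> x\<close> have the same powers modulo powers of \<open>x\<close>. Hence
      \<open>?r\<close> is an admissible exponent for \<open>b\<close>, and no commutators have to
      be counted.\<close>
    have "card (generate G {x, t}) \<le> 2 * ord x * ?r * card {\<one>}"
    proof (rule card_generate_le[OF _ _ _ _ xc bc tc tx tb tt])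
      show "\<exists>w\<in>{\<one>}. b \<otimes> x = x \<otimes> b \<otimes> w" using xbc xc bc by simp
      show "0 < ord x" "0 < ?r" using ord_ge_1[OF fin] xc bc by (auto simp: Suc_le_eq)
      have "b [^] ?r \<otimes> x [^] ?r = \<one>" using pow_mult_distrib[OF xbc bc xc, of ?r] bc xc by simp
      then have "b [^] ?r = inv (x [^] ?r)" using inv_equality xc bc by simp
      also have "\<dots> = inv x [^] ?r" using xc by (simp add: nat_pow_inv)
      also have "inv x = x [^] (ord x - 1)" using inv_eq_pow[OF xc pow_ord_eq_1[OF xc] \<open>0 < ord x\<close>] .
      finally have "b [^] ?r = x [^] ((ord x - 1) * ?r) \<otimes> \<one>" using xc by (simp add: nat_pow_pow)
      then show "\<exists>i. \<exists>w\<in>{\<one>}. b [^] ?r = x [^] (i::nat) \<otimes> w" by blast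
    qed (use xc bc tc in auto)
    then have "p ^ m \<le> ord x * ?r" using genxt ord by (simp add: order_def)
    then show ?thesis by (rule tightI)
  qed
  have c3: ?thesis if m3: "m = 3" and z1: "z \<noteq> \<one>"
  proof (cases "x [^] p = \<one>")
    case False
    then have "p ^ 2 \<le> ord x" using ord_ge_prime_power[OF p(1) P xy(1), of 1] by (simp add: numeral_2_eq_2)
    then show ?thesis using tightI[OF pow_le[of 2 1]] ordbx[OF z1] m3 by simp
  next
    case True
    note Q = H.order_p_cubed_commutator[OF p(1), of x b z]
    have "z \<in> centralizer (G\<lparr>carrier := P\<rparr>) P"
      using Q(1) ordH m3 xy(1) bP zP xb by simp
    then have zx: "z \<otimes> x = x \<otimes> z" and zb: "z \<otimes> b = b \<otimes> z" using xy(1) bP by (auto simp: centralizer_def)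
    have "z [^]\<^bsub>G\<lparr>carrier := P\<rparr>\<^esub> p = \<one>" using Q(2) ordH m3 xy(1) bP zP xb by simp
    then have zp: "z [^] p = \<one>" by (simp only: nat_pow_consistent[symmetric])
    have "b [^] p = \<one>" using bxpow[of p] True tt tc by simp
    \<comment> \<open>Class 2 with \<open>x\<close>, \<open>b\<close> and \<open>z\<close> all of
      exponent \<open>p\<close>: the count is \<open>2 * p * p * p\<close>.\<close>
    then have False using NA[of \<one> 0 1 p 0 0 0] zx zb zp True xc bc zc p1 m3
      by (simp add: power_numeral_reduce)
    then show ?thesis ..
  qed
  have c4: ?thesis if m4: "m = 4" and zx: "z \<otimes> x = x \<otimes> z" and zb: "z \<otimes> b = b \<otimes> z" and zp: "z [^] p = \<one>"
    and z1: "z \<noteq> \<one>"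
  proof (cases "x [^] (p ^ 2) = \<one>")
    case False
    then have "p ^ 3 \<le> ord x" using ord_ge_prime_power[OF p(1) P xy(1), of 2] by (simp add: numeral_3_eq_3)
    then show ?thesis using tightI[OF pow_le[of 3 1]] ordbx[OF z1] m4 by simp
  next
    case xp2: True
    obtain l where l: "p choose 2 = p * l" using prime_dvd_choose_2[OF p] by (rule dvdE)
    have "z [^] (p choose 2) = \<one>" unfolding l using zc zp by (simp add: nat_pow_pow[symmetric])
    \<comment> \<open>The central correction has vanished, so taking \<open>p\<close>-th powers is
      multiplicative on \<open>b\<close> and \<open>x\<close>.\<close>
    then have prod: "(b \<otimes> x) [^] p = b [^] p \<otimes> x [^] p"
      using pow_product[OF xc bc zc xb zx zb, of p] xc bc by simp
    show ?thesis
    proof (cases "(b \<otimes> x) [^] p = \<one>")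
      case False
      have "x [^] p \<noteq> \<one>"
      proof
        assume "x [^] p = \<one>"
        then have "(b \<otimes> x) [^] p = \<one>" unfolding prod using bxpow[of p] tt tc by simp
        then show False using False by simp
      qed
      then have "p ^ 2 \<le> ord x" "p ^ 2 \<le> ord (b \<otimes> x)"
        using ord_ge_prime_power[OF p(1) P, of _ 1] xy(1) bxP False by (simp_all add: numeral_2_eq_2)
      then show ?thesis using tightI[OF pow_le[of 2 2]] m4 by simp
    next
      case True
      then have "b [^] p = inv (x [^] p)" using prod inv_equality xc bc by simp
      \<comment> \<open>The relation must have the form \<open>b [^] p = x [^] i\<close> with
        natural \<open>i\<close>; as \<open>x [^] p\<close> has exponent \<open>p\<close>, its
        inverse is its power \<open>p - 1\<close>.\<close>
      also have "\<dots> = (x [^] p) [^] (p - 1)"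
        using xp2 xc p1 by (intro inv_eq_pow) (simp_all add: nat_pow_pow power2_eq_square)
      finally have bp: "b [^] p = x [^] (p * (p - 1))" using xc by (simp add: nat_pow_pow)
      \<comment> \<open>Class 2 with exponents \<open>p ^ 2\<close> for \<open>x\<close>,
        \<open>p\<close> for \<open>b\<close> modulo powers of \<open>x\<close>, and
        \<open>p\<close> for \<open>z\<close>: the count is \<open>2 * p ^ 4\<close>.\<close>
      have False using NA[of \<one> 0 1 "p ^ 2" 0 "p * (p - 1)" 0] bp zx zb zp xp2 xc bc zc p1 m4
        by (simp add: power_numeral_reduce)
      then show ?thesis ..
    qed
  qed
  have c4': ?thesis if m4: "m = 4" and z1: "z \<noteq> \<one>"
  proof -
    define c where "c = inv (x \<otimes> z) \<otimes> (z \<otimes> x)"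
    define d where "d = inv (b \<otimes> z) \<otimes> (z \<otimes> b)"
    have Pm: "u \<otimes> v \<in> P" "inv u \<in> P" if "u \<in> P" "v \<in> P" for u v
      using that P(1) subgroup.m_closed subgroup.m_inv_closed by metis+
    have cP: "c \<in> P" and dP: "d \<in> P" unfolding c_def d_def using Pm zP xy(1) bP by auto
    have cc: "c \<in> carrier G" and dc: "d \<in> carrier G" using cP dP Pc by auto
    have zx: "z \<otimes> x = x \<otimes> z \<otimes> c" unfolding c_def using xc zc inv_mult_cancel(2)[of "x \<otimes> z" "z \<otimes> x"] by simp
    have zb: "z \<otimes> b = b \<otimes> z \<otimes> d" unfolding d_def using bc zc inv_mult_cancel(2)[of "b \<otimes> z" "z \<otimes> b"] by simp
    obtain N where N: "subgroup N (G\<lparr>carrier := P\<rparr>)" "card N = p"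
      "N \<subseteq> centralizer (G\<lparr>carrier := P\<rparr>) P" "c \<in> N" "d \<in> N"
      "z [^]\<^bsub>G\<lparr>carrier := P\<rparr>\<^esub> p \<in> N"
      "z \<in> N \<or> (\<exists>i::nat. \<exists>v\<in>N. x [^]\<^bsub>G\<lparr>carrier := P\<rparr>\<^esub> p = z [^]\<^bsub>G\<lparr>carrier := P\<rparr>\<^esub> i \<otimes> v)"
      by (rule H.order_p_fourth_commutator[OF p(1), of x b z c d])
        (use ordH m4 xy(1) bP zP cP dP xb zx zb in auto)
    have NG: "subgroup N G" by (rule incl_subgroup[OF P(1) N(1)])
    have Nc: "u \<in> carrier G" if "u \<in> N" for u using subgroup.mem_carrier[OF NG that] .
    have Ncomm: "u \<otimes> v = v \<otimes> u" if "u \<in> N" "v \<in> P" for u v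
      using N(3) that unfolding centralizer_def by auto
    have Npow: "u [^] (k::nat) \<in> N" if "u \<in> N" for u k
      using that subgroup.one_closed[OF NG] subgroup.m_closed[OF NG] by (induction k) auto
    have Np: "u [^] p = \<one>" if "u \<in> N" for u
      using ord_dvd_card_subgroup[OF NG that] N(2) pow_eq_id[OF Nc[OF that]] by simp
    have zpN: "z [^] p \<in> N" using N(6) by (simp only: nat_pow_consistent[symmetric])
    have xpN: "z \<in> N \<or> (\<exists>i::nat. \<exists>v\<in>N. x [^] p = z [^] i \<otimes> v)"
      using N(7) by (simp only: nat_pow_consistent[symmetric])
    \<comment> \<open>This symmetry makes \<open>c\<close> and \<open>d\<close> trivial together, so
      the class is decided by \<open>c\<close> alone.\<close>
    have tcd: "t \<otimes> c = inv d \<otimes> t"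
      by (rule swap_double_commutator[OF xc bc tc zc cc dc tx tb xb zx zb Ncomm[OF N(5) zP]])
    have cx: "c \<otimes> x = x \<otimes> c" and cb: "c \<otimes> b = b \<otimes> c" and cz: "c \<otimes> z = z \<otimes> c"
      using Ncomm[OF N(4)] xy(1) bP zP by auto
    obtain l where l: "p choose 2 = p * l" using prime_dvd_choose_2[OF p] by (rule dvdE)
    have "c [^] (p choose 2) = \<one>" unfolding l using cc Np[OF N(4)] by (simp add: nat_pow_pow[symmetric])
    then have xpb: "x [^] p \<otimes> b = b \<otimes> x [^] p \<otimes> z [^] p"
      using pow_commutator[OF xc bc zc cc xb zx cx cz, of p] xc bc zc by simp
    \<comment> \<open>The factor \<open>z [^] p\<close> in \<open>xpb\<close> is the commutator of
      \<open>x [^] p\<close> and \<open>b\<close>, so it suffices to show that these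
      commute.\<close>
    have zpI: "z [^] p = \<one>" if "x [^] p \<otimes> b = b \<otimes> x [^] p"
      using xpb that xc bc zc by (metis l_cancel_one m_closed nat_pow_closed)
    show ?thesis
    proof (cases "c = \<one>")
      case True
      then have "inv d \<otimes> t = \<one> \<otimes> t" using tcd tc by simp
      then have "inv d = \<one>" using right_cancel[of t "inv d" \<one>] tc dc by simp
      then have "d = \<one>" using dc by (metis inv_inv inv_one)
      then have zx': "z \<otimes> x = x \<otimes> z" and zb': "z \<otimes> b = b \<otimes> z" using zx zb True xc bc zc by auto
      have "z [^] p = \<one>"
        using xpN
      proof
        assume "z \<in> N"
        then show ?thesis by (rule Np)
      next
        assume "\<exists>i::nat. \<exists>v\<in>N. x [^] p = z [^] i \<otimes> v"
        then obtain i :: nat and v where v: "v \<in> N" "x [^] p = z [^] i \<otimes> v" by blast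
        have "x [^] p \<otimes> b = z [^] i \<otimes> (v \<otimes> b)" using v Nc bc zc by (simp add: m_assoc)
        also have "\<dots> = (z [^] i \<otimes> b) \<otimes> v" using Ncomm[OF v(1) bP] v(1) Nc bc zc by (simp add: m_assoc)
        also have "z [^] i \<otimes> b = b \<otimes> z [^] i" using pow_intertwine[of z z b i] zb' bc zc by simp
        also have "b \<otimes> z [^] i \<otimes> v = b \<otimes> x [^] p" using v Nc bc zc by (simp add: m_assoc)
        finally show ?thesis by (rule zpI)
      qed
      then show ?thesis using c4[OF m4 zx' zb' _ z1] by blast
    next
      case False
      have Ncyc: "\<exists>k::nat. u = c [^] k" if "u \<in> N" for u
        using prime_order_subgroup_powers[OF p(1) NG N(2) N(4) False that] by metis
      have zN: "z \<notin> N"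
      proof
        assume "z \<in> N"
        then have "x \<otimes> z \<otimes> c = x \<otimes> z" using zx Ncomm xy(1) by metis
        then show False using False xc zc cc by simp
      qed
      then obtain i :: nat and v where v: "v \<in> N" "x [^] p = z [^] i \<otimes> v" using xpN by blast
      have vc: "v \<in> carrier G" using Nc v by simp
      \<comment> \<open>As \<open>x\<close> commutes with its own power
        \<open>z [^] i \<otimes> v\<close> and with the central \<open>v\<close>, it commutes with
        \<open>z [^] i\<close>. But moving \<open>z [^] i\<close> past \<open>x\<close> costs
        \<open>c [^] i\<close>, which is therefore trivial. This forces \<open>p\<close> to divide
        \<open>i\<close> and brings \<open>x [^] p\<close> into \<open>N\<close>.\<close>
      have "x \<otimes> z [^] i = x \<otimes> z [^] i \<otimes> c [^] i"
      proof -
        have "(z [^] i \<otimes> x) \<otimes> v = z [^] i \<otimes> (v \<otimes> x)"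
          using Ncomm[OF v(1) xy(1)] vc xc zc by (simp add: m_assoc)
        also have "\<dots> = x [^] p \<otimes> x" using v(2) vc xc zc by (simp add: m_assoc)
        also have "\<dots> = x \<otimes> x [^] p" using nat_pow_Suc2[OF xc, of p] by simp
        also have "\<dots> = (x \<otimes> z [^] i) \<otimes> v" using v(2) vc xc zc by (simp add: m_assoc)
        finally have zix: "z [^] i \<otimes> x = x \<otimes> z [^] i" using vc xc zc by simp
        have "x \<otimes> (z \<otimes> c) = z \<otimes> x" using zx xc zc cc by (simp add: m_assoc)
        then have "z [^] i \<otimes> x = x \<otimes> (z \<otimes> c) [^] i"
          using pow_intertwine[of "z \<otimes> c" z x i] zc cc xc by simp
        also have "(z \<otimes> c) [^] i = z [^] i \<otimes> c [^] i" by (rule pow_mult_distrib[OF cz[symmetric] zc cc])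
        finally show ?thesis using zix zc cc xc by (simp add: m_assoc)
      qed
      then have ci: "c [^] i = \<one>" using xc zc cc by (metis l_cancel_one' m_closed nat_pow_closed)
      have "ord c = p"
        using ord_dvd_card_subgroup[OF NG N(4)] N(2) p(1) ord_eq_1[OF cc] False by (metis prime_nat_iff)
      then have "p dvd i" using ci pow_eq_id[OF cc] by simp
      then obtain e where e: "i = p * e" by (rule dvdE)
      have "z [^] i \<in> N" unfolding e using Npow[OF zpN, of e] zc by (simp add: nat_pow_pow)
      then have "x [^] p \<in> N" unfolding v(2) using v(1) subgroup.m_closed[OF NG] by blast
      then obtain k :: nat where k: "x [^] p = c [^] k" using Ncyc by blast
      have "t \<otimes> c [^] k = inv d [^] k \<otimes> t" by (rule pow_intertwine[OF cc _ tc tcd]) (use dc in simp)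
      then have "b [^] p = inv d [^] k" using bxpow[of p] k tc dc tt by (simp add: m_assoc)
      moreover have "inv d \<in> N" by (rule subgroup.m_inv_closed[OF NG N(5)])
      ultimately have "b [^] p \<in> N" using Npow by simp
      then obtain j :: nat where j: "b [^] p = c [^] j" using Ncyc by blast
      obtain n :: nat where n: "d = c [^] n" using Ncyc[OF N(5)] by blast
      have "z [^] p = \<one>" using zpI Ncomm[OF \<open>x [^] p \<in> N\<close> bP] by blast
      \<comment> \<open>In class 3 the \<open>p\<close>-th powers of \<open>x\<close> and
        \<open>b\<close> are powers of \<open>c\<close>, while those of \<open>z\<close> and
        \<open>c\<close> are trivial. All four exponents are \<open>p\<close>, and the count is
        \<open>2 * p ^ 4\<close> without any further case distinction.\<close>
      then have False using NA[OF cc zx zb[unfolded n] cx cb _ _ Np[OF N(4)] _ k, of 0 j] j p1 cc m4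
        by (simp add: power_numeral_reduce)
      then show ?thesis ..
    qed
  qed
  show ?thesis using m abelian c3 c4' by blast
qed

text \<open>Exchanging \<open>x\<close> and \<open>y\<close> inverts the involution and preserves
  the other hypotheses, so it is enough that one of them lies in \<open>P\<close>. If neither did,
  the involution would lie in \<open>P\<close>, whose order is odd.\<close>

theorem (in group) order_2pm_tight:
  fixes p m :: nat
  assumes p: "prime p" "odd p" and m: "m = 3 \<or> m = 4" and ord: "order G = 2 * p ^ m"
    and xy: "x \<in> carrier G" "y \<in> carrier G" "x \<noteq> y"
    and gen: "generate G {x, y} = carrier G"
    and inv2: "(x \<otimes> inv y) \<otimes> (x \<otimes> inv y) = \<one>"
    and int: "generate G {x} \<inter> generate G {y} = {\<one>}"
    and noaut: "\<not> (\<exists>\<alpha>\<in>iso G G. \<alpha> x = inv x \<and> \<alpha> y = inv y)"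
  shows "ord x * ord y = 2 * p ^ m"
proof -
  have p0: "0 < p" using prime_gt_0_nat[OF p(1)] .
  have fin: "finite (carrier G)" using ord p0 order_gt_0_iff_finite by simp
  obtain P where P: "subgroup P G" "card P = p ^ m"
    using sylow_thm[OF p(1) is_group, of m 2] ord fin by (auto simp: mult.commute)
  have pow: "u [^] (i::nat) \<in> generate G {u}" if "u \<in> carrier G" for u i
    using that by (induction i) (auto intro: generate.one generate.incl generate.eng)
  have int': "x [^] i = \<one>" if "x [^] i = y [^] j" for i j :: nat
    using pow[OF xy(1), of i] pow[OF xy(2), of j] that int by auto
  show ?thesis
  proof (cases "x \<in> P")
    case True
    show ?thesis
      by (rule order_2pm_tight_aux[OF p m ord P True xy(2,3) gen inv2 int']) (use noaut in blast)+
  next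
    case False
    have y: "y \<in> P"
    proof (rule ccontr)
      assume "y \<notin> P"
      then have "inv y \<notin> P" using P(1) xy(2) subgroup.m_inv_closed inv_inv by metis
      then have "x \<otimes> inv y \<in> P"
        using mult_mem_index_two[OF P(1) _ fin xy(1) False] ord P(2) xy(2) by simp
      then have "ord (x \<otimes> inv y) dvd p ^ m" using ord_dvd_card_subgroup[OF P(1)] P(2) by metis
      moreover have "(x \<otimes> inv y) [^] (2::nat) = \<one>" using inv2 xy by (simp add: numeral_2_eq_2)
      then have "ord (x \<otimes> inv y) dvd 2" using pow_eq_id xy by (metis inv_closed m_closed)
      moreover have "ord (x \<otimes> inv y) \<noteq> 1"
        using ord_eq_1[of "x \<otimes> inv y"] xy by (metis inv_closed inv_equality inv_inv m_closed)
      ultimately have "even (p ^ m)" using two_is_prime_nat prime_nat_iff by metis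
      then show False using p(2) by simp
    qed
    have "(y \<otimes> inv x) \<otimes> (y \<otimes> inv x) = inv ((x \<otimes> inv y) \<otimes> (x \<otimes> inv y))"
      using xy by (simp add: inv_mult_group)
    then have inv2': "(y \<otimes> inv x) \<otimes> (y \<otimes> inv x) = \<one>" using inv2 by simp
    have "ord y * ord x = 2 * p ^ m"
    proof (rule order_2pm_tight_aux[OF p m ord P y xy(1)])
      show "y [^] i = \<one>" if "y [^] i = x [^] j" for i j :: nat
        using int'[of j i] that by simp
    qed (use xy gen noaut inv2' in \<open>auto simp: insert_commute\<close>)
    then show ?thesis by (simp add: mult.commute)
  qed
qed

section \<open>Flags and automorphisms of polyhedra\<close>

context polyhedron
begin

abbreviation comparable :: "'a \<Rightarrow> 'a \<Rightarrow> bool" where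
  "comparable x y \<equiv> x = y \<or> lt P x y \<or> lt P y x"

abbreviation ranks :: "int set" where
  "ranks \<equiv> {-1, 0, 1, 2, 3}"

lemma atLeastAtMost_ranks: "{-1..3} = ranks"
  by auto

lemma leq_faces: "(x, y) \<in> leq P \<Longrightarrow> x \<in> faces P \<and> y \<in> faces P"
  using partial_order unfolding partial_order_on_def preorder_on_def by blast

lemma leq_refl: "x \<in> faces P \<Longrightarrow> (x, x) \<in> leq P"
  using partial_order unfolding partial_order_on_def preorder_on_def refl_on_def by blast

lemma leq_iff: "x \<in> faces P \<Longrightarrow> (x, y) \<in> leq P \<longleftrightarrow> x = y \<or> lt P x y"
  using leq_refl by (auto simp: lt_def)

lemma lt_faces: "lt P x y \<Longrightarrow> x \<in> faces P \<and> y \<in> faces P"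
  unfolding lt_def using leq_faces by blast

lemma lt_rk: "lt P x y \<Longrightarrow> rk P x < rk P y"
  using rk_strict_mono lt_faces unfolding monotone_on_def by blast

lemma lt_trans: "lt P x y \<Longrightarrow> lt P y z \<Longrightarrow> lt P x z"
  using partial_order unfolding partial_order_on_def preorder_on_def lt_def
  by (metis antisymD transD)

lemma rk_ranks: "x \<in> faces P \<Longrightarrow> rk P x \<in> ranks"
  using rk_range unfolding atLeastAtMost_ranks by blast

lemma comparable_lt: "comparable x y \<Longrightarrow> rk P x < rk P y \<Longrightarrow> lt P x y"
  using lt_rk by fastforce

lemma chain_iff:
  "pred_on.chain (faces P) (lt P) C \<longleftrightarrow> C \<subseteq> faces P \<and> (\<forall>x\<in>C. \<forall>y\<in>C. comparable x y)"
  unfolding pred_on.chain_def by blast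

lemma chain_rk_inj: "pred_on.chain (faces P) (lt P) C \<Longrightarrow> inj_on (rk P) C"
  unfolding chain_iff inj_on_def using lt_rk by (metis less_irrefl)

lemma chain_finite_card:
  assumes "pred_on.chain (faces P) (lt P) C"
  shows "finite C" "card C \<le> 5"
proof -
  have sub: "rk P ` C \<subseteq> ranks" using assms rk_ranks unfolding chain_iff by blast
  have inj: "inj_on (rk P) C" by (rule chain_rk_inj[OF assms])
  show "finite C" by (rule inj_on_finite[OF inj sub]) simp
  show "card C \<le> 5" using card_inj_on_le[OF inj sub] by simp
qed

lemma flag_chain: "flag P \<Phi> \<Longrightarrow> pred_on.chain (faces P) (lt P) \<Phi>"
  unfolding flag_def by (rule pred_on.maxchain_imp_chain)

lemma flag_faces: "flag P \<Phi> \<Longrightarrow> x \<in> \<Phi> \<Longrightarrow> x \<in> faces P"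
  using flag_chain unfolding chain_iff by blast

lemma flag_comparable: "flag P \<Phi> \<Longrightarrow> x \<in> \<Phi> \<Longrightarrow> y \<in> \<Phi> \<Longrightarrow> comparable x y"
  using flag_chain unfolding chain_iff by blast

lemma flag_rk_inj: "flag P \<Phi> \<Longrightarrow> inj_on (rk P) \<Phi>"
  using flag_chain chain_rk_inj by blast

lemma flag_rk_image:
  assumes "flag P \<Phi>"
  shows "rk P ` \<Phi> = ranks"
proof (rule card_subset_eq)
  show "rk P ` \<Phi> \<subseteq> ranks" using flag_faces[OF assms] rk_ranks by blast
  show "card (rk P ` \<Phi>) = card ranks" using card_image[OF flag_rk_inj[OF assms]] P2[OF assms] by simp
qed simp

lemma flagI:
  assumes "\<Phi> \<subseteq> faces P" "\<And>x y. x \<in> \<Phi> \<Longrightarrow> y \<in> \<Phi> \<Longrightarrow> comparable x y" "ranks \<subseteq> rk P ` \<Phi>"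
  shows "flag P \<Phi>"
proof -
  have "\<not> (pred_on.chain (faces P) (lt P) S \<and> \<Phi> \<subset> S)" for S
  proof
    assume S: "pred_on.chain (faces P) (lt P) S \<and> \<Phi> \<subset> S"
    then obtain y where y: "y \<in> S" "y \<notin> \<Phi>" by blast
    then have "rk P y \<in> rk P ` \<Phi>" using S assms(3) rk_ranks unfolding chain_iff by blast
    then obtain x where "x \<in> \<Phi>" "rk P x = rk P y" by auto
    then have "x = y" using chain_rk_inj S y by (meson inj_onD psubsetD)
    then show False using \<open>x \<in> \<Phi>\<close> y by simp
  qed
  moreover have "pred_on.chain (faces P) (lt P) \<Phi>" unfolding chain_iff using assms(1,2) by blast
  ultimately show ?thesis unfolding flag_def pred_on.maxchain_def by blast
qed

lemma chain_extend_flag: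
  assumes "pred_on.chain (faces P) (lt P) C"
  obtains \<Phi> where "flag P \<Phi>" "C \<subseteq> \<Phi>"
proof -
  let ?Q = "\<lambda>D. pred_on.chain (faces P) (lt P) D \<and> C \<subseteq> D"
  \<comment> \<open>Chains have at most five elements, so one of greatest cardinality exists even if
    there are infinitely many faces.\<close>
  have "\<exists>D. ?Q D \<and> (\<forall>E. ?Q E \<longrightarrow> card E \<le> card D)"
    by (rule ex_has_greatest_nat[of _ C _ 6]) (use assms chain_finite_card in fastforce)+
  then obtain D where D: "?Q D" "\<And>E. ?Q E \<Longrightarrow> card E \<le> card D" by blast
  have "\<not> (pred_on.chain (faces P) (lt P) S \<and> D \<subset> S)" for S
  proof
    assume S: "pred_on.chain (faces P) (lt P) S \<and> D \<subset> S"
    then have "card D < card S" using chain_finite_card(1) by (meson psubset_card_mono)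
    moreover have "card S \<le> card D" using D S by blast
    ultimately show False by simp
  qed
  then have "flag P D" unfolding flag_def pred_on.maxchain_def using D by blast
  then show thesis using that D by blast
qed

lemma flag_through2:
  assumes "x \<in> faces P" "y \<in> faces P" "comparable x y"
  obtains \<Phi> where "flag P \<Phi>" "x \<in> \<Phi>" "y \<in> \<Phi>"
proof -
  have "pred_on.chain (faces P) (lt P) {x, y}" unfolding chain_iff using assms by auto
  then show thesis using that by (rule chain_extend_flag) auto
qed

definition face :: "'a set \<Rightarrow> int \<Rightarrow> 'a" where
  "face \<Phi> i = the_inv_into \<Phi> (rk P) i"

lemma face:
  assumes "flag P \<Phi>" "i \<in> ranks"
  shows "face \<Phi> i \<in> \<Phi>" "rk P (face \<Phi> i) = i" "face \<Phi> i \<in> faces P"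
proof -
  have i: "i \<in> rk P ` \<Phi>" using flag_rk_image assms by blast
  show "face \<Phi> i \<in> \<Phi>" unfolding face_def by (rule the_inv_into_into[OF flag_rk_inj[OF assms(1)] i]) simp
  then show "face \<Phi> i \<in> faces P" using flag_faces assms by blast
  show "rk P (face \<Phi> i) = i" unfolding face_def by (rule f_the_inv_into_f[OF flag_rk_inj[OF assms(1)] i])
qed

lemma face_rk: "flag P \<Phi> \<Longrightarrow> x \<in> \<Phi> \<Longrightarrow> face \<Phi> (rk P x) = x"
  unfolding face_def by (rule the_inv_into_f_f[OF flag_rk_inj])

lemma face_eqI: "flag P \<Phi> \<Longrightarrow> x \<in> \<Phi> \<Longrightarrow> rk P x = i \<Longrightarrow> face \<Phi> i = x"
  using face_rk[of \<Phi> x] by simp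

lemma flag_eq_image:
  assumes "flag P \<Phi>"
  shows "\<Phi> = face \<Phi> ` ranks"
proof
  show "\<Phi> \<subseteq> face \<Phi> ` ranks" using face_rk[OF assms] flag_faces[OF assms] rk_ranks by (metis image_eqI subsetI)
  show "face \<Phi> ` ranks \<subseteq> \<Phi>" using face[OF assms] by blast
qed

lemma flag_eqI:
  assumes "flag P \<Phi>" "flag P \<Psi>" "\<And>i. i \<in> ranks \<Longrightarrow> face \<Phi> i = face \<Psi> i"
  shows "\<Phi> = \<Psi>"
proof -
  have "face \<Phi> ` ranks = face \<Psi> ` ranks" by (rule image_cong[OF refl assms(3)])
  then show ?thesis by (simp only: flag_eq_image[OF assms(1), symmetric] flag_eq_image[OF assms(2), symmetric])
qed

lemma face_lt:
  assumes "flag P \<Phi>" "i \<in> ranks" "j \<in> ranks" "i < j"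
  shows "lt P (face \<Phi> i) (face \<Phi> j)"
proof (rule comparable_lt)
  show "comparable (face \<Phi> i) (face \<Phi> j)"
    by (rule flag_comparable[OF assms(1) face(1)[OF assms(1,2)] face(1)[OF assms(1,3)]])
  show "rk P (face \<Phi> i) < rk P (face \<Phi> j)" using face(2)[OF assms(1)] assms(2-4) by simp
qed

text \<open>A second face of rank -1 would lie strictly above the least face and push the rank of
  the latter below -1; dually for rank 3. Hence flags never differ in these ranks.\<close>

lemma least_unique:
  assumes "x \<in> faces P" "y \<in> faces P" "rk P x = rk P y" "rk P x = -1 \<or> rk P x = 3"
  shows "x = y"
proof -
  obtain B where B: "B \<in> faces P" "\<And>H. H \<in> faces P \<Longrightarrow> (B, H) \<in> leq P" using P1_least by blast
  obtain T where T: "T \<in> faces P" "\<And>H. H \<in> faces P \<Longrightarrow> (H, T) \<in> leq P" using P1_greatest by blast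
  have b: "u = B" if "u \<in> faces P" "rk P u = -1" for u
  proof (rule ccontr)
    assume "u \<noteq> B"
    then have "lt P B u" using B(2)[OF that(1)] by (simp add: lt_def)
    then have "rk P B < -1" using lt_rk that by fastforce
    then show False using rk_ranks[OF B(1)] by auto
  qed
  have t: "u = T" if "u \<in> faces P" "rk P u = 3" for u
  proof (rule ccontr)
    assume "u \<noteq> T"
    then have "lt P u T" using T(2)[OF that(1)] by (simp add: lt_def)
    then have "3 < rk P T" using lt_rk that by fastforce
    then show False using rk_ranks[OF T(1)] by auto
  qed
  show ?thesis using b t assms by metis
qed

section \<open>Adjacent flags\<close>

text \<open>The set comparison inside \<open>adj_flag\<close>, read rank by rank.\<close>

definition agree :: "int \<Rightarrow> 'a set \<Rightarrow> 'a set \<Rightarrow> bool" where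
  "agree i \<Phi> \<Psi> \<longleftrightarrow> (\<forall>j\<in>ranks - {i}. face \<Phi> j = face \<Psi> j)"

lemma agree_iff:
  assumes "flag P \<Phi>" "flag P \<Psi>"
  shows "{x \<in> \<Psi>. rk P x \<noteq> i} = {x \<in> \<Phi>. rk P x \<noteq> i} \<longleftrightarrow> agree i \<Phi> \<Psi>"
proof -
  have *: "{x \<in> \<Psi>. rk P x \<noteq> i} = face \<Psi> ` (ranks - {i})" if "flag P \<Psi>" for \<Psi>
  proof
    show "{x \<in> \<Psi>. rk P x \<noteq> i} \<subseteq> face \<Psi> ` (ranks - {i})"
    proof
      fix x assume x: "x \<in> {x \<in> \<Psi>. rk P x \<noteq> i}"
      then have "x = face \<Psi> (rk P x)" "rk P x \<in> ranks - {i}"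
        using face_rk[OF that] rk_ranks flag_faces[OF that] by auto
      then show "x \<in> face \<Psi> ` (ranks - {i})" by blast
    qed
    show "face \<Psi> ` (ranks - {i}) \<subseteq> {x \<in> \<Psi>. rk P x \<noteq> i}"
    proof
      fix x assume "x \<in> face \<Psi> ` (ranks - {i})"
      then obtain j where "j \<in> ranks" "j \<noteq> i" "x = face \<Psi> j" by blast
      then show "x \<in> {x \<in> \<Psi>. rk P x \<noteq> i}" using face(1,2)[OF that] by simp
    qed
  qed
  show ?thesis
  proof
    assume eq: "{x \<in> \<Psi>. rk P x \<noteq> i} = {x \<in> \<Phi>. rk P x \<noteq> i}"
    show "agree i \<Phi> \<Psi>"
      unfolding agree_def
    proof
      fix j assume j: "j \<in> ranks - {i}"
      then have "face \<Phi> j \<in> {x \<in> \<Phi>. rk P x \<noteq> i}" using face[OF assms(1)] by auto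
      then have "face \<Phi> j \<in> \<Psi>" using eq by blast
      then have "face \<Psi> j = face \<Phi> j"
        by (rule face_eqI[OF assms(2)]) (use j face(2)[OF assms(1)] in blast)
      then show "face \<Phi> j = face \<Psi> j" ..
    qed
  next
    assume "agree i \<Phi> \<Psi>"
    then show "{x \<in> \<Psi>. rk P x \<noteq> i} = {x \<in> \<Phi>. rk P x \<noteq> i}"
      unfolding *[OF assms(1)] *[OF assms(2)] agree_def by (intro image_cong) auto
  qed
qed

text \<open>The diamond condition \<open>P4\<close> offers exactly one other face in rank
  \<open>i\<close>; comparability with the faces further away follows by transitivity through the
  two neighbouring ranks.\<close>

lemma adjacent_flag_ex1:
  assumes \<Phi>: "flag P \<Phi>" and i: "i \<in> {0, 1, 2}"
  shows "\<exists>!\<Psi>. flag P \<Psi> \<and> \<Psi> \<noteq> \<Phi> \<and> agree i \<Phi> \<Psi>"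
proof -
  let ?F = "face \<Phi> (i - 1)" and ?G = "face \<Phi> (i + 1)" and ?x = "face \<Phi> i"
  have ir: "i - 1 \<in> ranks" "i \<in> ranks" "i + 1 \<in> ranks" using i by auto
  note fF = face[OF \<Phi> ir(1)] and fx = face[OF \<Phi> ir(2)] and fG = face[OF \<Phi> ir(3)]
  define S where "S = {H \<in> faces P. rk P H = i \<and> lt P ?F H \<and> lt P H ?G}"
  have cS: "card S = 2" unfolding S_def
    using P4[OF i fF(3) fG(3) face_lt[OF \<Phi> ir(1,3)] fF(2) fG(2)] by simp
  have xS: "?x \<in> S" unfolding S_def using fx face_lt[OF \<Phi> ir(1,2)] face_lt[OF \<Phi> ir(2,3)] by simp
  obtain h where h: "h \<in> S" "h \<noteq> ?x" using cS xS by (metis card_2_iff')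
  have S2: "u = h" if "u \<in> S" "u \<noteq> ?x" for u using that h xS cS by (metis card_2_iff')
  have hf: "h \<in> faces P" "rk P h = i" "lt P ?F h" "lt P h ?G" using h unfolding S_def by auto
  define \<Psi> where "\<Psi> = insert h (\<Phi> - {?x})"
  have comp: "comparable h y" if "y \<in> \<Phi> - {?x}" for y
  proof -
    have y: "y \<in> \<Phi>" "y \<noteq> ?x" using that by auto
    have yf: "face \<Phi> (rk P y) = y" by (rule face_rk[OF \<Phi> y(1)])
    have yr: "rk P y \<in> ranks" using rk_ranks flag_faces[OF \<Phi> y(1)] .
    have "rk P y \<noteq> i" using y yf by auto
    then consider "rk P y = i - 1" | "rk P y < i - 1" | "rk P y = i + 1" | "rk P y > i + 1" by linarith
    then show ?thesis
    proof cases
      case 2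
      then have "lt P y ?F" using face_lt[OF \<Phi> yr ir(1)] yf by simp
      then show ?thesis using lt_trans hf by blast
    next
      case 4
      then have "lt P ?G y" using face_lt[OF \<Phi> ir(3) yr] yf by simp
      then show ?thesis using lt_trans hf by blast
    qed (use yf hf in auto)
  qed
  have \<Psi>f: "flag P \<Psi>"
  proof (rule flagI)
    show "\<Psi> \<subseteq> faces P" unfolding \<Psi>_def using hf flag_faces[OF \<Phi>] by blast
    show "comparable x y" if "x \<in> \<Psi>" "y \<in> \<Psi>" for x y
      using that comp flag_comparable[OF \<Phi>] unfolding \<Psi>_def by blast
    show "ranks \<subseteq> rk P ` \<Psi>"
    proof
      fix j assume j: "j \<in> ranks"
      show "j \<in> rk P ` \<Psi>"
      proof (cases "j = i")
        case True
        then show ?thesis unfolding \<Psi>_def using hf by blast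
      next
        case False
        then have "face \<Phi> j \<in> \<Psi>" unfolding \<Psi>_def using face[OF \<Phi> j] fx by auto
        then show ?thesis by (rule rev_image_eqI) (rule face(2)[OF \<Phi> j, symmetric])
      qed
    qed
  qed
  have h\<Phi>: "h \<notin> \<Phi>" using h face_eqI[OF \<Phi> _ hf(2)] by blast
  show ?thesis
  proof (rule ex1I[of _ \<Psi>], intro conjI)
    show "flag P \<Psi>" by (rule \<Psi>f)
    show "\<Psi> \<noteq> \<Phi>" using h\<Phi> unfolding \<Psi>_def by blast
    show "agree i \<Phi> \<Psi>"
      unfolding agree_def
    proof
      fix j assume j: "j \<in> ranks - {i}"
      then have jr: "j \<in> ranks" "j \<noteq> i" by blast+
      then have "face \<Phi> j \<noteq> ?x" using face(2)[OF \<Phi> jr(1)] fx(2) by metis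
      then have "face \<Phi> j \<in> \<Psi>" unfolding \<Psi>_def using face(1)[OF \<Phi> jr(1)] by blast
      then show "face \<Phi> j = face \<Psi> j"
        by (rule face_eqI[OF \<Psi>f _ face(2)[OF \<Phi> jr(1)], symmetric])
    qed
    fix X assume X: "flag P X \<and> X \<noteq> \<Phi> \<and> agree i \<Phi> X"
    then have Xf: "flag P X" and ag: "\<And>j. j \<in> ranks \<Longrightarrow> j \<noteq> i \<Longrightarrow> face X j = face \<Phi> j"
      unfolding agree_def by simp_all
    have FX: "face X (i - 1) = ?F" "face X (i + 1) = ?G" using ag ir by auto
    have "face X i \<in> S"
      unfolding S_def using face[OF Xf ir(2)] face_lt[OF Xf ir(1,2)] face_lt[OF Xf ir(2,3)] FX by simp
    moreover have "face X i \<noteq> ?x"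
    proof
      assume eq: "face X i = ?x"
      have "X = \<Phi>"
      proof (rule flag_eqI[OF Xf \<Phi>])
        show "face X j = face \<Phi> j" if "j \<in> ranks" for j
          using ag[OF that] eq by (cases "j = i") simp_all
      qed
      then show False using X by simp
    qed
    ultimately have Xi: "face X i = h" by (rule S2)
    have \<Psi>i: "face \<Psi> i = h" by (rule face_eqI[OF \<Psi>f _ hf(2)]) (simp add: \<Psi>_def)
    have \<Psi>j: "face \<Psi> j = face \<Phi> j" if "j \<in> ranks" "j \<noteq> i" for j
      using \<open>agree i \<Phi> \<Psi>\<close> that unfolding agree_def by simp
    show "X = \<Psi>"
    proof (rule flag_eqI[OF Xf \<Psi>f])
      show "face X j = face \<Psi> j" if "j \<in> ranks" for j
        using ag[OF that] \<Psi>j[OF that] \<Psi>i Xi by (cases "j = i") simp_all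
    qed
  qed
qed

lemma adj_flag_eq:
  assumes "flag P \<Phi>"
  shows "adj_flag P i \<Phi> = (THE \<Psi>. flag P \<Psi> \<and> \<Psi> \<noteq> \<Phi> \<and> agree i \<Phi> \<Psi>)"
proof -
  have "(flag P \<Psi> \<and> \<Psi> \<noteq> \<Phi> \<and> {x \<in> \<Psi>. rk P x \<noteq> i} = {x \<in> \<Phi>. rk P x \<noteq> i})
      = (flag P \<Psi> \<and> \<Psi> \<noteq> \<Phi> \<and> agree i \<Phi> \<Psi>)" for \<Psi>
    using agree_iff[OF assms, of \<Psi> i] by argo
  then show ?thesis unfolding adj_flag_def by presburger
qed

lemma adj_flag:
  assumes "flag P \<Phi>" "i \<in> {0, 1, 2}"
  shows "flag P (adj_flag P i \<Phi>)" "adj_flag P i \<Phi> \<noteq> \<Phi>"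
    "\<And>j. j \<in> ranks \<Longrightarrow> j \<noteq> i \<Longrightarrow> face (adj_flag P i \<Phi>) j = face \<Phi> j"
proof -
  have *: "flag P (adj_flag P i \<Phi>) \<and> adj_flag P i \<Phi> \<noteq> \<Phi> \<and> agree i \<Phi> (adj_flag P i \<Phi>)"
    unfolding adj_flag_eq[OF assms(1)] by (rule theI'[OF adjacent_flag_ex1[OF assms]])
  then show "flag P (adj_flag P i \<Phi>)" "adj_flag P i \<Phi> \<noteq> \<Phi>" by blast+
  show "face (adj_flag P i \<Phi>) j = face \<Phi> j" if "j \<in> ranks" "j \<noteq> i" for j
    using * that unfolding agree_def by (metis DiffI singletonD)
qed

lemma adj_flag_eqI:
  assumes "flag P \<Phi>" "i \<in> {0, 1, 2}" "flag P \<Psi>" "\<Psi> \<noteq> \<Phi>"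
    "\<And>j. j \<in> ranks \<Longrightarrow> j \<noteq> i \<Longrightarrow> face \<Phi> j = face \<Psi> j"
  shows "adj_flag P i \<Phi> = \<Psi>"
proof -
  have "agree i \<Phi> \<Psi>" unfolding agree_def using assms(5) by blast
  then show ?thesis unfolding adj_flag_eq[OF assms(1)]
    by (intro the1_equality[OF adjacent_flag_ex1[OF assms(1,2)]] conjI assms(3,4))
qed

lemma adj_flag_involution:
  assumes "flag P \<Phi>" "i \<in> {0, 1, 2}"
  shows "adj_flag P i (adj_flag P i \<Phi>) = \<Phi>"
  by (rule adj_flag_eqI[OF adj_flag(1)[OF assms] assms(2,1) adj_flag(2)[OF assms, symmetric] adj_flag(3)[OF assms]])

lemma face_adj_flag_neq:
  assumes "flag P \<Phi>" "i \<in> {0, 1, 2}"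
  shows "face (adj_flag P i \<Phi>) i \<noteq> face \<Phi> i"
proof
  assume "face (adj_flag P i \<Phi>) i = face \<Phi> i"
  then have "face (adj_flag P i \<Phi>) j = face \<Phi> j" if "j \<in> ranks" for j
    using adj_flag(3)[OF assms that] by (cases "j = i") simp_all
  then have "adj_flag P i \<Phi> = \<Phi>" by (rule flag_eqI[OF adj_flag(1)[OF assms] assms(1)])
  then show False using adj_flag(2)[OF assms] by simp
qed

text \<open>Rank 2 is the point to check: both sides replace the same face between the same faces of
  ranks 1 and 3, and \<open>P4\<close> leaves only one replacement.\<close>

lemma adj_flag_0_2_commute:
  assumes "flag P \<Phi>"
  shows "adj_flag P 0 (adj_flag P 2 \<Phi>) = adj_flag P 2 (adj_flag P 0 \<Phi>)"
proof (rule adj_flag_eqI)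
  note a0 = adj_flag[OF assms, of 0] and a2 = adj_flag[OF assms, of 2]
  let ?X = "adj_flag P 2 (adj_flag P 0 \<Phi>)"
  have a02: "flag P ?X" "\<And>j. j \<in> ranks \<Longrightarrow> j \<noteq> 2 \<Longrightarrow> face ?X j = face (adj_flag P 0 \<Phi>) j"
    "face ?X 2 \<noteq> face (adj_flag P 0 \<Phi>) 2"
    using adj_flag[OF a0(1), of 2] face_adj_flag_neq[OF a0(1), of 2] by auto
  show "flag P (adj_flag P 2 \<Phi>)" "flag P ?X" using a2 a02 by auto
  have "face (adj_flag P 2 \<Phi>) 0 = face \<Phi> 0" using a2(3) by simp
  moreover have "face ?X 0 = face (adj_flag P 0 \<Phi>) 0" using a02(2) by simp
  ultimately show "?X \<noteq> adj_flag P 2 \<Phi>" using face_adj_flag_neq[OF assms, of 0] by auto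
  fix j assume j: "j \<in> ranks" "j \<noteq> 0"
  show "face (adj_flag P 2 \<Phi>) j = face ?X j"
  proof (cases "j = 2")
    case False
    then show ?thesis using a2(3)[OF _ j(1)] a0(3)[OF _ j] a02(2)[OF j(1)] by simp
  next
    case True
    let ?Y = "adj_flag P 2 \<Phi>"
    have r: "(1::int) \<in> ranks" "(2::int) \<in> ranks" "(3::int) \<in> ranks" by auto
    define S where "S = {H \<in> faces P. rk P H = 2 \<and> lt P (face \<Phi> 1) H \<and> lt P H (face \<Phi> 3)}"
    have "card S = 2" unfolding S_def
      using P4[of 2 "face \<Phi> 1" "face \<Phi> 3"] face[OF assms r(1)] face[OF assms r(3)] face_lt[OF assms r(1,3)] by simp
    moreover have in_S: "face Z 2 \<in> S" if "flag P Z" "face Z 1 = face \<Phi> 1" "face Z 3 = face \<Phi> 3" for Z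
      unfolding S_def using face[OF that(1) r(2)] face_lt[OF that(1) r(1,2)] face_lt[OF that(1) r(2,3)] that by simp
    moreover have "face ?Y 2 \<noteq> face \<Phi> 2" using face_adj_flag_neq[OF assms, of 2] by simp
    moreover have "face ?X 2 \<noteq> face \<Phi> 2" using a02(3) a0(3)[of 2] by simp
    moreover have "face ?X 1 = face \<Phi> 1" "face ?X 3 = face \<Phi> 3" using a02(2)[of 1] a02(2)[of 3] a0(3)[of 1] a0(3)[of 3] by auto
    moreover have "face ?Y 1 = face \<Phi> 1" "face ?Y 3 = face \<Phi> 3" using a2(3)[of 1] a2(3)[of 3] by auto
    ultimately have "face ?Y 2 = face ?X 2"
      using in_S[OF assms] in_S[of ?X] in_S[of ?Y] a2(1) a02(1) by (metis card_2_iff' insertI1 insertI2)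
    then show ?thesis using True by simp
  qed
qed simp

section \<open>Automorphisms acting on flags\<close>

lemma Aut_iff:
  "g \<in> carrier (Aut P) \<longleftrightarrow> g \<in> extensional (faces P) \<and> bij_betw g (faces P) (faces P) \<and>
    (\<forall>x\<in>faces P. \<forall>y\<in>faces P. (g x, g y) \<in> leq P \<longleftrightarrow> (x, y) \<in> leq P)"
  by (auto simp: Aut_def Bij_def)

lemma Aut_one: "\<one>\<^bsub>Aut P\<^esub> = (\<lambda>x\<in>faces P. x)"
  by (simp add: Aut_def)

lemma Aut_mult_apply: "x \<in> faces P \<Longrightarrow> (f \<otimes>\<^bsub>Aut P\<^esub> g) x = g (f x)"
  by (simp add: Aut_def compose_eq)

lemma Aut_mult_image: "\<Phi> \<subseteq> faces P \<Longrightarrow> (f \<otimes>\<^bsub>Aut P\<^esub> g) ` \<Phi> = g ` (f ` \<Phi>)"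
  by (force simp: Aut_mult_apply image_iff subset_iff)

lemma Aut_faces: "g \<in> carrier (Aut P) \<Longrightarrow> x \<in> faces P \<Longrightarrow> g x \<in> faces P"
  unfolding Aut_iff by (meson bij_betwE)

lemma Aut_inj: "g \<in> carrier (Aut P) \<Longrightarrow> inj_on g (faces P)"
  unfolding Aut_iff by (meson bij_betw_imp_inj_on)

lemma Aut_lt:
  assumes "g \<in> carrier (Aut P)" "x \<in> faces P" "y \<in> faces P"
  shows "lt P (g x) (g y) \<longleftrightarrow> lt P x y"
  using assms Aut_inj[OF assms(1)] unfolding lt_def Aut_iff by (metis inj_onD)

text \<open>Along a flag through \<open>x\<close> the images have five strictly increasing ranks
  between -1 and 3, which leaves no choice.\<close>

lemma Aut_rk:
  assumes g: "g \<in> carrier (Aut P)" and x: "x \<in> faces P"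
  shows "rk P (g x) = rk P x"
proof -
  obtain \<Phi> where \<Phi>: "flag P \<Phi>" "x \<in> \<Phi>" using flag_through2[OF x x] by blast
  let ?r = "\<lambda>i. rk P (g (face \<Phi> i))"
  have step: "?r i < ?r j" if "i \<in> ranks" "j \<in> ranks" "i < j" for i j
    by (rule lt_rk, subst Aut_lt[OF g face(3)[OF \<Phi>(1) that(1)] face(3)[OF \<Phi>(1) that(2)]])
      (rule face_lt[OF \<Phi>(1) that])
  have "?r i \<in> ranks" if "i \<in> ranks" for i
    by (rule rk_ranks[OF Aut_faces[OF g face(3)[OF \<Phi>(1) that]]])
  from this[of "-1"] this[of 3] have "-1 \<le> ?r (-1)" "?r 3 \<le> 3" by auto
  moreover have "?r (-1) < ?r 0" "?r 0 < ?r 1" "?r 1 < ?r 2" "?r 2 < ?r 3" by (rule step; simp)+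
  ultimately have "?r (-1) = -1" "?r 0 = 0" "?r 1 = 1" "?r 2 = 2" "?r 3 = 3" by linarith+
  then have "?r i = i" if "i \<in> ranks" for i using that by auto
  from this[OF rk_ranks[OF x]] show ?thesis using face_rk[OF \<Phi>] by simp
qed

lemma flag_subset: "flag P \<Phi> \<Longrightarrow> \<Phi> \<subseteq> faces P"
  using flag_faces by blast

lemma Aut_flag:
  assumes g: "g \<in> carrier (Aut P)" and \<Phi>: "flag P \<Phi>"
  shows "flag P (g ` \<Phi>)"
proof (rule flagI)
  show "g ` \<Phi> \<subseteq> faces P" using Aut_faces[OF g] flag_faces[OF \<Phi>] by blast
  show "comparable x y" if xy: "x \<in> g ` \<Phi>" "y \<in> g ` \<Phi>" for x y
  proof -
    obtain u v where uv: "u \<in> \<Phi>" "v \<in> \<Phi>" "x = g u" "y = g v" using xy by blast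
    then show ?thesis
      using flag_comparable[OF \<Phi> uv(1,2)] Aut_lt[OF g] flag_faces[OF \<Phi>] by metis
  qed
  have "rk P ` (g ` \<Phi>) = rk P ` \<Phi>"
    unfolding image_image by (rule image_cong[OF refl Aut_rk[OF g flag_faces[OF \<Phi>]]])
  then show "ranks \<subseteq> rk P ` (g ` \<Phi>)" using flag_rk_image[OF \<Phi>] by simp
qed

lemma face_image:
  assumes "g \<in> carrier (Aut P)" "flag P \<Phi>" "i \<in> ranks"
  shows "face (g ` \<Phi>) i = g (face \<Phi> i)"
  by (rule face_eqI[OF Aut_flag[OF assms(1,2)]])
    (use face[OF assms(2,3)] Aut_rk[OF assms(1)] in auto)

lemma Aut_image_inj:
  assumes "g \<in> carrier (Aut P)" "flag P \<Phi>" "flag P \<Psi>" "g ` \<Phi> = g ` \<Psi>"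
  shows "\<Phi> = \<Psi>"
  using inj_on_image_eq_iff[OF Aut_inj[OF assms(1)]] flag_subset assms(2-4) by metis

lemma Aut_adj_flag:
  assumes g: "g \<in> carrier (Aut P)" and \<Phi>: "flag P \<Phi>" and i: "i \<in> {0, 1, 2}"
  shows "g ` adj_flag P i \<Phi> = adj_flag P i (g ` \<Phi>)"
proof (rule adj_flag_eqI[symmetric])
  note a = adj_flag[OF \<Phi> i]
  show "flag P (g ` \<Phi>)" "flag P (g ` adj_flag P i \<Phi>)" using Aut_flag[OF g] \<Phi> a(1) by auto
  show "g ` adj_flag P i \<Phi> \<noteq> g ` \<Phi>" using Aut_image_inj[OF g a(1) \<Phi>] a(2) by blast
  show "face (g ` \<Phi>) j = face (g ` adj_flag P i \<Phi>) j" if "j \<in> ranks" "j \<noteq> i" for j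
    using face_image[OF g \<Phi> that(1)] face_image[OF g a(1) that(1)] a(3)[OF that] by simp
qed (rule i)

text \<open>Translates the rank-free adjacency of \<open>P3\<close> and of chirality into
  \<open>adj_flag\<close>; ranks -1 and 3 are excluded because each of them has only one
  face.\<close>

lemma adjacent_imp_adj_flag:
  assumes \<Phi>: "flag P \<Phi>" and \<Psi>: "flag P \<Psi>" and adj: "adjacent \<Phi> \<Psi>"
  obtains i where "i \<in> {0, 1, 2}" "\<Psi> = adj_flag P i \<Phi>"
proof -
  obtain x where x: "\<Phi> - \<Psi> = {x}" using adj unfolding adjacent_def by (metis card_1_singletonE)
  define i where "i = rk P x"
  have x\<Phi>: "x \<in> \<Phi>" "x \<notin> \<Psi>" using x by auto
  have ir: "i \<in> ranks" unfolding i_def by (rule rk_ranks[OF flag_faces[OF \<Phi> x\<Phi>(1)]])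
  have ag: "face \<Phi> j = face \<Psi> j" if j: "j \<in> ranks" "j \<noteq> i" for j
  proof -
    have "face \<Phi> j \<noteq> x" using face(2)[OF \<Phi> j(1)] j(2) i_def by metis
    then have "face \<Phi> j \<in> \<Psi>" using face(1)[OF \<Phi> j(1)] x by blast
    then show ?thesis by (rule face_eqI[OF \<Psi> _ face(2)[OF \<Phi> j(1)], symmetric])
  qed
  have "face \<Psi> i \<noteq> x" using face(1)[OF \<Psi> ir] x\<Phi> by metis
  moreover have "rk P (face \<Psi> i) = rk P x" using face(2)[OF \<Psi> ir] i_def by simp
  ultimately have "\<not> (i = -1 \<or> i = 3)"
    using least_unique[OF face(3)[OF \<Psi> ir] flag_faces[OF \<Phi> x\<Phi>(1)]] i_def by metis
  then have i: "i \<in> {0, 1, 2}" using ir by blast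
  have "\<Psi> \<noteq> \<Phi>" using x\<Phi> by blast
  then have "adj_flag P i \<Phi> = \<Psi>" by (rule adj_flag_eqI[OF \<Phi> i \<Psi> _ ag])
  then show thesis using that i by blast
qed

lemma adj_flag_adjacent:
  assumes \<Phi>: "flag P \<Phi>" and i: "i \<in> {0, 1, 2}"
  shows "adjacent \<Phi> (adj_flag P i \<Phi>)"
proof -
  have ir: "i \<in> ranks" using i by blast
  have diff: "X - Y = {face X i}"
    if "flag P X" "flag P Y" "face X i \<noteq> face Y i" "\<And>j. j \<in> ranks \<Longrightarrow> j \<noteq> i \<Longrightarrow> face X j = face Y j" for X Y
  proof
    show "{face X i} \<subseteq> X - Y"
    proof -
      have "face X i \<notin> Y" using face_eqI[OF that(2) _ face(2)[OF that(1) ir]] that(3) by metis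
      then show ?thesis using face(1)[OF that(1) ir] by simp
    qed
    show "X - Y \<subseteq> {face X i}"
    proof
      fix x assume x: "x \<in> X - Y"
      then have xf: "face X (rk P x) = x" "rk P x \<in> ranks"
        using face_rk[OF that(1)] rk_ranks[OF flag_faces[OF that(1)]] by simp_all
      have "rk P x = i"
      proof (rule ccontr)
        assume "rk P x \<noteq> i"
        then have "face X (rk P x) = face Y (rk P x)" by (rule that(4)[OF xf(2)])
        then have "x = face Y (rk P x)" using xf(1) by simp
        then show False using face(1)[OF that(2) xf(2)] x by auto
      qed
      then show "x \<in> {face X i}" using xf by simp
    qed
  qed
  note a = adj_flag[OF \<Phi> i] and n = face_adj_flag_neq[OF \<Phi> i]
  have "\<Phi> - adj_flag P i \<Phi> = {face \<Phi> i}" by (rule diff[OF \<Phi> a(1) n[symmetric] a(3)[symmetric]])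
  moreover have "adj_flag P i \<Phi> - \<Phi> = {face (adj_flag P i \<Phi>) i}" by (rule diff[OF a(1) \<Phi> n a(3)])
  ultimately show ?thesis unfolding adjacent_def by simp
qed

section \<open>Connectedness of the flag graph\<close>

text \<open>\<open>P3\<close> as an induction rule. The set \<open>F\<close> keeps the whole path
  among flags containing \<open>F\<close>; it is empty for global statements and a single face for
  statements about its stabilizer or its image.\<close>

lemma flag_induct:
  assumes \<Phi>: "flag P \<Phi>" and \<Psi>: "flag P \<Psi>" and F: "F \<subseteq> \<Phi>" "F \<subseteq> \<Psi>" and base: "Q \<Phi>"
    and step: "\<And>X i. flag P X \<Longrightarrow> Q X \<Longrightarrow> i \<in> {0, 1, 2} \<Longrightarrow> F \<subseteq> X \<Longrightarrow> F \<subseteq> adj_flag P i X \<Longrightarrow>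
      Q (adj_flag P i X)"
  shows "Q \<Psi>"
proof -
  obtain X :: "nat \<Rightarrow> 'a set" and k where X: "X 0 = \<Phi>" "X k = \<Psi>"
    "\<And>i. i \<le> k \<Longrightarrow> flag P (X i)" "\<And>i. i \<le> k \<Longrightarrow> \<Phi> \<inter> \<Psi> \<subseteq> X i"
    "\<And>i. i < k \<Longrightarrow> adjacent (X i) (X (Suc i))"
    using P3[OF \<Phi> \<Psi>] by blast
  have FX: "F \<subseteq> X i" if "i \<le> k" for i using X(4)[OF that] F by blast
  have "Q (X i)" if "i \<le> k" for i
    using that
  proof (induction i)
    case 0
    then show ?case using base X(1) by simp
  next
    case (Suc i)
    then have i: "i \<le> k" "i < k" by auto
    obtain l where "l \<in> {0, 1, 2}" "X (Suc i) = adj_flag P l (X i)"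
      by (rule adjacent_imp_adj_flag[OF X(3)[OF i(1)] X(3)[OF Suc.prems] X(5)[OF i(2)]])
    then show ?case using step[OF X(3)[OF i(1)] Suc.IH[OF i(1)]] FX[OF i(1)] FX[OF Suc.prems] by metis
  qed
  then show ?thesis using X(2) by blast
qed

text \<open>Automorphisms commute with adjacency, so a fixed flag forces all flags to be fixed: the
  action on flags is free.\<close>

lemma Aut_fix_flag:
  assumes g: "g \<in> carrier (Aut P)" and \<Phi>: "flag P \<Phi>" and fixed: "g ` \<Phi> = \<Phi>"
  shows "g = \<one>\<^bsub>Aut P\<^esub>"
proof -
  have all: "g ` \<Psi> = \<Psi>" if "flag P \<Psi>" for \<Psi>
  proof (rule flag_induct[OF \<Phi> that, of "{}"])
    show "g ` adj_flag P i X = adj_flag P i X" if "flag P X" "g ` X = X" "i \<in> {0, 1, 2}" for X i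
      using Aut_adj_flag[OF g that(1,3)] that(2) by simp
  qed (use fixed in auto)
  have "g x = x" if x: "x \<in> faces P" for x
  proof -
    obtain \<Psi> where \<Psi>: "flag P \<Psi>" "x \<in> \<Psi>" using flag_through2[OF x x] by blast
    then have "g x \<in> \<Psi>" using all by blast
    then have "face \<Psi> (rk P x) = g x" by (rule face_eqI[OF \<Psi>(1) _ Aut_rk[OF g x]])
    then show ?thesis using face_rk[OF \<Psi>] by simp
  qed
  moreover have "g \<in> extensional (faces P)" using g unfolding Aut_iff by blast
  ultimately show ?thesis unfolding Aut_one by (intro extensionalityI[of _ "faces P"]) auto
qed

text \<open>Send \<open>x\<close> to the face of rank \<open>rk P x\<close> in the image of any flag
  through \<open>x\<close>. The choice does not matter: flags through \<open>x\<close> are linked by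
  adjacencies in other ranks, and these leave that face of the image unchanged.\<close>

lemma flag_bijection_induced:
  assumes \<beta>: "bij_betw \<beta> {\<Phi>. flag P \<Phi>} {\<Phi>. flag P \<Phi>}"
    and adj: "\<And>\<Phi> i. flag P \<Phi> \<Longrightarrow> i \<in> {0, 1, 2} \<Longrightarrow> \<beta> (adj_flag P i \<Phi>) = adj_flag P i (\<beta> \<Phi>)"
  obtains \<gamma> where "\<gamma> \<in> carrier (Aut P)" "\<And>\<Phi>. flag P \<Phi> \<Longrightarrow> \<gamma> ` \<Phi> = \<beta> \<Phi>"
proof -
  let ?F = "{\<Phi>. flag P \<Phi>}"
  \<comment> \<open>Stated for an arbitrary flag map, so that it applies both to the given bijection
    and to its inverse; the two induced maps turn out to be mutually inverse.\<close>
  have ind: "\<exists>\<gamma>. (\<forall>\<Phi> x. flag P \<Phi> \<longrightarrow> x \<in> \<Phi> \<longrightarrow> \<gamma> x = face (\<beta> \<Phi>) (rk P x)) \<and> \<gamma> \<in> extensional (faces P)"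
    if fl: "\<And>\<Phi>. flag P \<Phi> \<Longrightarrow> flag P (\<beta> \<Phi>)"
      and adj: "\<And>\<Phi> i. flag P \<Phi> \<Longrightarrow> i \<in> {0, 1, 2} \<Longrightarrow> \<beta> (adj_flag P i \<Phi>) = adj_flag P i (\<beta> \<Phi>)" for \<beta>
  proof (intro exI conjI allI impI)
    let ?\<gamma> = "\<lambda>x\<in>faces P. face (\<beta> (SOME \<Phi>. flag P \<Phi> \<and> x \<in> \<Phi>)) (rk P x)"
    show "?\<gamma> \<in> extensional (faces P)" by simp
    fix \<Phi> x assume \<Phi>: "flag P \<Phi>" "x \<in> \<Phi>"
    let ?\<Psi> = "SOME \<Phi>. flag P \<Phi> \<and> x \<in> \<Phi>"
    have \<Psi>: "flag P ?\<Psi> \<and> x \<in> ?\<Psi>" by (rule someI[of _ \<Phi>]) (use \<Phi> in blast)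
    have xf: "x \<in> faces P" by (rule flag_faces[OF \<Phi>])
    have "face (\<beta> \<Phi>) (rk P x) = face (\<beta> ?\<Psi>) (rk P x)"
    proof (rule flag_induct[of ?\<Psi> \<Phi> "{x}"])
      fix X i assume X: "flag P X" "face (\<beta> X) (rk P x) = face (\<beta> ?\<Psi>) (rk P x)"
        "i \<in> {0, 1, 2}" "{x} \<subseteq> X" "{x} \<subseteq> adj_flag P i X"
      have "rk P x \<noteq> i"
      proof
        assume e: "rk P x = i"
        have "face X i = x" using face_eqI[OF X(1) _ e] X(4) by simp
        moreover have "face (adj_flag P i X) i = x" using face_eqI[OF adj_flag(1)[OF X(1,3)] _ e] X(5) by simp
        ultimately show False using face_adj_flag_neq[OF X(1,3)] by simp
      qed
      then show "face (\<beta> (adj_flag P i X)) (rk P x) = face (\<beta> ?\<Psi>) (rk P x)"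
        using adj[OF X(1,3)] adj_flag(3)[OF fl[OF X(1)] X(3) rk_ranks[OF xf]] X(2) by simp
    qed (use \<Phi> \<Psi> in auto)
    then show "?\<gamma> x = face (\<beta> \<Phi>) (rk P x)" using xf by simp
  qed
  have fl: "flag P (\<beta> \<Phi>)" if "flag P \<Phi>" for \<Phi> using \<beta> that by (auto dest: bij_betwE)
  define \<beta>' where "\<beta>' = inv_into ?F \<beta>"
  have \<beta>': "bij_betw \<beta>' ?F ?F" unfolding \<beta>'_def by (rule bij_betw_inv_into[OF \<beta>])
  have fl': "flag P (\<beta>' \<Phi>)" if "flag P \<Phi>" for \<Phi> using \<beta>' that by (auto dest: bij_betwE)
  have b1: "\<beta>' (\<beta> \<Phi>) = \<Phi>" if "flag P \<Phi>" for \<Phi>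
    unfolding \<beta>'_def using bij_betw_inv_into_left[OF \<beta>] that by simp
  have b2: "\<beta> (\<beta>' \<Phi>) = \<Phi>" if "flag P \<Phi>" for \<Phi>
    unfolding \<beta>'_def using bij_betw_inv_into_right[OF \<beta>] that by simp
  have adj': "\<beta>' (adj_flag P i \<Phi>) = adj_flag P i (\<beta>' \<Phi>)" if "flag P \<Phi>" "i \<in> {0, 1, 2}" for \<Phi> i
    using adj[OF fl'[OF that(1)] that(2)] b1 b2[OF that(1)] adj_flag(1)[OF fl'[OF that(1)] that(2)] by metis
  obtain \<gamma> where \<gamma>: "\<And>\<Phi> x. flag P \<Phi> \<Longrightarrow> x \<in> \<Phi> \<Longrightarrow> \<gamma> x = face (\<beta> \<Phi>) (rk P x)"
    "\<gamma> \<in> extensional (faces P)" using ind[of \<beta>, OF fl adj] by blast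
  obtain \<gamma>' where \<gamma>': "\<And>\<Phi> x. flag P \<Phi> \<Longrightarrow> x \<in> \<Phi> \<Longrightarrow> \<gamma>' x = face (\<beta>' \<Phi>) (rk P x)"
    using ind[of \<beta>', OF fl' adj'] by blast
  \<comment> \<open>Order is preserved because comparable faces lie in a common flag, on which both
    images are read off from the same flag.\<close>
  have mono: "f x \<in> faces P \<and> ((x, y) \<in> leq P \<longrightarrow> (f x, f y) \<in> leq P) \<and> f' (f x) = x"
    if f: "\<And>\<Phi> x. flag P \<Phi> \<Longrightarrow> x \<in> \<Phi> \<Longrightarrow> f x = face (b \<Phi>) (rk P x)"
      and f': "\<And>\<Phi> x. flag P \<Phi> \<Longrightarrow> x \<in> \<Phi> \<Longrightarrow> f' x = face (b' \<Phi>) (rk P x)"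
      and b: "\<And>\<Phi>. flag P \<Phi> \<Longrightarrow> flag P (b \<Phi>)" and bb: "\<And>\<Phi>. flag P \<Phi> \<Longrightarrow> b' (b \<Phi>) = \<Phi>"
      and x: "x \<in> faces P" and y: "y \<in> faces P" for f f' b b' x y
  proof (intro conjI impI)
    obtain \<Phi> where \<Phi>: "flag P \<Phi>" "x \<in> \<Phi>" using flag_through2[OF x x] by blast
    note fb = face[OF b[OF \<Phi>(1)] rk_ranks[OF x]]
    show "f x \<in> faces P" using f[OF \<Phi>] fb by simp
    have "f' (f x) = face (b' (b \<Phi>)) (rk P (f x))"
      by (rule f'[OF b[OF \<Phi>(1)]]) (use f[OF \<Phi>] fb in simp)
    then show "f' (f x) = x" using bb[OF \<Phi>(1)] f[OF \<Phi>] fb face_rk[OF \<Phi>] by simp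
    assume xy: "(x, y) \<in> leq P"
    then have cmp: "x = y \<or> lt P x y" using leq_iff[OF x] by blast
    then obtain \<Psi> where \<Psi>: "flag P \<Psi>" "x \<in> \<Psi>" "y \<in> \<Psi>" using flag_through2[OF x y] by blast
    show "(f x, f y) \<in> leq P"
      using cmp
    proof
      assume "x = y"
      then show ?thesis using leq_refl \<open>f x \<in> faces P\<close> by simp
    next
      assume "lt P x y"
      then have "lt P (f x) (f y)"
        unfolding f[OF \<Psi>(1,2)] f[OF \<Psi>(1,3)]
        by (intro face_lt[OF b[OF \<Psi>(1)]] rk_ranks x y lt_rk)
      then show ?thesis by (simp add: lt_def)
    qed
  qed
  have m1: "\<gamma> x \<in> faces P" "(x, y) \<in> leq P \<Longrightarrow> (\<gamma> x, \<gamma> y) \<in> leq P" "\<gamma>' (\<gamma> x) = x"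
    if "x \<in> faces P" "y \<in> faces P" for x y
    using mono[of \<gamma> \<beta> \<gamma>' \<beta>', OF \<gamma>(1) \<gamma>' fl b1 that] by blast+
  have m2: "\<gamma>' x \<in> faces P" "(x, y) \<in> leq P \<Longrightarrow> (\<gamma>' x, \<gamma>' y) \<in> leq P" "\<gamma> (\<gamma>' x) = x"
    if "x \<in> faces P" "y \<in> faces P" for x y
    using mono[of \<gamma>' \<beta>' \<gamma> \<beta>, OF \<gamma>' \<gamma>(1) fl' b2 that] by blast+
  have "\<gamma> \<in> carrier (Aut P)"
    unfolding Aut_iff
  proof (intro conjI ballI)
    show "\<gamma> \<in> extensional (faces P)" by (rule \<gamma>(2))
    show "bij_betw \<gamma> (faces P) (faces P)"
      by (rule bij_betw_byWitness[of _ \<gamma>']) (use m1 m2 in auto)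
    show "(\<gamma> x, \<gamma> y) \<in> leq P \<longleftrightarrow> (x, y) \<in> leq P" if "x \<in> faces P" "y \<in> faces P" for x y
      using m1[OF that] m1[OF that(2,1)] m2(2)[of "\<gamma> x" "\<gamma> y"] by metis
  qed
  moreover have "\<gamma> ` \<Phi> = \<beta> \<Phi>" if \<Phi>: "flag P \<Phi>" for \<Phi>
  proof -
    have "\<gamma> ` \<Phi> = (\<lambda>x. face (\<beta> \<Phi>) (rk P x)) ` \<Phi>" by (rule image_cong[OF refl \<gamma>(1)[OF \<Phi>]])
    also have "\<dots> = face (\<beta> \<Phi>) ` ranks" using flag_rk_image[OF \<Phi>] by (metis image_image)
    also have "\<dots> = \<beta> \<Phi>" by (rule flag_eq_image[OF fl[OF \<Phi>], symmetric])
    finally show ?thesis .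
  qed
  ultimately show thesis using that by blast
qed

end

section \<open>Chiral polyhedra\<close>

text \<open>Here \<open>s 0\<close> is \<open>\<sigma>1\<close> and \<open>s 2\<close> is the
  inverse of \<open>\<sigma>2\<close>. Indexed by the adjacent rank, both obey the same equation, so
  each dual pair of statements on 2-faces and vertices becomes one statement about
  \<open>2 - i\<close>.\<close>

locale chiral_polyhedron = polyhedron P
  for P :: "('a, 'b) ranked_poset_scheme" +
  fixes \<Phi> :: "'a set" and s :: "int \<Rightarrow> 'a \<Rightarrow> 'a"
  assumes chiral: "chiral P" and \<Phi>: "flag P \<Phi>"
    and s_Aut: "i \<in> {0, 2} \<Longrightarrow> s i \<in> carrier (Aut P)"
    and s_adj: "i \<in> {0, 2} \<Longrightarrow> s i ` adj_flag P i \<Phi> = adj_flag P 1 \<Phi>"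
begin

sublocale Aut: group "Aut P"
  by (rule group_Aut)

abbreviation mult :: "('a \<Rightarrow> 'a) \<Rightarrow> ('a \<Rightarrow> 'a) \<Rightarrow> 'a \<Rightarrow> 'a" (infixl "\<cdot>" 70) where
  "f \<cdot> g \<equiv> f \<otimes>\<^bsub>Aut P\<^esub> g"

abbreviation \<Phi>1 :: "'a set" where
  "\<Phi>1 \<equiv> adj_flag P 1 \<Phi>"

lemma \<Phi>1: "flag P \<Phi>1"
  using adj_flag(1)[OF \<Phi>, of 1] by simp

lemma image_mult: "flag P X \<Longrightarrow> (f \<cdot> g) ` X = g ` (f ` X)"
  by (rule Aut_mult_image[OF flag_subset])

lemma image_one: "flag P X \<Longrightarrow> \<one>\<^bsub>Aut P\<^esub> ` X = X"
  unfolding Aut_one using flag_subset by fastforce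

lemma image_inv:
  assumes "g \<in> carrier (Aut P)" "flag P X" "flag P Y" "g ` X = Y"
  shows "(inv\<^bsub>Aut P\<^esub> g) ` Y = X"
  using image_mult[OF assms(2), of g "inv\<^bsub>Aut P\<^esub> g"] image_one[OF assms(2)] assms by simp

lemma image_eq_imp_eq:
  assumes g: "g \<in> carrier (Aut P)" and h: "h \<in> carrier (Aut P)" and X: "flag P X" and eq: "g ` X = h ` X"
  shows "g = h"
proof -
  have "(g \<cdot> inv\<^bsub>Aut P\<^esub> h) ` X = X"
    using image_mult[OF X] image_inv[OF h X Aut_flag[OF h X] refl] eq by simp
  then have "g \<cdot> inv\<^bsub>Aut P\<^esub> h = \<one>\<^bsub>Aut P\<^esub>" using Aut_fix_flag[OF _ X] g h by simp
  then show ?thesis using g h Aut.inv_equality Aut.inv_inv by fastforce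
qed

lemma not_adj:
  assumes g: "g \<in> carrier (Aut P)" and X: "flag P X" and i: "i \<in> {0, 1, 2}"
  shows "g ` X \<noteq> adj_flag P i X"
proof
  assume eq: "g ` X = adj_flag P i X"
  let ?o = "orbit (Aut P) (\<lambda>f. (`) f)"
  have "?o (g ` X) = ?o X"
  proof
    show "?o (g ` X) \<subseteq> ?o X"
    proof
      fix Y assume "Y \<in> ?o (g ` X)"
      then obtain h where h: "h \<in> carrier (Aut P)" "Y = h ` (g ` X)" unfolding orbit_def by blast
      then have "Y = (g \<cdot> h) ` X" using image_mult[OF X] by simp
      then show "Y \<in> ?o X" unfolding orbit_def using h g by blast
    qed
    show "?o X \<subseteq> ?o (g ` X)"
    proof
      fix Y assume "Y \<in> ?o X"
      then obtain h where h: "h \<in> carrier (Aut P)" "Y = h ` X" unfolding orbit_def by blast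
      have "X = (inv\<^bsub>Aut P\<^esub> g) ` (g ` X)" using image_inv[OF g X Aut_flag[OF g X] refl] by simp
      then have "Y = (inv\<^bsub>Aut P\<^esub> g \<cdot> h) ` (g ` X)" using h image_mult[OF Aut_flag[OF g X]] by simp
      then show "Y \<in> ?o (g ` X)" unfolding orbit_def using h g by blast
    qed
  qed
  moreover have "?o X \<noteq> ?o (adj_flag P i X)"
    using chiral adj_flag_adjacent[OF X i] X adj_flag(1)[OF X i] unfolding chiral_def by blast
  ultimately show False using eq by simp
qed

lemma adj_i:
  assumes i: "i \<in> {0, 2}"
  shows "adj_flag P i \<Phi> = (inv\<^bsub>Aut P\<^esub> s i) ` \<Phi>1" "adj_flag P i \<Phi>1 = s i ` \<Phi>"
proof -
  have i': "i \<in> {0, 1, 2}" using i by blast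
  note a = adj_flag(1)[OF \<Phi> i']
  show "adj_flag P i \<Phi> = (inv\<^bsub>Aut P\<^esub> s i) ` \<Phi>1"
    by (rule image_inv[OF s_Aut[OF i] a \<Phi>1 s_adj[OF i], symmetric])
  show "adj_flag P i \<Phi>1 = s i ` \<Phi>"
    using Aut_adj_flag[OF s_Aut[OF i] a i'] adj_flag_involution[OF \<Phi> i'] s_adj[OF i] by simp
qed

text \<open>The flag graph in terms of the group. In ranks 0 and 2 the formulas for the two orbits
  differ exactly by exchanging \<open>s i\<close> with its inverse, which is why inverting the
  generators would exchange the orbits.\<close>

lemma adj_image:
  assumes g: "g \<in> carrier (Aut P)" and i: "i \<in> {0, 2}"
  shows "adj_flag P i (g ` \<Phi>) = (inv\<^bsub>Aut P\<^esub> s i \<cdot> g) ` \<Phi>1" "adj_flag P i (g ` \<Phi>1) = (s i \<cdot> g) ` \<Phi>"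
    "adj_flag P 1 (g ` \<Phi>) = g ` \<Phi>1" "adj_flag P 1 (g ` \<Phi>1) = g ` \<Phi>"
proof -
  have i': "i \<in> {0, 1, 2}" and j: "(1::int) \<in> {0, 1, 2}" using i by auto
  show "adj_flag P i (g ` \<Phi>) = (inv\<^bsub>Aut P\<^esub> s i \<cdot> g) ` \<Phi>1"
    using Aut_adj_flag[OF g \<Phi> i'] adj_i(1)[OF i] image_mult[OF \<Phi>1] by simp
  show "adj_flag P i (g ` \<Phi>1) = (s i \<cdot> g) ` \<Phi>"
    using Aut_adj_flag[OF g \<Phi>1 i'] adj_i(2)[OF i] image_mult[OF \<Phi>] by simp
  show "adj_flag P 1 (g ` \<Phi>) = g ` \<Phi>1" using Aut_adj_flag[OF g \<Phi> j] by simp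
  show "adj_flag P 1 (g ` \<Phi>1) = g ` \<Phi>"
    using Aut_adj_flag[OF g \<Phi>1 j] adj_flag_involution[OF \<Phi> j] by simp
qed

text \<open>Flag induction through the rank \<open>k\<close> face of \<open>\<Phi>\<close>: an
  adjacency in rank 1 switches between the two kinds of images, one in rank \<open>i\<close> also
  multiplies the group element by \<open>s i\<close> or its inverse, and rank \<open>k\<close> never
  occurs. A rank \<open>k\<close> without faces removes the restriction.\<close>

lemma cover:
  assumes K: "subgroup K (Aut P)" and sK: "\<And>i. i \<in> {0, 2} \<Longrightarrow> i \<noteq> k \<Longrightarrow> s i \<in> K" and k: "k \<noteq> 1"
    and \<Psi>: "flag P \<Psi>" and F: "{x \<in> \<Phi>. rk P x = k} \<subseteq> \<Psi>"
  shows "\<exists>g\<in>K. \<Psi> = g ` \<Phi> \<or> \<Psi> = g ` \<Phi>1"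
proof (rule flag_induct[OF \<Phi> \<Psi> _ F])
  show "\<exists>g\<in>K. \<Phi> = g ` \<Phi> \<or> \<Phi> = g ` \<Phi>1"
    using subgroup.one_closed[OF K] image_one[OF \<Phi>] by metis
  fix X i
  assume X: "flag P X" "\<exists>g\<in>K. X = g ` \<Phi> \<or> X = g ` \<Phi>1" and i: "i \<in> {0, 1, 2}"
    and FX: "{x \<in> \<Phi>. rk P x = k} \<subseteq> X" "{x \<in> \<Phi>. rk P x = k} \<subseteq> adj_flag P i X"
  obtain g where g: "g \<in> K" "X = g ` \<Phi> \<or> X = g ` \<Phi>1" using X(2) by blast
  have gc: "g \<in> carrier (Aut P)" by (rule subgroup.mem_carrier[OF K g(1)])
  have ik: "i \<noteq> k"
  proof
    assume ik: "i = k"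
    have kr: "k \<in> ranks" using i ik by blast
    have "face \<Phi> k \<in> {x \<in> \<Phi>. rk P x = k}" using face(1,2)[OF \<Phi> kr] by simp
    then have m: "face \<Phi> k \<in> X" "face \<Phi> k \<in> adj_flag P i X" using FX by blast+
    have "face X i = face \<Phi> k" by (rule face_eqI[OF X(1) m(1)]) (simp add: face(2)[OF \<Phi> kr] ik)
    moreover have "face (adj_flag P i X) i = face \<Phi> k"
      by (rule face_eqI[OF adj_flag(1)[OF X(1) i] m(2)]) (simp add: face(2)[OF \<Phi> kr] ik)
    ultimately show False using face_adj_flag_neq[OF X(1) i] by simp
  qed
  show "\<exists>g\<in>K. adj_flag P i X = g ` \<Phi> \<or> adj_flag P i X = g ` \<Phi>1"
  proof (cases "i = 1")
    case True
    then show ?thesis using g adj_image(3,4)[OF gc, of 0] by auto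
  next
    case False
    then have i': "i \<in> {0, 2}" using i by blast
    then have si: "s i \<in> K" using sK ik by blast
    have "s i \<cdot> g \<in> K" "inv\<^bsub>Aut P\<^esub> s i \<cdot> g \<in> K"
      using subgroup.m_closed[OF K] subgroup.m_inv_closed[OF K] si g(1) by blast+
    then show ?thesis using g(2) adj_image(1,2)[OF gc i'] by metis
  qed
qed blast

lemma orbits_disjoint:
  assumes "g \<in> carrier (Aut P)" "h \<in> carrier (Aut P)"
  shows "g ` \<Phi> \<noteq> h ` \<Phi>1"
proof
  assume "g ` \<Phi> = h ` \<Phi>1"
  then have "(g \<cdot> inv\<^bsub>Aut P\<^esub> h) ` \<Phi> = \<Phi>1"
    using image_mult[OF \<Phi>] image_inv[OF assms(2) \<Phi>1 Aut_flag[OF assms(2) \<Phi>1] refl] by simp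
  then show False using not_adj[of "g \<cdot> inv\<^bsub>Aut P\<^esub> h" \<Phi> 1] \<Phi> assms by simp
qed

lemma generate_s: "generate (Aut P) {s 0, s 2} = carrier (Aut P)"
proof
  have sc: "{s 0, s 2} \<subseteq> carrier (Aut P)" using s_Aut[of 0] s_Aut[of 2] by blast
  show "generate (Aut P) {s 0, s 2} \<subseteq> carrier (Aut P)" by (rule Aut.generate_incl[OF sc])
  show "carrier (Aut P) \<subseteq> generate (Aut P) {s 0, s 2}"
  proof
    fix g assume g: "g \<in> carrier (Aut P)"
    have empty: "{x \<in> \<Phi>. rk P x = 7} = {}"
      using rk_ranks flag_faces[OF \<Phi>] by fastforce
    have "\<exists>h\<in>generate (Aut P) {s 0, s 2}. g ` \<Phi> = h ` \<Phi> \<or> g ` \<Phi> = h ` \<Phi>1"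
    \<comment> \<open>No face has rank 7, so all flags are covered and both generators are
      allowed.\<close>
    proof (rule cover[OF Aut.generate_is_subgroup[OF sc], of 7])
      show "s i \<in> generate (Aut P) {s 0, s 2}" if "i \<in> {0, 2}" for i
        using that by (auto intro: generate.incl)
      show "{x \<in> \<Phi>. rk P x = 7} \<subseteq> g ` \<Phi>" unfolding empty by blast
    qed (use Aut_flag[OF g \<Phi>] in simp_all)
    then obtain h where h: "h \<in> generate (Aut P) {s 0, s 2}" "g ` \<Phi> = h ` \<Phi> \<or> g ` \<Phi> = h ` \<Phi>1" by blast
    have hc: "h \<in> carrier (Aut P)" by (rule Aut.generate_in_carrier[OF sc h(1)])
    have "g = h" using h(2) image_eq_imp_eq[OF g hc \<Phi>] orbits_disjoint[OF g hc] by blast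
    then show "g \<in> generate (Aut P) {s 0, s 2}" using h by simp
  qed
qed

lemma flag_cases:
  assumes "flag P X"
  obtains g where "g \<in> carrier (Aut P)" "X = g ` \<Phi>" | g where "g \<in> carrier (Aut P)" "X = g ` \<Phi>1"
proof -
  have "{x \<in> \<Phi>. rk P x = 7} = {}" using rk_ranks flag_faces[OF \<Phi>] by fastforce
  then have "\<exists>g\<in>carrier (Aut P). X = g ` \<Phi> \<or> X = g ` \<Phi>1"
    by (intro cover[OF Aut.subgroup_self _ _ assms, of 7]) (use s_Aut in auto)
  then show thesis using that by blast
qed

text \<open>The product takes \<open>\<Phi>\<close> to the flag obtained by changing ranks 0 and 2;
  these two changes commute and are involutions, so applying the product twice returns to
  \<open>\<Phi>\<close>.\<close>

lemma s_involution:
  shows "(s 0 \<cdot> inv\<^bsub>Aut P\<^esub> s 2) \<cdot> (s 0 \<cdot> inv\<^bsub>Aut P\<^esub> s 2) = \<one>\<^bsub>Aut P\<^esub>" and "s 0 \<noteq> s 2"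
proof -
  let ?t = "s 0 \<cdot> inv\<^bsub>Aut P\<^esub> s 2" and ?a = "adj_flag P"
  have c: "s 0 \<in> carrier (Aut P)" "s 2 \<in> carrier (Aut P)" using s_Aut by auto
  then have tc: "?t \<in> carrier (Aut P)" by simp
  have a2: "flag P (?a 2 \<Phi>)" and a02: "flag P (?a 0 (?a 2 \<Phi>))"
    using adj_flag(1)[OF \<Phi>, of 2] adj_flag(1)[of "?a 2 \<Phi>" 0] by auto
  have i2: "(inv\<^bsub>Aut P\<^esub> s 2) ` \<Phi>1 = ?a 2 \<Phi>" using adj_i(1)[of 2] by simp
  have t\<Phi>: "?t ` \<Phi> = ?a 0 (?a 2 \<Phi>)"
  proof -
    have "?t ` \<Phi> = (inv\<^bsub>Aut P\<^esub> s 2) ` ?a 0 \<Phi>1" using image_mult[OF \<Phi>] adj_i(2)[of 0] by simp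
    also have "\<dots> = ?a 0 ((inv\<^bsub>Aut P\<^esub> s 2) ` \<Phi>1)" by (rule Aut_adj_flag[OF _ \<Phi>1]) (use c in auto)
    finally show ?thesis using i2 by simp
  qed
  have "(?t \<cdot> ?t) ` \<Phi> = ?t ` ?a 0 (?a 2 \<Phi>)" using image_mult[OF \<Phi>] t\<Phi> by simp
  also have "\<dots> = ?a 0 (?a 2 (?t ` \<Phi>))"
    using Aut_adj_flag[OF tc a2, of 0] Aut_adj_flag[OF tc \<Phi>, of 2] by simp
  also have "\<dots> = ?a 0 (?a 2 (?a 2 (?a 0 \<Phi>)))" using t\<Phi> adj_flag_0_2_commute[OF \<Phi>] by simp
  also have "\<dots> = \<Phi>"
    using adj_flag_involution[of "?a 0 \<Phi>" 2] adj_flag_involution[OF \<Phi>, of 0] adj_flag(1)[OF \<Phi>, of 0] by simp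
  finally show "?t \<cdot> ?t = \<one>\<^bsub>Aut P\<^esub>" using Aut_fix_flag[OF _ \<Phi>] tc by simp
  show "s 0 \<noteq> s 2"
  proof
    assume "s 0 = s 2"
    then have "\<Phi> = ?a 0 (?a 2 \<Phi>)" using t\<Phi> c image_one[OF \<Phi>] by simp
    then have "face \<Phi> 0 = face (?a 0 (?a 2 \<Phi>)) 0" by simp
    moreover have "face (?a 2 \<Phi>) 0 = face \<Phi> 0" using adj_flag(3)[OF \<Phi>, of 2 0] by simp
    ultimately show False using face_adj_flag_neq[OF a2, of 0] by simp
  qed
qed

section \<open>Stabilizers of base faces and the orders of the generators\<close>

lemma Aut_face_stabilizer:
  assumes "x \<in> faces P"
  shows "subgroup {g \<in> carrier (Aut P). g x = x} (Aut P)"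
proof (rule Aut.subgroupI)
  show "{g \<in> carrier (Aut P). g x = x} \<noteq> {}"
    using assms Aut.one_closed unfolding Aut_one by auto
  fix g assume g: "g \<in> {g \<in> carrier (Aut P). g x = x}"
  then have "\<one>\<^bsub>Aut P\<^esub> x = (inv\<^bsub>Aut P\<^esub> g) x"
    using Aut_mult_apply[OF assms, of g "inv\<^bsub>Aut P\<^esub> g"] by simp
  then have "(inv\<^bsub>Aut P\<^esub> g) x = x" using g assms by (simp add: Aut_one)
  then show "inv\<^bsub>Aut P\<^esub> g \<in> {g \<in> carrier (Aut P). g x = x}" using g by simp
  fix h assume "h \<in> {g \<in> carrier (Aut P). g x = x}"
  then show "g \<cdot> h \<in> {g \<in> carrier (Aut P). g x = x}" using g Aut_mult_apply[OF assms] by simp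
qed auto

lemma s_fixes_face:
  assumes i: "i \<in> {0, 2}"
  shows "s i (face \<Phi> (2 - i)) = face \<Phi> (2 - i)"
proof -
  have i': "i \<in> {0, 1, 2}" and kr: "2 - i \<in> ranks" and k: "2 - i \<noteq> i" "2 - i \<noteq> 1" using i by auto
  have "face \<Phi>1 (2 - i) = face \<Phi> (2 - i)" using adj_flag(3)[OF \<Phi> _ kr k(2)] by simp
  moreover have "face (s i ` adj_flag P i \<Phi>) (2 - i) = s i (face (adj_flag P i \<Phi>) (2 - i))"
    by (rule face_image[OF s_Aut[OF i] adj_flag(1)[OF \<Phi> i'] kr])
  moreover have "face (adj_flag P i \<Phi>) (2 - i) = face \<Phi> (2 - i)" by (rule adj_flag(3)[OF \<Phi> i' kr k(1)])
  ultimately show ?thesis using s_adj[OF i] by simp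
qed

lemma generate_fixes_face:
  assumes i: "i \<in> {0, 2}" and g: "g \<in> generate (Aut P) {s i}"
  shows "g \<in> carrier (Aut P)" "g (face \<Phi> (2 - i)) = face \<Phi> (2 - i)"
proof -
  have kr: "2 - i \<in> ranks" using i by auto
  have "generate (Aut P) {s i} \<subseteq> {g \<in> carrier (Aut P). g (face \<Phi> (2 - i)) = face \<Phi> (2 - i)}"
    by (rule Aut.generate_subgroup_incl[OF _ Aut_face_stabilizer[OF face(3)[OF \<Phi> kr]]])
      (use s_Aut[OF i] s_fixes_face[OF i] in auto)
  then show "g \<in> carrier (Aut P)" "g (face \<Phi> (2 - i)) = face \<Phi> (2 - i)" using g by auto
qed

text \<open>Only the face of rank \<open>i\<close> could move, so \<open>\<Phi>\<close> would go to
  itself or to its \<open>i\<close>-adjacent flag; chirality excludes the latter.\<close>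

lemma fixes_two_faces:
  assumes g: "g \<in> carrier (Aut P)" and i: "i \<in> {0, 1, 2}"
    and fixed: "\<And>j. j \<in> {0, 1, 2} \<Longrightarrow> j \<noteq> i \<Longrightarrow> g (face \<Phi> j) = face \<Phi> j"
  shows "g = \<one>\<^bsub>Aut P\<^esub>"
proof (rule Aut_fix_flag[OF g \<Phi>])
  have gf: "flag P (g ` \<Phi>)" by (rule Aut_flag[OF g \<Phi>])
  have eq: "face \<Phi> j = face (g ` \<Phi>) j" if j: "j \<in> ranks" "j \<noteq> i" for j
  proof (cases "j \<in> {0, 1, 2}")
    case True
    then show ?thesis using fixed[OF True j(2)] face_image[OF g \<Phi> j(1)] by simp
  next
    case False
    then have "j = -1 \<or> j = 3" using j(1) by auto
    then show ?thesis
      using face(2)[OF \<Phi> j(1)] face(2)[OF gf j(1)]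
      by (intro least_unique[OF face(3)[OF \<Phi> j(1)] face(3)[OF gf j(1)]]) simp_all
  qed
  show "g ` \<Phi> = \<Phi>"
  proof (rule ccontr)
    assume "g ` \<Phi> \<noteq> \<Phi>"
    then have "adj_flag P i \<Phi> = g ` \<Phi>" by (rule adj_flag_eqI[OF \<Phi> i gf _ eq])
    then show False using not_adj[OF g \<Phi> i] by simp
  qed
qed

lemma s_intersection: "generate (Aut P) {s 0} \<inter> generate (Aut P) {s 2} = {\<one>\<^bsub>Aut P\<^esub>}"
proof
  show "generate (Aut P) {s 0} \<inter> generate (Aut P) {s 2} \<subseteq> {\<one>\<^bsub>Aut P\<^esub>}"
  proof
    fix g assume g: "g \<in> generate (Aut P) {s 0} \<inter> generate (Aut P) {s 2}"
    have "g (face \<Phi> 2) = face \<Phi> 2" "g (face \<Phi> 0) = face \<Phi> 0" "g \<in> carrier (Aut P)"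
      using generate_fixes_face[of 0 g] generate_fixes_face[of 2 g] g by auto
    then have "g = \<one>\<^bsub>Aut P\<^esub>" by (intro fixes_two_faces[of g 1]) auto
    then show "g \<in> {\<one>\<^bsub>Aut P\<^esub>}" by simp
  qed
qed (auto intro: generate.one)

text \<open>The cyclic group generated by \<open>s i\<close> acts simply transitively on these
  edges. Using \<open>comparable\<close> treats the edges of a 2-face (\<open>i = 0\<close>) and the
  edges at a vertex (\<open>i = 2\<close>) together.\<close>

lemma card_edges:
  assumes i: "i \<in> {0, 2}"
  shows "card {E \<in> faces P. rk P E = 1 \<and> comparable E (face \<Phi> (2 - i))} = Aut.ord (s i)"
proof -
  let ?k = "2 - i" and ?K = "generate (Aut P) {s i}" and ?e = "face \<Phi> 1"
  have i': "i \<in> {0, 1, 2}" and kr: "?k \<in> ranks" and k: "?k \<noteq> i" "?k \<noteq> 1" "?k \<in> {0, 2}"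
    and r1: "(1::int) \<in> ranks" "(1::int) \<noteq> i" using i by auto
  have sK: "subgroup ?K (Aut P)" using s_Aut[OF i] by (intro Aut.generate_is_subgroup) simp
  note Kc = generate_fixes_face(1)[OF i] and Kf = generate_fixes_face(2)[OF i]
  note ef = face[OF \<Phi> r1(1)] and ff = face[OF \<Phi> kr]
  \<comment> \<open>The edge of \<open>\<Phi>1\<close> is already an image of \<open>?e\<close>, so
    flags of the second kind yield edges in the same orbit of \<open>?K\<close>.\<close>
  have e1: "face \<Phi>1 1 = s i ?e"
  proof -
    have "face (s i ` adj_flag P i \<Phi>) 1 = s i (face (adj_flag P i \<Phi>) 1)"
      by (rule face_image[OF s_Aut[OF i] adj_flag(1)[OF \<Phi> i'] r1(1)])
    then show ?thesis using s_adj[OF i] adj_flag(3)[OF \<Phi> i' r1] by simp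
  qed
  have "{E \<in> faces P. rk P E = 1 \<and> comparable E (face \<Phi> ?k)} = (\<lambda>g. g ?e) ` ?K"
  proof
    show "(\<lambda>g. g ?e) ` ?K \<subseteq> {E \<in> faces P. rk P E = 1 \<and> comparable E (face \<Phi> ?k)}"
    proof
      fix E assume "E \<in> (\<lambda>g. g ?e) ` ?K"
      then obtain g where g: "g \<in> ?K" "E = g ?e" by blast
      have gf: "flag P (g ` \<Phi>)" by (rule Aut_flag[OF Kc[OF g(1)] \<Phi>])
      have "face \<Phi> ?k \<in> g ` \<Phi>" using Kf[OF g(1)] ff(1) by (metis imageI)
      then have "comparable E (face \<Phi> ?k)" using flag_comparable[OF gf] g(2) ef(1) by blast
      then show "E \<in> {E \<in> faces P. rk P E = 1 \<and> comparable E (face \<Phi> ?k)}"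
        using Aut_faces[OF Kc[OF g(1)] ef(3)] Aut_rk[OF Kc[OF g(1)] ef(3)] ef(2) g(2) by simp
    qed
    show "{E \<in> faces P. rk P E = 1 \<and> comparable E (face \<Phi> ?k)} \<subseteq> (\<lambda>g. g ?e) ` ?K"
    proof
      fix E assume "E \<in> {E \<in> faces P. rk P E = 1 \<and> comparable E (face \<Phi> ?k)}"
      then have E: "E \<in> faces P" "rk P E = 1" "comparable E (face \<Phi> ?k)" by blast+
      obtain \<Psi> where \<Psi>: "flag P \<Psi>" "E \<in> \<Psi>" "face \<Phi> ?k \<in> \<Psi>"
        using flag_through2[OF E(1) ff(3) E(3)] by blast
      have "\<exists>g\<in>?K. \<Psi> = g ` \<Phi> \<or> \<Psi> = g ` \<Phi>1"
      proof (rule cover[OF sK _ k(2) \<Psi>(1)])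
        show "s j \<in> ?K" if "j \<in> {0, 2}" "j \<noteq> ?k" for j
        proof -
          have "j = i" using that i by auto
          then show ?thesis by (simp add: generate.incl)
        qed
        show "{x \<in> \<Phi>. rk P x = ?k} \<subseteq> \<Psi>" using face_eqI[OF \<Phi>] \<Psi>(3) by blast
      qed
      then obtain g where g: "g \<in> ?K" "\<Psi> = g ` \<Phi> \<or> \<Psi> = g ` \<Phi>1" by blast
      have E\<Psi>: "E = face \<Psi> 1" using face_eqI[OF \<Psi>(1,2) E(2)] by simp
      show "E \<in> (\<lambda>g. g ?e) ` ?K"
        using g(2)
      proof
        assume "\<Psi> = g ` \<Phi>"
        then have "E = g ?e" using E\<Psi> face_image[OF Kc[OF g(1)] \<Phi> r1(1)] by simp
        then show ?thesis using g(1) by blast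
      next
        assume "\<Psi> = g ` \<Phi>1"
        then have "E = g (s i ?e)" using E\<Psi> face_image[OF Kc[OF g(1)] \<Phi>1 r1(1)] e1 by simp
        then have "E = (s i \<cdot> g) ?e" using Aut_mult_apply[OF ef(3)] by simp
        moreover have "s i \<cdot> g \<in> ?K" by (rule subgroup.m_closed[OF sK _ g(1)]) (simp add: generate.incl)
        ultimately show ?thesis by blast
      qed
    qed
  qed
  moreover have "inj_on (\<lambda>g. g ?e) ?K"
  proof (rule inj_onI)
    fix g h assume g: "g \<in> ?K" and h: "h \<in> ?K" and eq: "g ?e = h ?e"
    let ?u = "g \<cdot> inv\<^bsub>Aut P\<^esub> h"
    have u: "?u \<in> ?K" using subgroup.m_closed[OF sK] subgroup.m_inv_closed[OF sK] g h by blast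
    have "?u ?e = (h \<cdot> inv\<^bsub>Aut P\<^esub> h) ?e" using Aut_mult_apply[OF ef(3)] eq by simp
    then have "?u ?e = ?e" using Kc[OF h] ef(3) by (simp add: Aut_one)
    then have "?u = \<one>\<^bsub>Aut P\<^esub>"
    proof (intro fixes_two_faces[OF Kc[OF u] i'])
      fix j :: int assume "j \<in> {0, 1, 2}" "j \<noteq> i"
      then have "j = 1 \<or> j = ?k" using i by auto
      then show "?u (face \<Phi> j) = face \<Phi> j" using \<open>?u ?e = ?e\<close> Kf[OF u] by blast
    qed
    then show "g = h" using Kc[OF g] Kc[OF h] Aut.inv_equality Aut.inv_inv by fastforce
  qed
  ultimately have "card {E \<in> faces P. rk P E = 1 \<and> comparable E (face \<Phi> ?k)} = card ?K"
    by (simp add: card_image)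
  then show ?thesis using Aut.generate_pow_card[OF s_Aut[OF i]] by simp
qed

text \<open>
  An automorphism inverting \<open>s 0\<close> and \<open>s 2\<close> would give a permutation of the flags that commutes with
  all adjacencies and exchanges the base flag with \<open>\<Phi>1\<close>.
\<close>
lemma no_inverting_automorphism:
  "\<not> (\<exists>\<alpha>\<in>iso (Aut P) (Aut P). \<alpha> (s 0) = inv\<^bsub>Aut P\<^esub> s 0 \<and> \<alpha> (s 2) = inv\<^bsub>Aut P\<^esub> s 2)"
proof
  assume "\<exists>\<alpha>\<in>iso (Aut P) (Aut P). \<alpha> (s 0) = inv\<^bsub>Aut P\<^esub> s 0 \<and> \<alpha> (s 2) = inv\<^bsub>Aut P\<^esub> s 2"
  then obtain \<alpha> where \<alpha>: "\<alpha> \<in> iso (Aut P) (Aut P)" and \<alpha>s: "\<And>i. i \<in> {0, 2} \<Longrightarrow> \<alpha> (s i) = inv\<^bsub>Aut P\<^esub> s i"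
    by auto
  interpret \<alpha>: group_hom "Aut P" "Aut P" \<alpha> using \<alpha> by unfold_locales (simp add: iso_def)
  let ?A = "carrier (Aut P)"
  have \<alpha>bij: "bij_betw \<alpha> ?A ?A" using \<alpha> by (simp add: iso_def)
  \<comment> \<open>At most one clause applies to a flag because the orbits of \<open>\<Phi>\<close>
    and \<open>\<Phi>1\<close> are disjoint, and \<open>g\<close> is unique because the action is
    free.\<close>
  define \<beta> where "\<beta> X = (THE Y. \<exists>g\<in>?A. X = g ` \<Phi> \<and> Y = \<alpha> g ` \<Phi>1 \<or> X = g ` \<Phi>1 \<and> Y = \<alpha> g ` \<Phi>)" for X
  have \<beta>0: "\<beta> (g ` \<Phi>) = \<alpha> g ` \<Phi>1" if g: "g \<in> ?A" for g
    unfolding \<beta>_def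
  proof (rule the_equality)
    show "\<exists>h\<in>?A. g ` \<Phi> = h ` \<Phi> \<and> \<alpha> g ` \<Phi>1 = \<alpha> h ` \<Phi>1 \<or> g ` \<Phi> = h ` \<Phi>1 \<and> \<alpha> g ` \<Phi>1 = \<alpha> h ` \<Phi>"
      using g by blast
    show "Y = \<alpha> g ` \<Phi>1"
      if "\<exists>h\<in>?A. g ` \<Phi> = h ` \<Phi> \<and> Y = \<alpha> h ` \<Phi>1 \<or> g ` \<Phi> = h ` \<Phi>1 \<and> Y = \<alpha> h ` \<Phi>" for Y
      using that orbits_disjoint[OF g] image_eq_imp_eq[OF g _ \<Phi>] by blast
  qed
  have \<beta>1: "\<beta> (g ` \<Phi>1) = \<alpha> g ` \<Phi>" if g: "g \<in> ?A" for g
    unfolding \<beta>_def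
  proof (rule the_equality)
    show "\<exists>h\<in>?A. g ` \<Phi>1 = h ` \<Phi> \<and> \<alpha> g ` \<Phi> = \<alpha> h ` \<Phi>1 \<or> g ` \<Phi>1 = h ` \<Phi>1 \<and> \<alpha> g ` \<Phi> = \<alpha> h ` \<Phi>"
      using g by blast
    show "Y = \<alpha> g ` \<Phi>"
      if Y: "\<exists>h\<in>?A. g ` \<Phi>1 = h ` \<Phi> \<and> Y = \<alpha> h ` \<Phi>1 \<or> g ` \<Phi>1 = h ` \<Phi>1 \<and> Y = \<alpha> h ` \<Phi>" for Y
    proof -
      obtain h where h: "h \<in> ?A" "g ` \<Phi>1 = h ` \<Phi> \<or> g ` \<Phi>1 = h ` \<Phi>1 \<and> Y = \<alpha> h ` \<Phi>" using Y by blast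
      then have "g ` \<Phi>1 = h ` \<Phi>1 \<and> Y = \<alpha> h ` \<Phi>" using orbits_disjoint[OF h(1) g] by auto
      then show ?thesis using image_eq_imp_eq[OF g h(1) \<Phi>1] by blast
    qed
  qed
  have \<beta>_bij: "bij_betw \<beta> {X. flag P X} {X. flag P X}"
    unfolding bij_betw_def
  proof
    show "inj_on \<beta> {X. flag P X}"
    proof (rule inj_onI)
      fix X Y assume X: "X \<in> {X. flag P X}" and Y: "Y \<in> {X. flag P X}" and eq: "\<beta> X = \<beta> Y"
      have inj: "g = h" if "\<alpha> g = \<alpha> h" "g \<in> ?A" "h \<in> ?A" for g h
        using \<alpha>bij that by (meson bij_betw_imp_inj_on inj_onD)
      have "flag P X" "flag P Y" using X Y by auto
      then show "X = Y"
      proof (elim flag_cases)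
        fix g h assume gh: "g \<in> ?A" "h \<in> ?A" "X = g ` \<Phi>" "Y = h ` \<Phi>"
        then have "\<alpha> g = \<alpha> h" using eq \<beta>0 image_eq_imp_eq[OF \<alpha>.hom_closed \<alpha>.hom_closed \<Phi>1] by simp
        then have "g = h" by (rule inj[OF _ gh(1,2)])
        then show "X = Y" using gh by simp
      next
        fix g h assume gh: "g \<in> ?A" "h \<in> ?A" "X = g ` \<Phi>" "Y = h ` \<Phi>1"
        then have "\<alpha> h ` \<Phi> = \<alpha> g ` \<Phi>1" using eq \<beta>0 \<beta>1 by simp
        then show "X = Y" using orbits_disjoint gh \<alpha>.hom_closed by blast
      next
        fix g h assume gh: "g \<in> ?A" "h \<in> ?A" "X = g ` \<Phi>1" "Y = h ` \<Phi>"
        then have "\<alpha> g ` \<Phi> = \<alpha> h ` \<Phi>1" using eq \<beta>0 \<beta>1 by simp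
        then show "X = Y" using orbits_disjoint gh \<alpha>.hom_closed by blast
      next
        fix g h assume gh: "g \<in> ?A" "h \<in> ?A" "X = g ` \<Phi>1" "Y = h ` \<Phi>1"
        then have "\<alpha> g = \<alpha> h" using eq \<beta>1 image_eq_imp_eq[OF \<alpha>.hom_closed \<alpha>.hom_closed \<Phi>] by simp
        then have "g = h" by (rule inj[OF _ gh(1,2)])
        then show "X = Y" using gh by simp
      qed
    qed
    show "\<beta> ` {X. flag P X} = {X. flag P X}"
    proof
      show "\<beta> ` {X. flag P X} \<subseteq> {X. flag P X}"
      proof
        fix Y assume "Y \<in> \<beta> ` {X. flag P X}"
        then obtain X where X: "flag P X" "Y = \<beta> X" by blast
        show "Y \<in> {X. flag P X}"
          using X(1)
        proof (rule flag_cases)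
          fix g assume "g \<in> ?A" "X = g ` \<Phi>"
          then show ?thesis using X(2) \<beta>0 Aut_flag[OF \<alpha>.hom_closed \<Phi>1] by simp
        next
          fix g assume "g \<in> ?A" "X = g ` \<Phi>1"
          then show ?thesis using X(2) \<beta>1 Aut_flag[OF \<alpha>.hom_closed \<Phi>] by simp
        qed
      qed
      show "{X. flag P X} \<subseteq> \<beta> ` {X. flag P X}"
      proof
        fix Y assume "Y \<in> {X. flag P X}"
        then have "flag P Y" by simp
        then show "Y \<in> \<beta> ` {X. flag P X}"
        proof (rule flag_cases)
          fix h assume h: "h \<in> ?A" "Y = h ` \<Phi>"
          then obtain g where g: "g \<in> ?A" "h = \<alpha> g" using bij_betw_imp_surj_on[OF \<alpha>bij] by blast
          have "Y = \<beta> (g ` \<Phi>1)" using \<beta>1[OF g(1)] g h by simp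
          then show ?thesis using Aut_flag[OF g(1) \<Phi>1] by blast
        next
          fix h assume h: "h \<in> ?A" "Y = h ` \<Phi>1"
          then obtain g where g: "g \<in> ?A" "h = \<alpha> g" using bij_betw_imp_surj_on[OF \<alpha>bij] by blast
          have "Y = \<beta> (g ` \<Phi>)" using \<beta>0[OF g(1)] g h by simp
          then show ?thesis using Aut_flag[OF g(1) \<Phi>] by blast
        qed
      qed
    qed
  qed
  \<comment> \<open>In ranks 0 and 2 the exchange of the orbits swaps \<open>s i\<close> with its
    inverse in \<open>adj_image\<close>, and \<open>\<alpha>\<close> swaps them back.\<close>
  have \<beta>_adj: "\<beta> (adj_flag P i X) = adj_flag P i (\<beta> X)" if X: "flag P X" and i: "i \<in> {0, 1, 2}" for X i
  proof (cases "i = 1")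
    case True
    show ?thesis
      using X
    proof (rule flag_cases)
      fix g assume g: "g \<in> ?A" "X = g ` \<Phi>"
      then show ?thesis
        using True \<beta>0 \<beta>1 adj_image(3)[OF g(1), of 0] adj_image(4)[OF \<alpha>.hom_closed[OF g(1)], of 0] by simp
    next
      fix g assume g: "g \<in> ?A" "X = g ` \<Phi>1"
      then show ?thesis
        using True \<beta>0 \<beta>1 adj_image(4)[OF g(1), of 0] adj_image(3)[OF \<alpha>.hom_closed[OF g(1)], of 0] by simp
    qed
  next
    case False
    then have i': "i \<in> {0, 2}" using i by blast
    note si = s_Aut[OF i']
    have sinv: "\<alpha> (inv\<^bsub>Aut P\<^esub> s i) = s i" using \<alpha>.hom_inv[OF si] \<alpha>s[OF i'] si by simp
    show ?thesis
      using X
    proof (rule flag_cases)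
      fix g assume g: "g \<in> ?A" "X = g ` \<Phi>"
      have "\<beta> (adj_flag P i X) = \<alpha> (inv\<^bsub>Aut P\<^esub> s i \<cdot> g) ` \<Phi>"
        using g adj_image(1)[OF g(1) i'] \<beta>1 si by simp
      also have "\<dots> = (s i \<cdot> \<alpha> g) ` \<Phi>" using \<alpha>.hom_mult g si sinv by simp
      also have "\<dots> = adj_flag P i (\<beta> X)" using adj_image(2)[OF \<alpha>.hom_closed[OF g(1)] i'] \<beta>0 g by simp
      finally show ?thesis .
    next
      fix g assume g: "g \<in> ?A" "X = g ` \<Phi>1"
      have "\<beta> (adj_flag P i X) = \<alpha> (s i \<cdot> g) ` \<Phi>1"
        using g adj_image(2)[OF g(1) i'] \<beta>0 si by simp
      also have "\<dots> = (inv\<^bsub>Aut P\<^esub> s i \<cdot> \<alpha> g) ` \<Phi>1" using \<alpha>.hom_mult g si \<alpha>s[OF i'] by simp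
      also have "\<dots> = adj_flag P i (\<beta> X)" using adj_image(1)[OF \<alpha>.hom_closed[OF g(1)] i'] \<beta>1 g by simp
      finally show ?thesis .
    qed
  qed
  obtain \<gamma> where \<gamma>: "\<gamma> \<in> ?A" "\<And>X. flag P X \<Longrightarrow> \<gamma> ` X = \<beta> X"
    using flag_bijection_induced[OF \<beta>_bij \<beta>_adj] by blast
  have "\<gamma> ` \<Phi> = \<beta> (\<one>\<^bsub>Aut P\<^esub> ` \<Phi>)" using \<gamma>(2)[OF \<Phi>] image_one[OF \<Phi>] by simp
  also have "\<dots> = \<Phi>1" using \<beta>0[OF Aut.one_closed] image_one[OF \<Phi>1] by simp
  finally show False using not_adj[OF \<gamma>(1) \<Phi>, of 1] by simp
qed

end

section \<open>The type read off from the orders of the generators\<close>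

theorem theorem1p2:
  fixes p m k1 k2 :: nat
    and P :: "'a ranked_poset"
    and G :: "('a \<Rightarrow> 'a) monoid"
    and \<sigma>1 \<sigma>2 :: "'a \<Rightarrow> 'a"
    and \<Phi> :: "'a set"
  assumes "prime p" and "odd p"
    and "m = 3 \<or> m = 4"
    and "group G" and "order G = 2 * p ^ m"
    and "polyhedron P" and "chiral P" and "has_type P k1 k2"
    and "G = Aut P" and "flag P \<Phi>" and "distinguished_generators P \<Phi> \<sigma>1 \<sigma>2"
  shows "tight P \<and> k1 * k2 = 2 * p ^ m"
proof -
  interpret polyhedron P by fact
  interpret A: group "Aut P" by (rule group_Aut)
  have \<sigma>: "\<sigma>1 \<in> carrier (Aut P)" "\<sigma>1 ` \<Phi> = adj_flag P 0 (adj_flag P 1 \<Phi>)"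
    "\<sigma>2 \<in> carrier (Aut P)" "\<sigma>2 ` \<Phi> = adj_flag P 1 (adj_flag P 2 \<Phi>)"
    using assms(11) unfolding distinguished_generators_def by auto
  note fl = \<open>flag P \<Phi>\<close>
  have adj: "flag P (adj_flag P i \<Phi>)" if "i \<in> {0, 1, 2}" for i using adj_flag(1)[OF fl that] .
  have s0: "\<sigma>1 ` adj_flag P 0 \<Phi> = adj_flag P 1 \<Phi>"
    using Aut_adj_flag[OF \<sigma>(1) fl, of 0] \<sigma>(2) adj_flag_involution[OF adj[of 1], of 0] by simp
  have s1: "\<sigma>2 ` adj_flag P 1 \<Phi> = adj_flag P 2 \<Phi>"
    using Aut_adj_flag[OF \<sigma>(3) fl, of 1] \<sigma>(4) adj_flag_involution[OF adj[of 2], of 1] by simp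
  have s2: "(inv\<^bsub>Aut P\<^esub> \<sigma>2) ` adj_flag P 2 \<Phi> = adj_flag P 1 \<Phi>"
  proof -
    have "(\<sigma>2 \<otimes>\<^bsub>Aut P\<^esub> inv\<^bsub>Aut P\<^esub> \<sigma>2) ` adj_flag P 1 \<Phi> = (inv\<^bsub>Aut P\<^esub> \<sigma>2) ` adj_flag P 2 \<Phi>"
      using Aut_mult_image[OF flag_subset[OF adj[of 1]]] s1 by simp
    moreover have "\<one>\<^bsub>Aut P\<^esub> ` adj_flag P 1 \<Phi> = adj_flag P 1 \<Phi>"
      unfolding Aut_one using flag_subset[OF adj[of 1]] by fastforce
    ultimately show ?thesis using \<sigma>(3) by simp
  qed
  \<comment> \<open>By \<open>s1\<close>, \<open>\<sigma>2\<close> takes the 1-adjacent flag to the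
    2-adjacent one; its inverse has the direction required of \<open>s 2\<close>.\<close>
  define s where "s i = (if i = (0::int) then \<sigma>1 else inv\<^bsub>Aut P\<^esub> \<sigma>2)" for i
  interpret C: chiral_polyhedron P \<Phi> s
    by unfold_locales (use assms(7) fl \<sigma> s0 s2 in \<open>auto simp: s_def\<close>)
  have order: "order (Aut P) = 2 * p ^ m" using assms by simp
  have c: "s 0 \<in> carrier (Aut P)" "s 2 \<in> carrier (Aut P)" using C.s_Aut by auto
  have tight: "A.ord (s 0) * A.ord (s 2) = 2 * p ^ m"
    by (rule A.order_2pm_tight[OF assms(1-3) order c C.s_involution(2) C.generate_s C.s_involution(1)
          C.s_intersection C.no_inverting_automorphism])
  have r: "(0::int) \<in> ranks" "(1::int) \<in> ranks" "(2::int) \<in> ranks" by auto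
  \<comment> \<open>Ranks fix the direction in \<open>comparable\<close>: an edge can only lie below
    a face of rank 2 and, later, above a vertex.\<close>
  have "edges_of_face P (face \<Phi> 2) = {E \<in> faces P. rk P E = 1 \<and> comparable E (face \<Phi> 2)}"
    unfolding edges_of_face_def using face(2)[OF fl r(3)] lt_rk by fastforce
  then have "card (edges_of_face P (face \<Phi> 2)) = A.ord (s 0)" using C.card_edges[of 0] by simp
  moreover have "card (edges_of_face P (face \<Phi> 2)) = k1"
    using assms(8) face(2,3)[OF fl r(3)] unfolding has_type_def by blast
  moreover have "edges_at_vertex P (face \<Phi> 0) = {E \<in> faces P. rk P E = 1 \<and> comparable E (face \<Phi> 0)}"
    unfolding edges_at_vertex_def using face(2)[OF fl r(1)] lt_rk by fastforce
  then have "card (edges_at_vertex P (face \<Phi> 0)) = A.ord (s 2)" using C.card_edges[of 2] by simp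
  moreover have "card (edges_at_vertex P (face \<Phi> 0)) = k2"
    using assms(8) face(2,3)[OF fl r(1)] unfolding has_type_def by blast
  ultimately have k: "k1 * k2 = 2 * p ^ m" using tight by simp
  have "finite (carrier (Aut P))"
    using order assms(1) A.order_gt_0_iff_finite by (simp add: prime_gt_0_nat)
  then show ?thesis unfolding tight_def using assms(8) order k by metis
qed

end
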